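(* Let $0<\delta<1$, let $w\in A_s$, let $\mathcal A$ satisfy the structural conditions listed in the context, and let $f\ge0$, $f\not\equiv0$, be a measurable function on $\Omega$. Let $u$ be the weak solution in $X=W_0^{1,p}(\Omega,w)$ of $$-\operatorname{div}(\mathcal A(x,\nabla u))=\frac{f(x)}{u^\delta}\ \text{in }\Omega,\qquad u>0\ \text{in }\Omega,\qquad u=0\ \text{on }\partial\Omega$$ obtained as the limit of the approximating solutions $u_n$ (see context). Then: (a) Suppose $1\le p_s<N$. (i) If $f\in L^m(\Omega)$ for some $m\in\left[\left(\frac{p_s^*}{1-\delta}\right)',\frac{p_s^*}{p_s^*-p}\right)$, then $u\in L^t(\Omega)$ with $t=p_s^*\gamma$, where $\gamma=\frac{(\delta+p-1)m'}{pm'-p_s^*}$. (ii) If $f\in L^m(\Omega)$ for some $m>\frac{p_s^*}{p_s^*-p}$, then $u\in L^\infty(\Omega)$. (b) Suppose $p_s=N$ and let $q>p$. If $f\in L^m(\Omega)$ for some $m\in\left(\left(\frac q{1-\delta}\right)',\frac q{q-p}\right)$, then $u\in L^t(\Omega)$ with $t=q\gamma$, where $\gamma=\frac{(\delta+p-1)m'}{pm'-q}$. (c) If $p_s>N$ and $f\in L^1(\Omega)$, then $u\in L^\infty(\Omega)$.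
   Context: Setting: $N\ge 2$, $\Omega\subset\mathbb R^N$ is a bounded smooth domain, $1<p<\infty$. Weights: a locally integrable $w:\mathbb R^N\to(0,\infty)$ (with $0<w<\infty$ a.e.) belongs to $A_p$ if there is $c_{p,w}>0$ such that $\left(\frac1{|B|}\int_B w\,dx\right)\left(\frac1{|B|}\int_B w^{-\frac1{p-1}}dx\right)^{p-1}\le c_{p,w}$ for all balls $B\subset\mathbb R^N$. Fix $s\in[\frac1{p-1},\infty)\cap(\frac Np,\infty)$; $w\in A_s$ means $w\in A_p$ and $w^{-s}\in L^1(\Omega)$. Set $p_s=\frac{ps}{s+1}\in[1,p)$ and, if $p_s<N$, $p_s^*=\frac{Np_s}{N-p_s}$ (then $p_s^*>p$). For an exponent $r$, $r'$ is the Hölder conjugate. Spaces: $W^{1,p}(\Omega,w)$ is the space of (weakly differentiable) measurable $u$ with $\|u\|_{1,p,w}=(\int_\Omega|u|^pw\,dx)^{1/p}+(\int_\Omega|\nabla u|^pw\,dx)^{1/p}<\infty$; $X=W^{1,p}_0(\Omega,w)$ is the closure of $C_c^\infty(\Omega)$ in it, and $\left(\int_\Omega|\nabla u|^pw\,dx\right)^{1/p}$ is an equivalent norm on $X$. $u\in W^{1,p}_{loc}(\Omega,w)$ means $u\in W^{1,p}(\Omega',w)$ for every $\Omega'\Subset\Omega$. Operator: $\mathcal A:\Omega\times\mathbb R^N\to\mathbb R^N$ is Carathéodory ($\mathcal A(\cdot,\zeta)$ measurable for every $\zeta$; $\mathcal A(x,\cdot)$ continuous for a.e. $x$), and for a.e.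 $x\in\Omega$ and all vectors in $\mathbb R^N$: (growth) $|\mathcal A(x,\zeta)|\le|\zeta|^{p-1}w(x)$; (degeneracy) $\mathcal A(x,\zeta)\cdot\zeta\ge|\zeta|^pw(x)$; (homogeneity) $\mathcal A(x,t\zeta)=t|t|^{p-2}\mathcal A(x,\zeta)$ for $t\in\mathbb R\setminus\{0\}$; (strong monotonicity) with $\gamma_0=\max\{p,2\}$ and some constant $c>0$, for $\zeta_1\ne\zeta_2$, $\langle\mathcal A(x,\zeta_1)-\mathcal A(x,\zeta_2),\zeta_1-\zeta_2\rangle\ge c|\zeta_1-\zeta_2|^{\gamma_0}\{\overline{\mathcal A}(x,\zeta_1,\zeta_2)\}^{1-\frac{\gamma_0}p}w(x)$, where $\overline{\mathcal A}(x,\zeta_1,\zeta_2)=\frac1{w(x)}(\langle\mathcal A(x,\zeta_1),\zeta_1\rangle+\langle\mathcal A(x,\zeta_2),\zeta_2\rangle)$. Weak solution: $u\in W^{1,p}_{loc}(\Omega,w)$ is a weak solution of the problem if for every $K\Subset\Omega$ there is $c_K>0$ with $u\ge c_K$ in $K$; for all $\phi\in C_c^1(\Omega)$, $\int_\Omega\mathcal A(x,\nabla u)\cdot\nabla\phi\,dx=\int_\Omega\frac{f}{u^\delta}\phi\,dx$; $u>0$ in $\Omega$; and $u=0$ on $\partial\Omega$ in the sense that $u^\alpha\in X$ for some $\alpha\ge1$. Approximating solutions: for $n\in\mathbb N$ let $f_n=\min\{f,n\}$. There is a unique $u_n\in X\cap L^\infty(\Omega)$ with $u_n>0$ in $\Omega$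 and $\int_\Omega\mathcal A(x,\nabla u_n)\cdot\nabla\phi\,dx=\int_\Omega\frac{f_n}{(u_n+\frac1n)^\delta}\phi\,dx$ for all $\phi\in X$; moreover $u_n\le u_{n+1}$. The solution $u$ in the claim is the pointwise a.e. limit of $u_n$; it is a weak solution in $X$ whenever $f\in L^{(p_s^*/(1-\delta))'}(\Omega)$ if $p_s<N$, $f\in L^m(\Omega)$ for some $m>1$ if $p_s=N$, or $f\in L^1(\Omega)$ if $p_s>N$. *)

theory Defs
  imports "HOL-Analysis.Analysis"
begin

subsection \<open>Smooth functions, test functions and smooth domains\<close>

definition gradient :: "('a::euclidean_space \<Rightarrow> real) \<Rightarrow> 'a \<Rightarrow> 'a" where
  "gradient f x = (THE D. GDERIV f x :> D)"

text \<open>Intended for open sets \<open>S\<close>.\<close>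

primrec Ck_on :: "nat \<Rightarrow> 'a::euclidean_space set \<Rightarrow> ('a \<Rightarrow> real) \<Rightarrow> bool" where
  "Ck_on 0 S f \<longleftrightarrow> continuous_on S f"
| "Ck_on (Suc k) S f \<longleftrightarrow>
     (\<forall>x\<in>S. GDERIV f x :> gradient f x) \<and> (\<forall>b\<in>Basis. Ck_on k S (\<lambda>x. gradient f x \<bullet> b))"

definition smooth_on :: "'a::euclidean_space set \<Rightarrow> ('a \<Rightarrow> real) \<Rightarrow> bool" where
  "smooth_on S f \<longleftrightarrow> (\<forall>k. Ck_on k S f)"

definition compactly_inside :: "'a::topological_space set \<Rightarrow> 'a set \<Rightarrow> bool" where
  "compactly_inside K \<Omega> \<longleftrightarrow> compact (closure K) \<and> closure K \<subseteq> \<Omega>"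

text \<open>Compactly supported functions on \<open>\<Omega>\<close> are represented by their extension by zero.\<close>

definition Cc1 :: "'a::euclidean_space set \<Rightarrow> ('a \<Rightarrow> real) set" where
  "Cc1 \<Omega> = {\<phi>. Ck_on 1 UNIV \<phi> \<and> compactly_inside {x. \<phi> x \<noteq> 0} \<Omega>}"

definition Cc_infinity :: "'a::euclidean_space set \<Rightarrow> ('a \<Rightarrow> real) set" where
  "Cc_infinity \<Omega> = {\<phi>. smooth_on UNIV \<phi> \<and> compactly_inside {x. \<phi> x \<noteq> 0} \<Omega>}"

text \<open>Smoothness of the boundary is expressed by local defining functions.\<close>

definition bounded_smooth_domain :: "'a::euclidean_space set \<Rightarrow> bool" where
  "bounded_smooth_domain \<Omega> \<longleftrightarrow>
     open \<Omega> \<and> connected \<Omega> \<and> \<Omega> \<noteq> {} \<and> bounded \<Omega> \<and>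
     (\<forall>x\<in>frontier \<Omega>. \<exists>U \<rho>. open U \<and> x \<in> U \<and> smooth_on U \<rho> \<and>
        (\<forall>y\<in>U. gradient \<rho> y \<noteq> 0) \<and> \<Omega> \<inter> U = {y \<in> U. \<rho> y < 0})"

subsection \<open>Lebesgue classes and weights\<close>

definition Lp :: "'a::euclidean_space set \<Rightarrow> real \<Rightarrow> ('a \<Rightarrow> real) set" where
  "Lp \<Omega> m = {u \<in> borel_measurable (lebesgue_on \<Omega>). integrable (lebesgue_on \<Omega>) (\<lambda>x. \<bar>u x\<bar> powr m)}"

definition Linfinity :: "'a::euclidean_space set \<Rightarrow> ('a \<Rightarrow> real) set" where
  "Linfinity \<Omega> = {u \<in> borel_measurable (lebesgue_on \<Omega>). \<exists>C. AE x in lebesgue_on \<Omega>. \<bar>u x\<bar> \<le> C}"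

definition locally_integrable_on ::
    "('a::euclidean_space \<Rightarrow> 'b::euclidean_space) \<Rightarrow> 'a set \<Rightarrow> bool" where
  "locally_integrable_on f \<Omega> \<longleftrightarrow> (\<forall>K. compact K \<and> K \<subseteq> \<Omega> \<longrightarrow> integrable (lebesgue_on K) f)"

text \<open>The integrability requirement makes the second average in the Muckenhoupt condition finite;
  it is needed because the Bochner integral of a non-integrable function is \<open>0\<close>.\<close>

definition Ap_weight :: "real \<Rightarrow> ('a::euclidean_space \<Rightarrow> real) \<Rightarrow> bool" where
  "Ap_weight p w \<longleftrightarrow>
     (AE x in lebesgue. 0 < w x) \<and> locally_integrable_on w UNIV \<and>
     (\<exists>c>0. \<forall>y r. 0 < r \<longrightarrow>
        integrable (lebesgue_on (ball y r)) (\<lambda>x. w x powr (- 1 / (p - 1))) \<and>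
        ((LINT x|lebesgue_on (ball y r). w x) / measure lebesgue (ball y r)) *
        ((LINT x|lebesgue_on (ball y r). w x powr (- 1 / (p - 1))) / measure lebesgue (ball y r))
          powr (p - 1) \<le> c)"

definition As_weight :: "'a::euclidean_space set \<Rightarrow> real \<Rightarrow> real \<Rightarrow> ('a \<Rightarrow> real) \<Rightarrow> bool" where
  "As_weight \<Omega> p s w \<longleftrightarrow> Ap_weight p w \<and> integrable (lebesgue_on \<Omega>) (\<lambda>x. w x powr (- s))"

subsection \<open>Weighted Sobolev spaces\<close>

definition has_weak_gradient ::
    "'a::euclidean_space set \<Rightarrow> ('a \<Rightarrow> real) \<Rightarrow> ('a \<Rightarrow> 'a) \<Rightarrow> bool" where
  "has_weak_gradient \<Omega> u g \<longleftrightarrow>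
     locally_integrable_on u \<Omega> \<and> locally_integrable_on g \<Omega> \<and>
     (\<forall>\<phi>\<in>Cc_infinity \<Omega>. \<forall>b\<in>Basis.
        (LINT x|lebesgue_on \<Omega>. u x * (gradient \<phi> x \<bullet> b)) =
        - (LINT x|lebesgue_on \<Omega>. (g x \<bullet> b) * \<phi> x))"

text \<open>The weak gradient is unique up to null sets, so the choice below is immaterial.\<close>

definition weak_gradient :: "'a::euclidean_space set \<Rightarrow> ('a \<Rightarrow> real) \<Rightarrow> 'a \<Rightarrow> 'a" where
  "weak_gradient \<Omega> u = (SOME g. has_weak_gradient \<Omega> u g)"

definition W1p :: "'a::euclidean_space set \<Rightarrow> real \<Rightarrow> ('a \<Rightarrow> real) \<Rightarrow> ('a \<Rightarrow> real) set" where
  "W1p \<Omega> p w = {u \<in> borel_measurable (lebesgue_on \<Omega>).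
     (\<exists>g. has_weak_gradient \<Omega> u g) \<and>
     integrable (lebesgue_on \<Omega>) (\<lambda>x. \<bar>u x\<bar> powr p * w x) \<and>
     integrable (lebesgue_on \<Omega>) (\<lambda>x. norm (weak_gradient \<Omega> u x) powr p * w x)}"

definition W1p_norm :: "'a::euclidean_space set \<Rightarrow> real \<Rightarrow> ('a \<Rightarrow> real) \<Rightarrow> ('a \<Rightarrow> real) \<Rightarrow> real" where
  "W1p_norm \<Omega> p w u =
     (LINT x|lebesgue_on \<Omega>. \<bar>u x\<bar> powr p * w x) powr (1 / p) +
     (LINT x|lebesgue_on \<Omega>. norm (weak_gradient \<Omega> u x) powr p * w x) powr (1 / p)"

definition W1p_0 :: "'a::euclidean_space set \<Rightarrow> real \<Rightarrow> ('a \<Rightarrow> real) \<Rightarrow> ('a \<Rightarrow> real) set" where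
  "W1p_0 \<Omega> p w =
     {u \<in> W1p \<Omega> p w. \<forall>\<epsilon>>0. \<exists>\<phi>\<in>Cc_infinity \<Omega>. W1p_norm \<Omega> p w (\<lambda>x. u x - \<phi> x) < \<epsilon>}"

definition W1p_loc :: "'a::euclidean_space set \<Rightarrow> real \<Rightarrow> ('a \<Rightarrow> real) \<Rightarrow> ('a \<Rightarrow> real) set" where
  "W1p_loc \<Omega> p w = {u. \<forall>\<Omega>'. open \<Omega>' \<and> compactly_inside \<Omega>' \<Omega> \<longrightarrow> u \<in> W1p \<Omega>' p w}"

subsection \<open>The operator and the notions of solution\<close>

definition structure_conditions ::
    "'a::euclidean_space set \<Rightarrow> real \<Rightarrow> ('a \<Rightarrow> real) \<Rightarrow> ('a \<Rightarrow> 'a \<Rightarrow> 'a) \<Rightarrow> bool" where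
  "structure_conditions \<Omega> p w A \<longleftrightarrow>
     (\<forall>\<zeta>. (\<lambda>x. A x \<zeta>) \<in> borel_measurable (lebesgue_on \<Omega>)) \<and>
     (AE x in lebesgue_on \<Omega>. continuous_on UNIV (A x)) \<and>
     (AE x in lebesgue_on \<Omega>. \<forall>\<zeta>. norm (A x \<zeta>) \<le> norm \<zeta> powr (p - 1) * w x) \<and>
     (AE x in lebesgue_on \<Omega>. \<forall>\<zeta>. A x \<zeta> \<bullet> \<zeta> \<ge> norm \<zeta> powr p * w x) \<and>
     (AE x in lebesgue_on \<Omega>. \<forall>\<zeta> t. t \<noteq> 0 \<longrightarrow>
        A x (t *\<^sub>R \<zeta>) = (t * \<bar>t\<bar> powr (p - 2)) *\<^sub>R A x \<zeta>) \<and>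
     (\<exists>c>0. AE x in lebesgue_on \<Omega>. \<forall>\<zeta>1 \<zeta>2. \<zeta>1 \<noteq> \<zeta>2 \<longrightarrow>
        (A x \<zeta>1 - A x \<zeta>2) \<bullet> (\<zeta>1 - \<zeta>2) \<ge>
          c * norm (\<zeta>1 - \<zeta>2) powr (max p 2) *
          ((A x \<zeta>1 \<bullet> \<zeta>1 + A x \<zeta>2 \<bullet> \<zeta>2) / w x) powr (1 - max p 2 / p) * w x)"

definition weak_solution ::
    "'a::euclidean_space set \<Rightarrow> real \<Rightarrow> ('a \<Rightarrow> real) \<Rightarrow> ('a \<Rightarrow> 'a \<Rightarrow> 'a) \<Rightarrow>
     real \<Rightarrow> ('a \<Rightarrow> real) \<Rightarrow> ('a \<Rightarrow> real) \<Rightarrow> bool" where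
  "weak_solution \<Omega> p w A \<delta> f u \<longleftrightarrow>
     u \<in> W1p_loc \<Omega> p w \<and>
     (\<forall>K. compactly_inside K \<Omega> \<longrightarrow> (\<exists>c>0. AE x in lebesgue. x \<in> K \<longrightarrow> c \<le> u x)) \<and>
     (\<forall>\<phi>\<in>Cc1 \<Omega>.
        integrable (lebesgue_on \<Omega>) (\<lambda>x. A x (weak_gradient \<Omega> u x) \<bullet> gradient \<phi> x) \<and>
        integrable (lebesgue_on \<Omega>) (\<lambda>x. f x / u x powr \<delta> * \<phi> x) \<and>
        (LINT x|lebesgue_on \<Omega>. A x (weak_gradient \<Omega> u x) \<bullet> gradient \<phi> x) =
        (LINT x|lebesgue_on \<Omega>. f x / u x powr \<delta> * \<phi> x)) \<and>
     (AE x in lebesgue_on \<Omega>. 0 < u x) \<and>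
     (\<exists>\<alpha>\<ge>1. (\<lambda>x. u x powr \<alpha>) \<in> W1p_0 \<Omega> p w)"

definition approx_solution ::
    "'a::euclidean_space set \<Rightarrow> real \<Rightarrow> ('a \<Rightarrow> real) \<Rightarrow> ('a \<Rightarrow> 'a \<Rightarrow> 'a) \<Rightarrow>
     real \<Rightarrow> ('a \<Rightarrow> real) \<Rightarrow> nat \<Rightarrow> ('a \<Rightarrow> real) \<Rightarrow> bool" where
  "approx_solution \<Omega> p w A \<delta> f n v \<longleftrightarrow>
     v \<in> W1p_0 \<Omega> p w \<inter> Linfinity \<Omega> \<and>
     (AE x in lebesgue_on \<Omega>. 0 < v x) \<and>
     (\<forall>\<phi>\<in>W1p_0 \<Omega> p w.
        integrable (lebesgue_on \<Omega>) (\<lambda>x. A x (weak_gradient \<Omega> v x) \<bullet> weak_gradient \<Omega> \<phi> x) \<and>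
        integrable (lebesgue_on \<Omega>) (\<lambda>x. min (f x) (real n) / (v x + 1 / real n) powr \<delta> * \<phi> x) \<and>
        (LINT x|lebesgue_on \<Omega>. A x (weak_gradient \<Omega> v x) \<bullet> weak_gradient \<Omega> \<phi> x) =
        (LINT x|lebesgue_on \<Omega>. min (f x) (real n) / (v x + 1 / real n) powr \<delta> * \<phi> x))"

subsection \<open>Exponents\<close>

definition conj_exp :: "real \<Rightarrow> real" where
  "conj_exp r = r / (r - 1)"

definition p_sub :: "real \<Rightarrow> real \<Rightarrow> real" where
  "p_sub p s = p * s / (s + 1)"

definition sobolev_exp :: "real \<Rightarrow> real \<Rightarrow> real" where
  "sobolev_exp N r = N * r / (N - r)"

text \<open>The factor \<open>\<gamma>\<close>; \<open>q\<close> is the exponent of the Sobolev embedding of the space \<open>W1p_0\<close>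
  into \<open>L\<^sup>q\<close>, and the resulting integrability exponent of the solution is \<open>q * \<gamma>\<close>.\<close>

definition gain :: "real \<Rightarrow> real \<Rightarrow> real \<Rightarrow> real \<Rightarrow> real" where
  "gain \<delta> p m q = (\<delta> + p - 1) * conj_exp m / (p * conj_exp m - q)"

end

theory Submission
  imports Defs
begin

text \<open>
  Testing the approximating problem with \<open>u\<^sub>n\<close> raised to the power \<open>p (\<gamma> - 1) + 1\<close> and
  estimating the right-hand side by Hoelder's inequality bounds the \<open>L\<^sup>q\<close> norm of the power \<open>\<gamma>\<close>
  of \<open>u\<^sub>n\<close> by a smaller power of itself, hence by a constant independent of \<open>n\<close>; testing with
  the truncations \<open>(u\<^sub>n - k)\<^sup>+\<close> and iterating over the levels \<open>k\<close> as Stampacchia does gives uniform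
  \<open>L\<^sup>\<infinity>\<close> bounds. Fatou's lemma passes to the limit.

  All embeddings reduce to the Gagliardo-Nirenberg inequality for \<open>W\<^sup>1\<^sup>,\<^sup>1\<close>: since \<open>w\<close> raised to \<open>-s\<close>
  is integrable, weighted gradients are in \<open>L\<^sup>r\<close> with \<open>r = p_s\<close>, and applying the inequality to powers of a
  function gives the Sobolev inequality for \<open>r < N\<close>, while applying it to truncations gives boundedness
  for \<open>r > N\<close>. Powers and truncations are admissible by a chain rule in \<open>W1p_0\<close>: composing the
  approximating test functions with smooth functions of bounded derivative stays inside the test
  functions, and general nonlinearities follow by the Stone-Weierstrass theorem and dominated convergence.
\<close>

subsection \<open>Smooth functions\<close>

text \<open>The test exponent \<beta> = p (\<gamma> - 1) + 1 makes v^(\<beta> - 1) |grad v|^p a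
  multiple of |grad v^\<gamma>|^p, so ellipticity and the embedding into L^q bound I^(p/q), where I
  is the integral of v^(q \<gamma>). Hoelder applied to f v^(\<beta> - \<delta>) returns I^(1/m')
  precisely when q \<gamma> = m' (\<beta> - \<delta>), and \<open>gain\<close> solves this equation.
  The condition m < q/(q - p) says 1/m' < p/q, so that I can be absorbed; m \<ge> (q/(1 -
  \<delta>))' says \<gamma> \<ge> 1, so that the powers are admissible. For m > q/(q - p) the
  recursion for the measures of the level sets has an exponent above 1, which is what Stampacchia's
  iteration requires. The obstacle is that \<open>weak_gradient\<close> is a choice, fixed only up
  to null sets, and that the norm behind \<open>W1p_0\<close> involves this choice for every
  difference u - \<phi>. The analysis therefore takes place in \<open>X\<close>, where limits are
  plain limits in a weighted Lebesgue space; integrability of w^(-1/(p - 1)) embeds that space into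
  L^1 and keeps the second component a weak gradient.\<close>

lemma gradient_eqI: "GDERIV f x :> D \<Longrightarrow> gradient f x = D"
  unfolding gradient_def
proof (rule the_equality)
  fix E assume "GDERIV f x :> D" "GDERIV f x :> E"
  then have "(\<lambda>h. h \<bullet> E) = (\<lambda>h. h \<bullet> D)"
    unfolding gderiv_def by (rule has_derivative_unique[rotated])
  then show "E = D"
    by (metis (mono_tags, lifting) inner_commute vector_eq_ldot)
qed

lemma Ck_on_Suc_gderiv: "Ck_on (Suc k) UNIV f \<Longrightarrow> GDERIV f x :> gradient f x"
  by simp

text \<open>Since \<open>gradient\<close> is a definite description, this rule is what lets an
  explicit field G stand in for it.\<close>

lemma Ck_on_SucI:
  assumes "\<And>x. GDERIV f x :> G x" "\<And>b. b \<in> Basis \<Longrightarrow> Ck_on k UNIV (\<lambda>x. G x \<bullet> b)"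
  shows "Ck_on (Suc k) UNIV f"
  using assms gradient_eqI[OF assms(1)] by simp

lemma GDERIV_continuous_on: "(\<And>x. GDERIV f x :> G x) \<Longrightarrow> continuous_on UNIV f"
  by (meson continuous_on_eq_continuous_at gderiv_def has_derivative_continuous open_UNIV)

lemma Ck_on_SucD: "Ck_on (Suc k) UNIV f \<Longrightarrow> Ck_on k UNIV f"
proof (induction k arbitrary: f)
  case 0
  then show ?case by (auto intro: GDERIV_continuous_on)
qed auto

lemma Ck_on_continuous: "Ck_on k UNIV f \<Longrightarrow> continuous_on UNIV f"
  by (induction k) (auto intro: GDERIV_continuous_on)

lemma Ck_on_const: "Ck_on k UNIV (\<lambda>x. c)"
proof (induction k arbitrary: c)
  case (Suc k)
  show ?case by (rule Ck_on_SucI[OF GDERIV_const]) (simp add: Suc)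
qed simp

lemma Ck_on_add: "Ck_on k UNIV f \<Longrightarrow> Ck_on k UNIV g \<Longrightarrow> Ck_on k UNIV (\<lambda>x. f x + g x)"
proof (induction k arbitrary: f g)
  case (Suc k)
  show ?case
    by (rule Ck_on_SucI[OF GDERIV_add[OF Suc.prems[THEN Ck_on_Suc_gderiv]]])
       (use Suc in \<open>auto simp: inner_add_left\<close>)
qed (auto intro: continuous_intros)

lemma Ck_on_mult: "Ck_on k UNIV f \<Longrightarrow> Ck_on k UNIV g \<Longrightarrow> Ck_on k UNIV (\<lambda>x. f x * g x)"
proof (induction k arbitrary: f g)
  case (Suc k)
  show ?case
    by (rule Ck_on_SucI[OF GDERIV_mult[OF Suc.prems[THEN Ck_on_Suc_gderiv]]])
       (use Suc Suc.prems[THEN Ck_on_SucD] in \<open>auto simp: inner_add_left intro!: Ck_on_add\<close>)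
qed (auto intro: continuous_intros)

lemma Ck_on_compose:
  fixes h :: "real \<Rightarrow> real"
  shows "Ck_on k UNIV h \<Longrightarrow> Ck_on k UNIV f \<Longrightarrow> Ck_on k UNIV (\<lambda>x. h (f x))"
proof (induction k arbitrary: f h)
  case (Suc k)
  have "GDERIV (\<lambda>x. h (f x)) x :> gradient h (f x) *\<^sub>R gradient f x" for x
    using Suc.prems by (intro GDERIV_DERIV_compose) (auto simp flip: gderiv_deriv)
  then show ?case
    by (rule Ck_on_SucI) (use Suc Ck_on_SucD in \<open>auto intro!: Ck_on_mult\<close>)
qed (auto intro: continuous_on_compose2)

lemma smooth_on_const: "smooth_on UNIV (\<lambda>x. c)"
  by (simp add: smooth_on_def Ck_on_const)

lemma smooth_on_add: "smooth_on UNIV f \<Longrightarrow> smooth_on UNIV g \<Longrightarrow> smooth_on UNIV (\<lambda>x. f x + g x)"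
  by (simp add: smooth_on_def Ck_on_add)

lemma smooth_on_mult: "smooth_on UNIV f \<Longrightarrow> smooth_on UNIV g \<Longrightarrow> smooth_on UNIV (\<lambda>x. f x * g x)"
  by (simp add: smooth_on_def Ck_on_mult)

lemma smooth_on_compose:
  fixes h :: "real \<Rightarrow> real"
  shows "smooth_on UNIV h \<Longrightarrow> smooth_on UNIV f \<Longrightarrow> smooth_on UNIV (\<lambda>x. h (f x))"
  by (simp add: smooth_on_def Ck_on_compose)

lemma smooth_on_prod:
  "finite I \<Longrightarrow> (\<And>i. i \<in> I \<Longrightarrow> smooth_on UNIV (f i)) \<Longrightarrow> smooth_on UNIV (\<lambda>x. \<Prod>i\<in>I. f i x)"
  by (induction rule: finite_induct) (auto intro: smooth_on_const smooth_on_mult)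

lemma smooth_on_gderiv: "smooth_on UNIV f \<Longrightarrow> GDERIV f x :> gradient f x"
  unfolding smooth_on_def by (meson Ck_on_Suc_gderiv)

lemma smooth_on_continuous: "smooth_on UNIV f \<Longrightarrow> continuous_on S f"
  unfolding smooth_on_def using Ck_on_continuous continuous_on_subset by blast

lemma continuous_on_gradient:
  assumes "Ck_on (Suc k) UNIV f"
  shows "continuous_on S (gradient f)"
proof -
  have *: "continuous_on UNIV (\<lambda>x. gradient f x \<bullet> b)" if "b \<in> Basis" for b
    using assms that by (auto intro: Ck_on_continuous)
  then have "continuous_on UNIV (gradient f)"
    using continuous_on_componentwise[of UNIV "gradient f"] * by blast
  then show ?thesis by (rule continuous_on_subset) simp
qed

lemma smooth_on_continuous_gradient: "smooth_on UNIV f \<Longrightarrow> continuous_on S (gradient f)"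
  unfolding smooth_on_def using continuous_on_gradient by blast

lemma smooth_on_antiderivative:
  fixes h :: "real \<Rightarrow> real"
  assumes "\<And>x. (h has_real_derivative h' x) (at x)" "smooth_on UNIV h'"
  shows "smooth_on UNIV h"
  unfolding smooth_on_def
proof
  fix k
  have "Ck_on (Suc k) UNIV h"
    by (rule Ck_on_SucI[where G = h']) (use assms in \<open>auto simp: smooth_on_def\<close>)
  then show "Ck_on k UNIV h" by (rule Ck_on_SucD)
qed

text \<open>For functions whose successive derivatives are known explicitly, such as exp, sin and
  the flat function. One more order of smoothness of \<open>D n\<close> is one order less of
  \<open>D (Suc n)\<close>, so the induction runs with n arbitrary.\<close>

lemma smooth_on_derivative_sequence:
  fixes D :: "nat \<Rightarrow> real \<Rightarrow> real"
  assumes D: "\<And>n x. (D n has_real_derivative D (Suc n) x) (at x)"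
  shows "smooth_on UNIV (D n)"
proof -
  have "Ck_on k UNIV (D n)" for k
  proof (induction k arbitrary: n)
    case 0
    show ?case using D by (metis Ck_on.simps(1) DERIV_continuous_on has_field_derivative_at_within)
  next
    case (Suc k)
    show ?case by (rule Ck_on_SucI[where G = "D (Suc n)"]) (use D Suc in auto)
  qed
  then show ?thesis by (simp add: smooth_on_def)
qed

lemma smooth_on_linear:
  fixes c :: "'a::euclidean_space"
  shows "smooth_on UNIV (\<lambda>x. x \<bullet> c + d)"
  unfolding smooth_on_def
proof
  fix k
  have "GDERIV (\<lambda>x. x \<bullet> c + d) x :> c" for x
    unfolding gderiv_def by (auto intro!: derivative_eq_intros)
  then have "Ck_on (Suc k) UNIV (\<lambda>x. x \<bullet> c + d)"
    by (rule Ck_on_SucI) (auto intro: Ck_on_const)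
  then show "Ck_on k UNIV (\<lambda>x. x \<bullet> c + d)" by (rule Ck_on_SucD)
qed

lemma smooth_on_exp: "smooth_on UNIV (exp :: real \<Rightarrow> real)"
  using smooth_on_derivative_sequence[of "\<lambda>_. exp" 0] DERIV_exp by blast

lemma smooth_on_sin: "smooth_on UNIV (sin :: real \<Rightarrow> real)"
proof -
  \<comment> \<open>Differentiating the sine is a shift by a quarter period, so the shifted sines
    form a single derivative sequence.\<close>
  have "((\<lambda>x. sin (x + real n * (pi / 2))) has_real_derivative sin (x + real (Suc n) * (pi / 2))) (at x)" for n x
  proof -
    have "sin (x + real (Suc n) * (pi / 2)) = sin ((x + real n * (pi / 2)) + pi / 2)"
      by (simp add: algebra_simps add_divide_distrib)
    also have "\<dots> = cos (x + real n * (pi / 2))"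
      by (simp add: sin_add)
    finally show ?thesis by (auto intro!: derivative_eq_intros)
  qed
  from smooth_on_derivative_sequence[of "\<lambda>n x. sin (x + real n * (pi / 2))", OF this, of 0]
  show ?thesis by simp
qed

text \<open>The classical smooth function that vanishes to infinite order at 0 and is positive
  exactly to the right of it; all bump functions below are made of it.\<close>

definition flat_exp :: "real \<Rightarrow> real" where
  "flat_exp t = (if t > 0 then exp (- 1 / t) else 0)"

lemma flat_exp_nonneg: "0 \<le> flat_exp t"
  by (simp add: flat_exp_def)

text \<open>Substituting x = 1/t turns the claim into the decay of polynomials times exp (- x) at
  infinity.\<close>

lemma tendsto_poly_exp_at_right_0:
  "((\<lambda>t. poly P (1 / t) * exp (- 1 / t)) \<longlongrightarrow> (0::real)) (at_right 0)"
proof -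
  have mono: "((\<lambda>x. x ^ n * exp (- x)) \<longlongrightarrow> (0::real)) at_top" for n
    using tendsto_power_div_exp_0[of n] by (simp add: exp_minus divide_inverse)
  have "((\<lambda>x. poly P x * exp (- x)) \<longlongrightarrow> (\<Sum>i\<le>degree P. coeff P i * 0)) at_top"
    unfolding poly_altdef sum_distrib_right mult.assoc
    by (intro tendsto_sum tendsto_mult tendsto_const mono)
  then have "((\<lambda>x. poly P x * exp (- x)) \<longlongrightarrow> 0) at_top" by simp
  from filterlim_compose[OF this filterlim_inverse_at_top_right]
  show ?thesis by (simp add: divide_inverse)
qed

lemma smooth_on_flat_exp: "smooth_on UNIV flat_exp"
proof -
  \<comment> \<open>The derivative of Q(1/t) exp(-1/t) is (1/t^2) (Q - Q')(1/t) exp(-1/t);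
    multiplication by \<open>[:0, 0, 1:]\<close> is the factor 1/t^2.\<close>
  define Q where "Q = rec_nat [:1:] (\<lambda>_ P. [:0, 0, 1:] * (P - pderiv P) :: real poly)"
  define D where "D n t = (if t > 0 then poly (Q n) (1 / t) * exp (- 1 / t) else 0)" for n and t :: real
  have Q: "Q 0 = [:1:]" "Q (Suc n) = [:0, 0, 1:] * (Q n - pderiv (Q n))" for n
    by (auto simp: Q_def)
  have D0: "D 0 = flat_exp"
    by (auto simp: D_def Q flat_exp_def fun_eq_iff)
  have "(D n has_real_derivative D (Suc n) x) (at x)" for n x
  proof -
    consider "x > 0" | "x < 0" | "x = 0" by linarith
    then show ?thesis
    proof cases
      case 1
      have "((\<lambda>t. poly (Q n) (1 / t) * exp (- 1 / t)) has_real_derivative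
          poly (Q n) (1 / x) * (exp (- 1 / x) * (1 / x\<^sup>2)) +
          poly (pderiv (Q n)) (1 / x) * (- 1 / x\<^sup>2) * exp (- 1 / x)) (at x)"
        using 1 by (auto intro!: derivative_eq_intros DERIV_chain2[OF poly_DERIV]
            simp: power2_eq_square field_simps)
      also have "poly (Q n) (1 / x) * (exp (- 1 / x) * (1 / x\<^sup>2)) +
          poly (pderiv (Q n)) (1 / x) * (- 1 / x\<^sup>2) * exp (- 1 / x) = D (Suc n) x"
        using 1 by (simp add: D_def Q power2_eq_square field_simps)
      finally show ?thesis
        by (rule has_field_derivative_transform_within_open[OF _ open_greaterThan[of 0]])
           (use 1 in \<open>auto simp: D_def\<close>)
    next
      case 2
      have "((\<lambda>x. 0) has_real_derivative 0) (at x)" by simp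
      then have "(D n has_real_derivative 0) (at x)"
        by (rule has_field_derivative_transform_within_open[OF _ open_lessThan[of 0]])
           (use 2 in \<open>auto simp: D_def\<close>)
      then show ?thesis using 2 by (simp add: D_def)
    next
      case 3
      \<comment> \<open>The difference quotient at 0 has the same shape as \<open>D n\<close>, with
        the polynomial multiplied once more by its variable.\<close>
      have r: "((\<lambda>t. D n t / t) \<longlongrightarrow> 0) (at_right 0)"
        by (rule Lim_transform_eventually[OF tendsto_poly_exp_at_right_0[of "[:0, 1:] * Q n"]])
           (auto simp: D_def eventually_at_filter field_simps)
      have "((\<lambda>t. D n t / t) \<longlongrightarrow> 0) (at_left 0)"
        by (rule Lim_transform_eventually[OF tendsto_const]) (auto simp: D_def eventually_at_filter)
      then have "((\<lambda>t. D n t / t) \<longlongrightarrow> 0) (at 0)"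
        using r by (simp add: filterlim_at_split)
      then show ?thesis using 3 by (simp add: has_field_derivative_iff D_def)
    qed
  qed
  from smooth_on_derivative_sequence[of D, OF this, of 0] show ?thesis
    by (simp add: D0)
qed

subsection \<open>Test functions\<close>

lemma Cc_infinity_smooth: "\<phi> \<in> Cc_infinity \<Omega> \<Longrightarrow> smooth_on UNIV \<phi>"
  by (simp add: Cc_infinity_def)

lemma Cc_infinity_compose:
  assumes "smooth_on UNIV h" "h 0 = 0" "\<phi> \<in> Cc_infinity \<Omega>"
  shows "(\<lambda>x. h (\<phi> x)) \<in> Cc_infinity \<Omega>"
proof -
  let ?A = "{x. h (\<phi> x) \<noteq> 0}" and ?B = "{x. \<phi> x \<noteq> 0}"
  have sub: "closure ?A \<subseteq> closure ?B" using assms(2) by (intro closure_mono) auto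
  have B: "compact (closure ?B)" "closure ?B \<subseteq> \<Omega>" "smooth_on UNIV \<phi>"
    using assms(3) by (auto simp: Cc_infinity_def compactly_inside_def)
  have "compact (closure ?A)"
    using compact_Int_closed[OF B(1) closed_closure, of ?A] sub by (simp add: Int_absorb1)
  then show ?thesis
    using sub B smooth_on_compose[OF assms(1) B(3)]
    unfolding Cc_infinity_def compactly_inside_def by blast
qed

lemma gradient_compose:
  fixes h :: "real \<Rightarrow> real"
  assumes "(h has_real_derivative h') (at (\<phi> x))" "smooth_on UNIV \<phi>"
  shows "gradient (\<lambda>x. h (\<phi> x)) x = h' *\<^sub>R gradient \<phi> x"
  by (rule gradient_eqI, rule GDERIV_DERIV_compose[OF smooth_on_gderiv[OF assms(2)] assms(1)])

text \<open>The closure of the nonzero set serves: its complement is open, so near a point outside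
  the function is constantly 0 and the gradient vanishes too.\<close>

lemma Cc_infinity_support:
  assumes "\<phi> \<in> Cc_infinity \<Omega>"
  shows "\<exists>K. compact K \<and> K \<subseteq> \<Omega> \<and> (\<forall>x. x \<notin> K \<longrightarrow> \<phi> x = 0 \<and> gradient \<phi> x = 0)"
proof (intro exI conjI allI impI)
  let ?K = "closure {x. \<phi> x \<noteq> 0}"
  show "compact ?K" "?K \<subseteq> \<Omega>" using assms by (auto simp: Cc_infinity_def compactly_inside_def)
  show 0: "\<phi> x = 0" if "x \<notin> ?K" for x
    using that closure_subset[of "{x. \<phi> x \<noteq> 0}"] by auto
  show "gradient \<phi> x = 0" if "x \<notin> ?K" for x
  proof (rule gradient_eqI)
    have "((\<lambda>x. 0 :: real) has_derivative (\<lambda>h. 0)) (at x)" by simp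
    then have "(\<phi> has_derivative (\<lambda>h. 0)) (at x)"
      by (rule has_derivative_transform_within_open[OF _ open_Compl[OF closed_closure]]) (use that in simp, metis 0 ComplD)
    then show "GDERIV \<phi> x :> 0" by (simp add: gderiv_def)
  qed
qed

lemma Cc_infinity_bounded:
  assumes "\<phi> \<in> Cc_infinity \<Omega>"
  obtains B where "\<And>x. \<bar>\<phi> x\<bar> \<le> B" "\<And>x. norm (gradient \<phi> x) \<le> B"
proof -
  obtain K where K: "compact K" "K \<subseteq> \<Omega>" "\<And>x. x \<notin> K \<Longrightarrow> \<phi> x = 0" "\<And>x. x \<notin> K \<Longrightarrow> gradient \<phi> x = 0"
    using Cc_infinity_support[OF assms] by metis
  have "bounded (\<phi> ` K)" "bounded (gradient \<phi> ` K)"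
    using assms[THEN Cc_infinity_smooth] K(1)
    by (auto intro!: compact_imp_bounded compact_continuous_image smooth_on_continuous
        smooth_on_continuous_gradient)
  then obtain A B where "\<forall>x\<in>K. \<bar>\<phi> x\<bar> \<le> A" "\<forall>x\<in>K. norm (gradient \<phi> x) \<le> B"
    by (auto simp: bounded_iff)
  then have "\<bar>\<phi> x\<bar> \<le> \<bar>A\<bar> + \<bar>B\<bar>" "norm (gradient \<phi> x) \<le> \<bar>A\<bar> + \<bar>B\<bar>" for x
    using K by (cases "x \<in> K"; force)+
  then show ?thesis by (rule that)
qed

text \<open>A product of one-sided flat functions, two for each coordinate, dies as soon as one
  coordinate leaves its open interval. Positivity on exactly the box is what later makes 1 - exp (-
  k \<Phi>) converge to the indicator of the box.\<close>

lemma box_bump: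
  fixes a b :: "'a::euclidean_space"
  shows "\<exists>\<Phi>. smooth_on UNIV \<Phi> \<and> (\<forall>x. 0 \<le> \<Phi> x) \<and> (\<forall>x. 0 < \<Phi> x \<longleftrightarrow> x \<in> box a b)"
proof (intro exI conjI allI)
  define \<Phi> where "\<Phi> x = (\<Prod>i\<in>Basis. flat_exp (x \<bullet> i + - (a \<bullet> i)) * flat_exp (x \<bullet> (- i) + b \<bullet> i))" for x
  show "smooth_on UNIV \<Phi>"
    unfolding \<Phi>_def[abs_def]
    by (intro smooth_on_prod smooth_on_mult smooth_on_compose[OF smooth_on_flat_exp] smooth_on_linear) simp
  show nn: "0 \<le> \<Phi> x" for x
    unfolding \<Phi>_def by (intro prod_nonneg mult_nonneg_nonneg flat_exp_nonneg)
  show "0 < \<Phi> x \<longleftrightarrow> x \<in> box a b" for x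
  proof -
    have z: "flat_exp t = 0 \<longleftrightarrow> t \<le> 0" for t by (simp add: flat_exp_def)
    have "\<Phi> x \<noteq> 0 \<longleftrightarrow> x \<in> box a b"
      unfolding \<Phi>_def by (auto simp: mem_box z not_le) 
    then show ?thesis using nn[of x] by (auto simp: less_le)
  qed
qed

subsection \<open>Integration by parts and uniqueness of weak gradients\<close>

lemma Cc_infinity_mult:
  assumes "\<phi> \<in> Cc_infinity \<Omega>" "smooth_on UNIV f"
  shows "(\<lambda>x. f x * \<phi> x) \<in> Cc_infinity \<Omega>"
proof -
  let ?A = "{x. f x * \<phi> x \<noteq> 0}" and ?B = "{x. \<phi> x \<noteq> 0}"
  have sub: "closure ?A \<subseteq> closure ?B" by (intro closure_mono) auto
  have B: "compact (closure ?B)" "closure ?B \<subseteq> \<Omega>" "smooth_on UNIV \<phi>"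
    using assms(1) by (auto simp: Cc_infinity_def compactly_inside_def)
  have "compact (closure ?A)"
    using compact_Int_closed[OF B(1) closed_closure, of ?A] sub by (simp add: Int_absorb1)
  then show ?thesis
    using sub B smooth_on_mult[OF assms(2) B(3)]
    unfolding Cc_infinity_def compactly_inside_def by blast
qed

lemma gradient_mult:
  "smooth_on UNIV f \<Longrightarrow> smooth_on UNIV g \<Longrightarrow>
    gradient (\<lambda>x. f x * g x) x = f x *\<^sub>R gradient g x + g x *\<^sub>R gradient f x"
  by (intro gradient_eqI GDERIV_mult smooth_on_gderiv)

lemma Cc_infinity_lipschitz:
  assumes "\<phi> \<in> Cc_infinity \<Omega>" "\<And>x. norm (gradient \<phi> x) \<le> B"
  shows "\<bar>\<phi> x - \<phi> y\<bar> \<le> B * norm (x - y)"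
proof -
  have "norm (\<phi> x - \<phi> y) \<le> B * norm (x - y)"
  proof (rule differentiable_bound[where S = UNIV])
    show "(\<phi> has_derivative (\<lambda>h. h \<bullet> gradient \<phi> x)) (at x within UNIV)" for x
      using smooth_on_gderiv[OF Cc_infinity_smooth[OF assms(1)]] by (simp add: gderiv_def)
    show "onorm (\<lambda>h. h \<bullet> gradient \<phi> x) \<le> B" for x
    proof (rule onorm_bound)
      show "0 \<le> B" using assms(2)[of x] norm_ge_zero order_trans by blast
      show "norm (h \<bullet> gradient \<phi> x) \<le> B * norm h" for h
        using Cauchy_Schwarz_ineq2[of h "gradient \<phi> x"] mult_left_mono[OF assms(2)[of x], of "norm h"]
        by (simp add: mult.commute)
    qed
  qed auto
  then show ?thesis by simp
qed

lemma compact_support_integrable: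
  fixes f :: "'a::euclidean_space \<Rightarrow> real"
  assumes "compact K" "continuous_on K f" "\<And>x. x \<notin> K \<Longrightarrow> f x = 0"
  shows "integrable lborel f"
proof -
  have "integrable lborel (\<lambda>x. indicator K x *\<^sub>R f x)"
    using assms(1,2) by (rule borel_integrable_compact)
  also have "(\<lambda>x. indicator K x *\<^sub>R f x) = f"
    using assms(3) by (auto simp: indicator_def fun_eq_iff)
  finally show ?thesis .
qed

lemma Cc_infinity_integrable_lborel:
  assumes "\<phi> \<in> Cc_infinity \<Omega>"
  shows "integrable lborel \<phi>"
  using Cc_infinity_support[OF assms] smooth_on_continuous[OF Cc_infinity_smooth[OF assms]]
  by (blast intro: compact_support_integrable)

text \<open>By translation invariance the difference quotients of \<open>\<phi>\<close> have integral zero.\<close>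

lemma integral_gradient_eq_0:
  fixes \<phi> :: "'a::euclidean_space \<Rightarrow> real"
  assumes \<phi>: "\<phi> \<in> Cc_infinity \<Omega>"
  shows "(LINT x|lborel. gradient \<phi> x \<bullet> b) = 0"
proof -
  obtain K where K: "compact K" "K \<subseteq> \<Omega>" "\<And>x. x \<notin> K \<Longrightarrow> \<phi> x = 0" "\<And>x. x \<notin> K \<Longrightarrow> gradient \<phi> x = 0"
    using Cc_infinity_support[OF assms] by metis
  obtain B where B: "\<And>x. \<bar>\<phi> x\<bar> \<le> B" "\<And>x. norm (gradient \<phi> x) \<le> B"
    using Cc_infinity_bounded[OF \<phi>] by blast
  obtain R where R: "K \<subseteq> cball 0 R"
    using compact_imp_bounded[OF K(1)] by (auto simp: bounded_iff subset_iff)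
  define q where "q n x = (\<phi> ((1 / real (Suc n)) *\<^sub>R b + x) - \<phi> x) * real (Suc n)" for n x
  have intT: "integrable lborel (\<lambda>x. \<phi> (c + x))" "(LINT x|lborel. \<phi> (c + x)) = (LINT x|lborel. \<phi> x)" for c
  proof -
    have m: "\<phi> \<in> borel_measurable borel"
      using Cc_infinity_integrable_lborel[OF \<phi>] by simp
    have "integrable (distr lborel borel ((+) c)) \<phi>"
      by (simp add: lborel_distr_plus Cc_infinity_integrable_lborel[OF \<phi>])
    then show "integrable lborel (\<lambda>x. \<phi> (c + x))"
      using m by (subst (asm) integrable_distr_eq) auto
    have "(LINT x|distr lborel borel ((+) c). \<phi> x) = (LINT x|lborel. \<phi> (c + x))"
      using m by (subst integral_distr) auto
    then show "(LINT x|lborel. \<phi> (c + x)) = (LINT x|lborel. \<phi> x)"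
      by (simp add: lborel_distr_plus)
  qed
  have q0: "(LINT x|lborel. q n x) = 0" for n
    unfolding q_def using intT Cc_infinity_integrable_lborel[OF \<phi>] by simp
  have "(\<lambda>n. LINT x|lborel. q n x) \<longlonglongrightarrow> (LINT x|lborel. gradient \<phi> x \<bullet> b)"
  proof (rule integral_dominated_convergence)
    \<comment> \<open>All translates by multiples of b of length at most |b| are supported in the
      ball of radius R + |b|, and the Lipschitz bound on \<phi> controls the quotients by B |b|
      uniformly in n.\<close>
    let ?w = "\<lambda>x. indicator (cball 0 (R + norm b)) x *\<^sub>R (B * norm b) :: real"
    show "integrable lborel ?w"
      by (rule borel_integrable_compact) auto
    have "continuous_on UNIV (\<lambda>x. gradient \<phi> x \<bullet> b)"
      by (intro continuous_intros smooth_on_continuous_gradient[OF Cc_infinity_smooth[OF \<phi>]])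
    then show "(\<lambda>x. gradient \<phi> x \<bullet> b) \<in> borel_measurable lborel"
      using borel_measurable_continuous_onI by simp
    show "q n \<in> borel_measurable lborel" for n
      unfolding q_def using intT(1) Cc_infinity_integrable_lborel[OF \<phi>] by measurable
    show "AE x in lborel. (\<lambda>n. q n x) \<longlonglongrightarrow> gradient \<phi> x \<bullet> b"
    proof (rule AE_I2)
      fix x
      have d: "(\<phi> has_derivative (\<lambda>h. h \<bullet> gradient \<phi> x)) (at x)"
        using smooth_on_gderiv[OF Cc_infinity_smooth[OF \<phi>]] by (simp add: gderiv_def)
      have "((\<lambda>t. \<phi> (t *\<^sub>R b + x)) has_derivative (\<lambda>h. (h *\<^sub>R b) \<bullet> gradient \<phi> x)) (at 0)"
        by (rule has_derivative_compose[of "\<lambda>t. t *\<^sub>R b + x" "\<lambda>h. h *\<^sub>R b" 0 UNIV \<phi>])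
           (use d in \<open>auto intro!: derivative_eq_intros\<close>)
      moreover have "(\<lambda>h. (h *\<^sub>R b) \<bullet> gradient \<phi> x) = (*) (gradient \<phi> x \<bullet> b)"
        by (auto simp: inner_commute)
      ultimately have "((\<lambda>t. \<phi> (t *\<^sub>R b + x)) has_real_derivative gradient \<phi> x \<bullet> b) (at 0)"
        by (simp only: has_field_derivative_def)
      then have "((\<lambda>t. (\<phi> (t *\<^sub>R b + x) - \<phi> x) / t) \<longlongrightarrow> gradient \<phi> x \<bullet> b) (at 0)"
        by (simp add: has_field_derivative_iff)
      moreover have "filterlim (\<lambda>n. 1 / real (Suc n)) (at 0) sequentially"
        by (auto intro!: filterlim_atI LIMSEQ_Suc lim_1_over_n simp del: of_nat_Suc)
      ultimately have "(\<lambda>n. (\<phi> ((1 / real (Suc n)) *\<^sub>R b + x) - \<phi> x) / (1 / real (Suc n))) \<longlonglongrightarrow> gradient \<phi> x \<bullet> b"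
        by (rule filterlim_compose)
      then show "(\<lambda>n. q n x) \<longlonglongrightarrow> gradient \<phi> x \<bullet> b"
        by (simp add: q_def del: of_nat_Suc)
    qed
    show "AE x in lborel. norm (q n x) \<le> ?w x" for n
    proof (rule AE_I2)
      fix x
      have nb: "norm ((1 / real (Suc n)) *\<^sub>R b) \<le> norm b"
        by (simp add: divide_simps mult_le_cancel_left1)
      show "norm (q n x) \<le> ?w x"
      proof (cases "x \<in> cball 0 (R + norm b)")
        case True
        have "\<bar>\<phi> ((1 / real (Suc n)) *\<^sub>R b + x) - \<phi> x\<bar> \<le> B * norm ((1 / real (Suc n)) *\<^sub>R b)"
          using Cc_infinity_lipschitz[OF \<phi> B(2), of "(1 / real (Suc n)) *\<^sub>R b + x" x] by simp
        then have "\<bar>\<phi> ((1 / real (Suc n)) *\<^sub>R b + x) - \<phi> x\<bar> * real (Suc n) \<le> B * norm ((1 / real (Suc n)) *\<^sub>R b) * real (Suc n)"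
          by (rule mult_right_mono) simp
        then show ?thesis using True by (simp add: q_def abs_mult del: of_nat_Suc)
      next
        case False
        then have "norm x > R + norm b" by simp
        then have "x \<notin> cball 0 R" "(1 / real (Suc n)) *\<^sub>R b + x \<notin> cball 0 R"
          using norm_diff_ineq[of x "(1 / real (Suc n)) *\<^sub>R b"] nb norm_ge_zero[of b]
          by (auto simp: add.commute simp del: norm_ge_zero)
        then have "x \<notin> K" "(1 / real (Suc n)) *\<^sub>R b + x \<notin> K" using R by blast+
        then show ?thesis using False K(3) by (simp add: q_def)
      qed
    qed
  qed
  then show ?thesis by (simp add: q0 LIMSEQ_const_iff)
qed

lemma lebesgue_on_integral_supported:
  fixes f :: "'a::euclidean_space \<Rightarrow> real"
  assumes "S \<in> sets lebesgue" "\<And>x. x \<notin> S \<Longrightarrow> f x = 0"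
  shows "(LINT x|lebesgue_on S. f x) = (LINT x|lebesgue. f x)"
    and "integrable (lebesgue_on S) f \<longleftrightarrow> integrable lebesgue f"
proof -
  have "(\<lambda>x. indicator S x *\<^sub>R f x) = f" using assms(2) by (auto simp: indicator_def fun_eq_iff)
  then show "(LINT x|lebesgue_on S. f x) = (LINT x|lebesgue. f x)"
    "integrable (lebesgue_on S) f \<longleftrightarrow> integrable lebesgue f"
    using assms(1) by (simp_all add: integral_restrict_space integrable_restrict_space)
qed

text \<open>The product of two test functions is a test function, so the integral of its gradient
  vanishes; the product rule splits it into the two sides.\<close>

lemma Cc_infinity_integration_by_parts:
  assumes \<Omega>: "\<Omega> \<in> sets lebesgue" and \<phi>: "\<phi> \<in> Cc_infinity \<Omega>" and \<eta>: "\<eta> \<in> Cc_infinity \<Omega>"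
  shows "(LINT x|lebesgue_on \<Omega>. \<phi> x * (gradient \<eta> x \<bullet> b)) = - (LINT x|lebesgue_on \<Omega>. (gradient \<phi> x \<bullet> b) * \<eta> x)"
proof -
  note sm = Cc_infinity_smooth[OF \<phi>] Cc_infinity_smooth[OF \<eta>]
  obtain K where K: "compact K" "K \<subseteq> \<Omega>" "\<And>x. x \<notin> K \<Longrightarrow> \<phi> x = 0" "\<And>x. x \<notin> K \<Longrightarrow> gradient \<phi> x = 0"
    using Cc_infinity_support[OF \<phi>] by metis
  have i: "integrable lborel (\<lambda>x. \<phi> x * (gradient \<eta> x \<bullet> b))" "integrable lborel (\<lambda>x. (gradient \<phi> x \<bullet> b) * \<eta> x)"
    by (intro compact_support_integrable[OF K(1)] continuous_intros smooth_on_continuous_gradient[OF sm(1)] smooth_on_continuous_gradient[OF sm(2)]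
        smooth_on_continuous[OF sm(1)] smooth_on_continuous[OF sm(2)]; simp add: K)+
  have "(LINT x|lborel. gradient (\<lambda>x. \<eta> x * \<phi> x) x \<bullet> b) = 0"
    by (rule integral_gradient_eq_0[OF Cc_infinity_mult[OF \<phi> sm(2)]])
  then have "(LINT x|lborel. (gradient \<phi> x \<bullet> b) * \<eta> x + \<phi> x * (gradient \<eta> x \<bullet> b)) = 0"
    by (simp add: gradient_mult sm inner_add_left mult.commute)
  then have *: "(LINT x|lborel. \<phi> x * (gradient \<eta> x \<bullet> b)) = - (LINT x|lborel. (gradient \<phi> x \<bullet> b) * \<eta> x)"
    using i by simp
  have z: "\<phi> x = 0" "gradient \<phi> x = 0" if "x \<notin> \<Omega>" for x using that K by blast+
  show ?thesis
    using * i by (simp add: lebesgue_on_integral_supported[OF \<Omega>] z integral_completion)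
qed

lemma locally_integrable_mult:
  fixes u :: "'a::euclidean_space \<Rightarrow> real"
  assumes u: "locally_integrable_on u \<Omega>" and \<Omega>: "\<Omega> \<in> sets lebesgue"
    and K: "compact K" "K \<subseteq> \<Omega>" and \<eta>: "continuous_on UNIV \<eta>" "\<And>x. \<bar>\<eta> x\<bar> \<le> B" "\<And>x. x \<notin> K \<Longrightarrow> \<eta> x = 0"
  shows "integrable (lebesgue_on \<Omega>) (\<lambda>x. u x * \<eta> x)"
proof -
  have "integrable (lebesgue_on K) u" using u K by (auto simp: locally_integrable_on_def)
  then have i: "integrable lebesgue (\<lambda>x. indicator K x * u x)"
    using K by (simp add: integrable_restrict_space lmeasurable_compact fmeasurableD)
  have m: "\<eta> \<in> borel_measurable lebesgue"
    using borel_measurable_continuous_onI[OF \<eta>(1)] by (simp add: measurable_completion)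
  have "integrable lebesgue (\<lambda>x. B * (indicator K x * u x))" using i by simp
  moreover have "(\<lambda>x. (indicator K x * u x) * \<eta> x) \<in> borel_measurable lebesgue"
    using borel_measurable_integrable[OF i] m by measurable
  moreover have "AE x in lebesgue. norm ((indicator K x * u x) * \<eta> x) \<le> norm (B * (indicator K x * u x))"
    using \<eta>(2) by (auto intro!: AE_I2 simp: abs_mult mult.commute[of _ "\<bar>u _\<bar>"] indicator_def
        mult_left_mono order_trans[OF _ abs_ge_self])
  ultimately have "integrable lebesgue (\<lambda>x. (indicator K x * u x) * \<eta> x)"
    by (rule Bochner_Integration.integrable_bound)
  also have "(\<lambda>x. (indicator K x * u x) * \<eta> x) = (\<lambda>x. u x * \<eta> x)"
    using \<eta>(3) by (auto simp: indicator_def fun_eq_iff)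
  finally have "integrable lebesgue (\<lambda>x. u x * \<eta> x)" .
  then show ?thesis
    using \<Omega> \<eta>(3) K(2) by (subst lebesgue_on_integral_supported) auto
qed

text \<open>The positive and the negative part of g are densities of two measures that agree on
  boxes and are finite there. Boxes form an intersection-stable generator of the Borel sets, so the
  measures coincide and hence so do the densities. The generator only reaches Borel sets, which is
  why g is first replaced by a Borel representative.\<close>

lemma integrable_box_integrals_zero:
  fixes g :: "'a::euclidean_space \<Rightarrow> real"
  assumes int: "integrable lebesgue g"
    and 0: "\<And>c d. (LINT x|lebesgue. indicator (box c d) x * g x) = 0"
  shows "AE x in lebesgue. g x = 0"
proof -
  obtain g' where g'm[measurable]: "g' \<in> borel_measurable lborel" and g': "AE x in lborel. g x = g' x"
    using completion_ex_borel_measurable_real[OF borel_measurable_integrable[OF int]] by auto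
  have AEc: "AE x in lebesgue. g x = g' x"
    using g' by (rule AE_completion)
  have g'c: "g' \<in> borel_measurable lebesgue" by (simp add: measurable_completion)
  have "integrable lebesgue g'"
    using int AEc g'c by (subst integrable_cong_AE[symmetric]) auto
  then have int': "integrable lborel g'"
    by (simp add: integrable_completion)
  have z0: "(LINT x|lborel. indicator (box c d) x * g' x) = 0" for c d
  proof -
    have "(LINT x|lebesgue. indicator (box c d) x * g' x) = (LINT x|lebesgue. indicator (box c d) x * g x)"
    proof (rule integral_cong_AE)
      show "(\<lambda>x. indicator (box c d) x * g' x) \<in> borel_measurable lebesgue"
        by (simp add: measurable_completion)
      show "(\<lambda>x. indicator (box c d) x * g x) \<in> borel_measurable lebesgue"
        using borel_measurable_integrable[OF int] by (intro borel_measurable_times) (auto simp: measurable_completion)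
      show "AE x in lebesgue. indicator (box c d) x * g' x = indicator (box c d) x * g x"
        using AEc by eventually_elim simp
    qed
    then show ?thesis using 0[of c d] by (simp add: integral_completion)
  qed
  \<comment> \<open>As \<open>ennreal\<close> sends negative reals to 0, s = 1 and s = -1 give the
    positive and the negative part.\<close>
  have em: "emeasure (density lborel (\<lambda>x. ennreal (s * g' x))) (box c d) =
      ennreal (LINT x|lborel. indicator (box c d) x * max 0 (s * g' x))" for c d s
  proof -
    have "emeasure (density lborel (\<lambda>x. ennreal (s * g' x))) (box c d) =
        (\<integral>\<^sup>+x. ennreal (indicator (box c d) x * max 0 (s * g' x)) \<partial>lborel)"
      by (subst emeasure_density) (auto intro!: nn_integral_cong simp: indicator_def max_def ennreal_neg)
    also have "\<dots> = ennreal (LINT x|lborel. indicator (box c d) x * max 0 (s * g' x))"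
      using int' by (intro nn_integral_eq_integral integrable_real_mult_indicator[unfolded mult.commute[of _ "indicator _ _"]] integrable_max) auto
    finally show ?thesis .
  qed
  have same: "(LINT x|lborel. indicator (box c d) x * max 0 (1 * g' x)) =
      (LINT x|lborel. indicator (box c d) x * max 0 (-1 * g' x))" for c d
  proof -
    have i: "integrable lborel (\<lambda>x. indicator (box c d) x * max 0 (s * g' x))" for s
      using int' by (intro integrable_real_mult_indicator[unfolded mult.commute[of _ "indicator _ _"]] integrable_max) auto
    have "(LINT x|lborel. indicator (box c d) x * max 0 (1 * g' x)) - (LINT x|lborel. indicator (box c d) x * max 0 (-1 * g' x))
      = (LINT x|lborel. indicator (box c d) x * max 0 (1 * g' x) - indicator (box c d) x * max 0 (-1 * g' x))"
      using i by (simp only: Bochner_Integration.integral_diff)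
    also have "\<dots> = (LINT x|lborel. indicator (box c d) x * g' x)"
      by (intro Bochner_Integration.integral_cong) (auto simp: indicator_def max_def)
    finally show ?thesis using z0[of c d] by simp
  qed
  have "density lborel (\<lambda>x. ennreal (1 * g' x)) = density lborel (\<lambda>x. ennreal (-1 * g' x))"
  proof (rule measure_eqI_generator_eq[where E = "range (\<lambda>(a, b). box a b :: 'a set)" and \<Omega> = UNIV
        and A = "\<lambda>n. box (- real n *\<^sub>R One) (real n *\<^sub>R One)"])
    show "Int_stable (range (\<lambda>(a, b). box a b :: 'a set))"
      by (auto simp: Int_stable_def box_Int_box)
    show "\<And>X. X \<in> range (\<lambda>(a, b). box a b) \<Longrightarrow>
       emeasure (density lborel (\<lambda>x. ennreal (1 * g' x))) X = emeasure (density lborel (\<lambda>x. ennreal (-1 * g' x))) X"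
      by (auto simp only: em same)
    show "sets (density lborel (\<lambda>x. ennreal (1 * g' x))) = sigma_sets UNIV (range (\<lambda>(a, b). box a b))"
      "sets (density lborel (\<lambda>x. ennreal (-1 * g' x))) = sigma_sets UNIV (range (\<lambda>(a, b). box a b))"
      by (simp_all add: borel_eq_box)
    show "emeasure (density lborel (\<lambda>x. ennreal (1 * g' x))) (box (- real n *\<^sub>R One) (real n *\<^sub>R One)) \<noteq> \<infinity>" for n
      by (simp only: em) simp
    show "(\<Union>n. box (- real n *\<^sub>R One) (real n *\<^sub>R One)) = (UNIV :: 'a set)"
      using UN_box_eq_UNIV by simp
  qed auto
  then have "AE x in lborel. ennreal (1 * g' x) = ennreal (-1 * g' x)"
    by (subst (asm) sigma_finite_measure.density_unique_iff[OF sigma_finite_lborel]) auto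
  then have "AE x in lborel. g' x = 0"
    by eventually_elim (smt (verit) ennreal_eq_0_iff ennreal_neg)
  from AE_completion[OF this] AEc show ?thesis by eventually_elim simp
qed

lemma integrable_lebesgue_on_subset:
  fixes f :: "'a::euclidean_space \<Rightarrow> 'b::euclidean_space"
  assumes "integrable (lebesgue_on \<Omega>) f" "S \<subseteq> \<Omega>" "\<Omega> \<in> sets lebesgue" "S \<in> sets lebesgue"
  shows "integrable (lebesgue_on S) f"
proof -
  have "set_integrable lebesgue \<Omega> f"
    using assms by (simp add: integrable_restrict_space set_integrable_def)
  then have "set_integrable lebesgue S f"
    using assms by (meson set_integrable_subset)
  then show ?thesis using assms by (simp add: integrable_restrict_space set_integrable_def)
qed

text \<open>With \<Phi> positive exactly on a box, the test functions 1 - exp (- k \<Phi>) stay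
  between 0 and 1 and converge to the indicator of the box. So G has integral zero over each box
  whose closure lies in \<Omega>, and countably many closed boxes cover \<Omega>.\<close>

lemma fundamental_lemma_of_variations:
  fixes G :: "'a::euclidean_space \<Rightarrow> real"
  assumes \<Omega>: "open \<Omega>" and G: "locally_integrable_on G \<Omega>"
    and 0: "\<And>\<phi>. \<phi> \<in> Cc_infinity \<Omega> \<Longrightarrow> (LINT x|lebesgue_on \<Omega>. G x * \<phi> x) = 0"
  shows "AE x in lebesgue_on \<Omega>. G x = 0"
proof -
  have \<Omega>': "\<Omega> \<in> sets lebesgue" using \<Omega> by simp
  have Gi: "integrable lebesgue (\<lambda>x. indicator (cbox c d) x * G x)" if "cbox c d \<subseteq> \<Omega>" for c d
    using G that integrable_restrict_space[of "cbox c d" lebesgue G]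
    by (simp add: locally_integrable_on_def)
  have box0: "(LINT x|lebesgue. indicator (box c d) x * G x) = 0" if cd: "cbox c d \<subseteq> \<Omega>" for c d
  proof -
    obtain \<Phi> where \<Phi>: "smooth_on UNIV \<Phi>" "\<And>x. 0 \<le> \<Phi> x" "\<And>x. 0 < \<Phi> x \<longleftrightarrow> x \<in> box c d"
      using box_bump[of c d] by metis
    have \<Phi>0: "\<Phi> x = 0" if "x \<notin> box c d" for x using \<Phi>(2,3)[of x] that by auto
    define \<eta> where "\<eta> k x = 1 + (-1) * exp (- real k * \<Phi> x)" for k :: nat and x
    have sm: "smooth_on UNIV (\<eta> k)" for k
      unfolding \<eta>_def[abs_def]
      by (intro smooth_on_add smooth_on_mult smooth_on_const smooth_on_compose[OF smooth_on_exp] \<Phi>(1))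
    have \<eta>0: "\<eta> k x = 0" if "x \<notin> box c d" for k x using \<Phi>0[OF that] by (simp add: \<eta>_def)
    have \<eta>1: "0 \<le> \<eta> k x" "\<eta> k x \<le> 1" for k x using \<Phi>(2)[of x] by (auto simp: \<eta>_def)
    have sub: "closure {x. \<eta> k x \<noteq> 0} \<subseteq> cbox c d" for k
      by (rule closure_minimal) (use \<eta>0 box_subset_cbox in \<open>fastforce simp: closed_cbox\<close>)+
    have "compact (closure {x. \<eta> k x \<noteq> 0})" for k
      using compact_Int_closed[OF compact_cbox[of c d] closed_closure, of "{x. \<eta> k x \<noteq> 0}"] sub[of k]
      by (simp add: Int_absorb1)
    then have \<eta>C: "\<eta> k \<in> Cc_infinity \<Omega>" for k
      using sub cd sm unfolding Cc_infinity_def compactly_inside_def by blast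
    have "(\<lambda>k. LINT x|lebesgue. G x * \<eta> k x) \<longlonglongrightarrow> (LINT x|lebesgue. indicator (box c d) x * G x)"
    proof (rule integral_dominated_convergence)
      have bm: "(\<lambda>x. indicator (box c d) x * (indicator (cbox c d) x * G x)) \<in> borel_measurable lebesgue"
        by (rule borel_measurable_times[OF _ borel_measurable_integrable[OF Gi[OF cd]]]) (simp add: measurable_completion)
      also have "(\<lambda>x. indicator (box c d) x * (indicator (cbox c d) x * G x)) = (\<lambda>x. indicator (box c d) x * G x)"
        using box_subset_cbox[of c d] by (auto simp: indicator_def fun_eq_iff)
      finally show bm': "(\<lambda>x. indicator (box c d) x * G x) \<in> borel_measurable lebesgue" .
      show "(\<lambda>x. G x * \<eta> k x) \<in> borel_measurable lebesgue" for k
      proof -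
        have "\<eta> k \<in> borel_measurable lebesgue"
          using borel_measurable_continuous_onI[OF smooth_on_continuous[OF sm]] by (simp add: measurable_completion)
        then have "(\<lambda>x. (indicator (box c d) x * G x) * \<eta> k x) \<in> borel_measurable lebesgue"
          using bm' by measurable
        also have "(\<lambda>x. (indicator (box c d) x * G x) * \<eta> k x) = (\<lambda>x. G x * \<eta> k x)"
          using \<eta>0 by (auto simp: indicator_def fun_eq_iff)
        finally show ?thesis .
      qed
      show "integrable lebesgue (\<lambda>x. \<bar>indicator (cbox c d) x * G x\<bar>)"
        using Gi[OF cd] by (rule integrable_abs)
      show "AE x in lebesgue. (\<lambda>k. G x * \<eta> k x) \<longlonglongrightarrow> indicator (box c d) x * G x"
      proof (rule AE_I2)
        fix x
        show "(\<lambda>k. G x * \<eta> k x) \<longlonglongrightarrow> indicator (box c d) x * G x"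
        proof (cases "x \<in> box c d")
          case True
          then have "exp (- \<Phi> x) < 1" using \<Phi>(3) by simp
          then have "(\<lambda>k. exp (- \<Phi> x) ^ k) \<longlonglongrightarrow> 0" by (intro LIMSEQ_power_zero) simp
          then have "(\<lambda>k. exp (- real k * \<Phi> x)) \<longlonglongrightarrow> 0" by (simp flip: exp_of_nat_mult)
          then have "(\<lambda>k. G x * \<eta> k x) \<longlonglongrightarrow> G x * (1 + (-1) * 0)"
            unfolding \<eta>_def by (intro tendsto_intros)
          then show ?thesis using True by simp
        qed (simp add: \<eta>0)
      qed
      show "AE x in lebesgue. norm (G x * \<eta> k x) \<le> \<bar>indicator (cbox c d) x * G x\<bar>" for k
      proof (rule AE_I2)
        fix x
        show "norm (G x * \<eta> k x) \<le> \<bar>indicator (cbox c d) x * G x\<bar>"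
          using \<eta>1[of k x] \<eta>0[of x k] box_subset_cbox[of c d]
          by (cases "x \<in> box c d") (auto simp: abs_mult indicator_def mult_left_le)
      qed
    qed
    moreover have "(LINT x|lebesgue. G x * \<eta> k x) = 0" for k
    proof -
      have "G x * \<eta> k x = 0" if "x \<notin> \<Omega>" for x using \<eta>0[of x k] that cd box_subset_cbox[of c d] by auto
      then show ?thesis
        using 0[OF \<eta>C[of k]] by (simp add: lebesgue_on_integral_supported[OF \<Omega>'])
    qed
    ultimately show ?thesis by (simp add: LIMSEQ_const_iff)
  qed
  have AEbox: "AE x in lebesgue. x \<in> cbox a b \<longrightarrow> G x = 0" if ab: "cbox a b \<subseteq> \<Omega>" for a b
  proof -
    \<comment> \<open>The integral argument only sees the open box; its boundary is a null
      set.\<close>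
    have N: "AE x in lebesgue. x \<in> cbox a b \<longrightarrow> x \<in> box a b"
      using negligible_frontier_interval[of a b] unfolding negligible_iff_null_sets
      by (auto dest: AE_not_in)
    have "AE x in lebesgue. indicator (box a b) x * G x = 0"
    proof (rule integrable_box_integrals_zero)
      have "integrable (lebesgue_on (cbox a b)) G" using G ab by (simp add: locally_integrable_on_def)
      then have "integrable (lebesgue_on (box a b)) G"
        by (rule integrable_lebesgue_on_subset) (auto simp: box_subset_cbox)
      then show "integrable lebesgue (\<lambda>x. indicator (box a b) x * G x)"
        using integrable_restrict_space[of "box a b" lebesgue G] by simp
      fix c d
      obtain c' d' where I: "box c d \<inter> box a b = box c' d'"
        by (simp add: box_Int_box)
      \<comment> \<open>If the intersection is empty, its corners c', d' are arbitrary and the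
        closed box between them may leave \<Omega>; the integral is then zero for the trivial
        reason.\<close>
      have sub: "cbox c' d' \<subseteq> \<Omega> \<or> box c' d' = {}"
      proof (cases "box c' d' = {}")
        case False
        then have "cbox c' d' = closure (box c' d')" by (simp add: closure_box)
        also have "\<dots> \<subseteq> cbox a b" using I box_subset_cbox[of a b] by (intro closure_minimal) auto
        finally show ?thesis using ab by blast
      qed simp
      have "(LINT x|lebesgue. indicator (box c d) x * (indicator (box a b) x * G x)) =
          (LINT x|lebesgue. indicator (box c' d') x * G x)"
        by (intro Bochner_Integration.integral_cong) (auto simp: I[symmetric] indicator_inter_arith)
      also have "\<dots> = 0" using sub box0 by auto
      finally show "(LINT x|lebesgue. indicator (box c d) x * (indicator (box a b) x * G x)) = 0" .
    qed
    with N show ?thesis by eventually_elim (auto simp: indicator_def)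
  qed
  obtain \<D> where \<D>: "countable \<D>" "\<D> \<subseteq> Pow \<Omega>" "\<And>X. X \<in> \<D> \<Longrightarrow> \<exists>a b. X = cbox a b" "\<Union>\<D> = \<Omega>"
    using open_countable_Union_open_cbox[OF \<Omega>] by metis
  have "AE x in lebesgue. \<forall>X\<in>\<D>. x \<in> X \<longrightarrow> G x = 0"
  proof (rule AE_ball_countable'[OF _ \<D>(1)])
    fix X assume X: "X \<in> \<D>"
    obtain a b where ab: "X = cbox a b" using \<D>(3)[OF X] by blast
    then have "cbox a b \<subseteq> \<Omega>" using X \<D>(2) by blast
    then show "AE x in lebesgue. x \<in> X \<longrightarrow> G x = 0" unfolding ab by (rule AEbox)
  qed
  then have "AE x in lebesgue. x \<in> \<Omega> \<longrightarrow> G x = 0"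
    by eventually_elim (use \<D>(4) in blast)
  then show ?thesis using \<Omega>' by (simp add: AE_restrict_space_iff)
qed

section \<open>Weak gradients: uniqueness and measurability\<close>

lemma locally_integrable_inner:
  "locally_integrable_on g \<Omega> \<Longrightarrow> locally_integrable_on (\<lambda>x. g x \<bullet> b) \<Omega>"
  by (simp add: locally_integrable_on_def)

lemma locally_integrable_diff:
  "locally_integrable_on g \<Omega> \<Longrightarrow> locally_integrable_on h \<Omega> \<Longrightarrow> locally_integrable_on (\<lambda>x. g x - h x) \<Omega>"
  by (simp add: locally_integrable_on_def)

lemma locally_integrable_mult_test:
  fixes u :: "'a::euclidean_space \<Rightarrow> real"
  assumes u: "locally_integrable_on u \<Omega>" and \<Omega>: "\<Omega> \<in> sets lebesgue" and \<phi>: "\<phi> \<in> Cc_infinity \<Omega>"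
  shows "integrable (lebesgue_on \<Omega>) (\<lambda>x. u x * \<phi> x)"
    "integrable (lebesgue_on \<Omega>) (\<lambda>x. u x * (gradient \<phi> x \<bullet> b))"
proof -
  obtain K where K: "compact K" "K \<subseteq> \<Omega>" "\<And>x. x \<notin> K \<Longrightarrow> \<phi> x = 0" "\<And>x. x \<notin> K \<Longrightarrow> gradient \<phi> x = 0"
    using Cc_infinity_support[OF \<phi>] by metis
  obtain B where B: "\<And>x. \<bar>\<phi> x\<bar> \<le> B" "\<And>x. norm (gradient \<phi> x) \<le> B"
    using Cc_infinity_bounded[OF \<phi>] by blast
  note sm = Cc_infinity_smooth[OF \<phi>]
  show "integrable (lebesgue_on \<Omega>) (\<lambda>x. u x * \<phi> x)"
    by (rule locally_integrable_mult[OF u \<Omega> K(1,2) smooth_on_continuous[OF sm] B(1) K(3)])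
  have "\<bar>gradient \<phi> x \<bullet> b\<bar> \<le> B * norm b" for x
    using Cauchy_Schwarz_ineq2[of "gradient \<phi> x" b] mult_right_mono[OF B(2)[of x], of "norm b"] by simp
  then show "integrable (lebesgue_on \<Omega>) (\<lambda>x. u x * (gradient \<phi> x \<bullet> b))"
    by (intro locally_integrable_mult[OF u \<Omega> K(1,2)] continuous_intros smooth_on_continuous_gradient[OF sm])
       (auto simp: K(4))
qed

lemma has_weak_gradient_diff:
  assumes \<Omega>: "\<Omega> \<in> sets lebesgue" and "has_weak_gradient \<Omega> u g" "has_weak_gradient \<Omega> v h"
  shows "has_weak_gradient \<Omega> (\<lambda>x. u x - v x) (\<lambda>x. g x - h x)"
  using assms(2,3) unfolding has_weak_gradient_def
  by (auto simp: locally_integrable_diff left_diff_distrib inner_diff_left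
      locally_integrable_mult_test[OF _ \<Omega>] locally_integrable_inner)

text \<open>The fundamental lemma applied to each component of g - h. This is what makes the choice
  inside \<open>weak_gradient\<close> harmless.\<close>

lemma has_weak_gradient_unique:
  assumes \<Omega>: "open \<Omega>" and g: "has_weak_gradient \<Omega> u g" and h: "has_weak_gradient \<Omega> u h"
  shows "AE x in lebesgue_on \<Omega>. g x = h x"
proof -
  have \<Omega>': "\<Omega> \<in> sets lebesgue" using \<Omega> by simp
  have l: "locally_integrable_on (\<lambda>x. g x \<bullet> b) \<Omega>" "locally_integrable_on (\<lambda>x. h x \<bullet> b) \<Omega>" for b
    using g h by (auto simp: has_weak_gradient_def locally_integrable_inner)
  have "AE x in lebesgue_on \<Omega>. g x \<bullet> b - h x \<bullet> b = 0" if b: "b \<in> Basis" for b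
  proof (rule fundamental_lemma_of_variations[OF \<Omega> locally_integrable_diff[OF l]])
    fix \<phi> assume \<phi>: "\<phi> \<in> Cc_infinity \<Omega>"
    have "(LINT x|lebesgue_on \<Omega>. (g x \<bullet> b) * \<phi> x) = (LINT x|lebesgue_on \<Omega>. (h x \<bullet> b) * \<phi> x)"
    proof -
      have "(LINT x|lebesgue_on \<Omega>. u x * (gradient \<phi> x \<bullet> b)) = - (LINT x|lebesgue_on \<Omega>. (g x \<bullet> b) * \<phi> x)"
        "(LINT x|lebesgue_on \<Omega>. u x * (gradient \<phi> x \<bullet> b)) = - (LINT x|lebesgue_on \<Omega>. (h x \<bullet> b) * \<phi> x)"
        using g h \<phi> b unfolding has_weak_gradient_def by blast+
      then show ?thesis by simp
    qed
    then show "(LINT x|lebesgue_on \<Omega>. (g x \<bullet> b - h x \<bullet> b) * \<phi> x) = 0"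
      by (simp add: left_diff_distrib locally_integrable_mult_test[OF l(1) \<Omega>' \<phi>] locally_integrable_mult_test[OF l(2) \<Omega>' \<phi>])
  qed
  then have "AE x in lebesgue_on \<Omega>. \<forall>b\<in>Basis. g x \<bullet> b - h x \<bullet> b = 0"
    by (simp add: AE_finite_all)
  then show ?thesis by eventually_elim (simp add: euclidean_eq_iff[of "g _"])
qed

lemma has_weak_gradient_weak_gradient:
  "has_weak_gradient \<Omega> u g \<Longrightarrow> has_weak_gradient \<Omega> u (weak_gradient \<Omega> u)"
  unfolding weak_gradient_def by (rule someI[where P = "has_weak_gradient \<Omega> u"])

lemma weak_gradient_eq_AE:
  "open \<Omega> \<Longrightarrow> has_weak_gradient \<Omega> u g \<Longrightarrow> AE x in lebesgue_on \<Omega>. weak_gradient \<Omega> u x = g x"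
  by (rule has_weak_gradient_unique[OF _ has_weak_gradient_weak_gradient])

lemma locally_integrable_continuous:
  fixes f :: "'a::euclidean_space \<Rightarrow> 'b::euclidean_space"
  assumes "continuous_on UNIV f"
  shows "locally_integrable_on f \<Omega>"
  unfolding locally_integrable_on_def
proof safe
  fix K assume K: "compact K" "K \<subseteq> \<Omega>"
  have "integrable lborel (\<lambda>x. indicator K x *\<^sub>R f x)"
    using K(1) continuous_on_subset[OF assms] by (intro borel_integrable_compact) auto
  then have "integrable lebesgue (\<lambda>x. indicator K x *\<^sub>R f x)"
    by (simp add: integrable_completion)
  then show "integrable (lebesgue_on K) f"
    using K by (subst integrable_restrict_space) (auto simp: lmeasurable_compact fmeasurableD)
qed

lemma has_weak_gradient_test:
  assumes \<Omega>: "\<Omega> \<in> sets lebesgue" and \<phi>: "\<phi> \<in> Cc_infinity \<Omega>"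
  shows "has_weak_gradient \<Omega> \<phi> (gradient \<phi>)"
  unfolding has_weak_gradient_def
  using Cc_infinity_integration_by_parts[OF \<Omega> \<phi>] Cc_infinity_smooth[OF \<phi>]
  by (auto intro!: locally_integrable_continuous smooth_on_continuous smooth_on_continuous_gradient)

text \<open>Local integrability speaks of compact subsets only; measurability on them is glued along
  a countable cover of the open set by closed boxes.\<close>

lemma locally_integrable_measurable:
  fixes g :: "'a::euclidean_space \<Rightarrow> 'b::euclidean_space"
  assumes \<Omega>: "open \<Omega>" and g: "locally_integrable_on g \<Omega>"
  shows "g \<in> borel_measurable (lebesgue_on \<Omega>)"
proof -
  obtain \<D> where \<D>: "countable \<D>" "\<D> \<subseteq> Pow \<Omega>" "\<And>X. X \<in> \<D> \<Longrightarrow> \<exists>a b. X = cbox a b" "\<Union>\<D> = \<Omega>"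
    using open_countable_Union_open_cbox[OF \<Omega>] by metis
  show ?thesis
  proof (rule measurable_piecewise_restrict[OF \<D>(1)])
    show "X \<inter> space (lebesgue_on \<Omega>) \<in> sets (lebesgue_on \<Omega>)" if X: "X \<in> \<D>" for X
    proof -
      obtain a b where "X = cbox a b" using \<D>(3)[OF X] by blast
      then have "X \<in> sets lebesgue" by simp
      then show ?thesis using \<Omega> by (auto simp: sets_restrict_space)
    qed
    show "space (lebesgue_on \<Omega>) \<subseteq> \<Union>\<D>" using \<D>(4) by simp
    show "g \<in> borel_measurable (restrict_space (lebesgue_on \<Omega>) X)" if X: "X \<in> \<D>" for X
    proof -
      have "integrable (lebesgue_on X) g"
      proof -
        obtain a b where "X = cbox a b" using \<D>(3)[OF X] by blast
        then show ?thesis using g \<D>(2) X by (auto simp: locally_integrable_on_def)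
      qed
      moreover have "restrict_space (lebesgue_on \<Omega>) X = lebesgue_on X"
      proof -
        obtain a b where "X = cbox a b" using \<D>(3)[OF X] by blast
        moreover have "X \<subseteq> \<Omega>" using \<D>(2) X by blast
        ultimately show ?thesis using \<Omega> by (subst restrict_restrict_space) (simp_all add: Int_absorb1)
      qed
      ultimately show ?thesis by (simp add: borel_measurable_integrable)
    qed
  qed
qed

subsection \<open>Hoelder's inequality for finite families\<close>

text \<open>Convexity of exp at the points ln (y i). A vanishing y i has no logarithm and is treated
  apart.\<close>

lemma weighted_arith_geom_mean:
  fixes y a :: "'i \<Rightarrow> real"
  assumes "finite I" "\<And>i. i \<in> I \<Longrightarrow> 0 \<le> a i" "sum a I = 1" "\<And>i. i \<in> I \<Longrightarrow> 0 \<le> y i"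
  shows "(\<Prod>i\<in>I. y i powr a i) \<le> (\<Sum>i\<in>I. a i * y i)"
proof (cases "\<exists>i\<in>I. y i = 0")
  case True
  \<comment> \<open>This covers exponent 0 as well, because \<open>0 powr 0\<close> is 0.\<close>
  then have "(\<Prod>i\<in>I. y i powr a i) = 0" using assms(1) by (intro prod_zero) auto
  moreover have "0 \<le> (\<Sum>i\<in>I. a i * y i)" using assms by (intro sum_nonneg) auto
  ultimately show ?thesis by linarith
next
  case False
  then have pos: "0 < y i" if "i \<in> I" for i using assms(4)[OF that] that by force
  have ne: "I \<noteq> {}" using assms(3) by auto
  have "(\<Prod>i\<in>I. y i powr a i) = exp (\<Sum>i\<in>I. a i * ln (y i))"
    using assms(1) by (auto simp: exp_sum powr_def dest: pos intro!: prod.cong)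
  also have "\<dots> \<le> (\<Sum>i\<in>I. a i * exp (ln (y i)))"
    using convex_on_sum[OF assms(1) ne exp_convex assms(3), of "\<lambda>i. ln (y i)"] assms(2) by simp
  also have "\<dots> = (\<Sum>i\<in>I. a i * y i)" using pos by simp
  finally show ?thesis .
qed

text \<open>Normalise each g i by its integral, apply the arithmetic-geometric mean pointwise and
  integrate: the weights sum to 1. If some integral is 0, that function and hence the product vanish
  almost everywhere.\<close>

lemma Hoelder_prod:
  fixes g :: "'i \<Rightarrow> 'a \<Rightarrow> real" and a :: "'i \<Rightarrow> real"
  assumes I: "finite I" and a: "\<And>i. i \<in> I \<Longrightarrow> 0 \<le> a i" "sum a I = 1"
    and g: "\<And>i. i \<in> I \<Longrightarrow> integrable M (g i)" "\<And>i. i \<in> I \<Longrightarrow> AE x in M. 0 \<le> g i x"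
  shows "integrable M (\<lambda>x. \<Prod>i\<in>I. g i x powr a i)"
    and "(LINT x|M. (\<Prod>i\<in>I. g i x powr a i)) \<le> (\<Prod>i\<in>I. (LINT x|M. g i x) powr a i)"
proof -
  have nn: "AE x in M. \<forall>i\<in>I. 0 \<le> g i x" using I g(2) by (simp add: AE_finite_all)
  have m: "(\<lambda>x. \<Prod>i\<in>I. g i x powr a i) \<in> borel_measurable M"
    using g(1) by (intro borel_measurable_prod powr_real_measurable borel_measurable_const) auto
  show int: "integrable M (\<lambda>x. \<Prod>i\<in>I. g i x powr a i)"
  proof (rule Bochner_Integration.integrable_bound[OF _ m])
    show "integrable M (\<lambda>x. \<Sum>i\<in>I. a i * g i x)" using g(1) by auto
    show "AE x in M. norm (\<Prod>i\<in>I. g i x powr a i) \<le> norm (\<Sum>i\<in>I. a i * g i x)"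
      using nn
    proof eventually_elim
      fix x assume "\<forall>i\<in>I. 0 \<le> g i x"
      then show "norm (\<Prod>i\<in>I. g i x powr a i) \<le> norm (\<Sum>i\<in>I. a i * g i x)"
        using weighted_arith_geom_mean[OF I a, of "\<lambda>i. g i x"] by (simp add: prod_nonneg)
    qed
  qed
  show "(LINT x|M. (\<Prod>i\<in>I. g i x powr a i)) \<le> (\<Prod>i\<in>I. (LINT x|M. g i x) powr a i)"
  proof (cases "\<exists>i\<in>I. (LINT x|M. g i x) = 0")
    case True
    then obtain i where i: "i \<in> I" "(LINT x|M. g i x) = 0" by blast
    then have "AE x in M. g i x = 0"
      using integral_nonneg_eq_0_iff_AE[OF g(1)[OF i(1)] g(2)[OF i(1)]] by simp
    then have "AE x in M. (\<Prod>i\<in>I. g i x powr a i) = 0"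
      by eventually_elim (use i I in \<open>auto simp: prod_zero_iff\<close>)
    then have "(LINT x|M. (\<Prod>i\<in>I. g i x powr a i)) = (LINT x|M. 0)"
      by (intro integral_cong_AE m) auto
    then show ?thesis by (simp add: prod_nonneg)
  next
    case False
    have G: "0 < (LINT x|M. g i x)" if "i \<in> I" for i
      using False integral_nonneg_AE[OF g(2)[OF that]] that by force
    let ?P = "\<Prod>i\<in>I. (LINT x|M. g i x) powr a i"
    have "(LINT x|M. (\<Prod>i\<in>I. g i x powr a i)) \<le> (LINT x|M. ?P * (\<Sum>i\<in>I. a i * (g i x / (LINT x|M. g i x))))"
    proof (rule integral_mono_AE[OF int])
      show "integrable M (\<lambda>x. ?P * (\<Sum>i\<in>I. a i * (g i x / (LINT x|M. g i x))))" using g(1) by auto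
      show "AE x in M. (\<Prod>i\<in>I. g i x powr a i) \<le> ?P * (\<Sum>i\<in>I. a i * (g i x / (LINT x|M. g i x)))"
        using nn
      proof eventually_elim
        fix x assume nnx: "\<forall>i\<in>I. 0 \<le> g i x"
        have "(\<Prod>i\<in>I. g i x powr a i) = ?P * (\<Prod>i\<in>I. (g i x / (LINT x|M. g i x)) powr a i)"
          unfolding prod.distrib[symmetric]
          by (rule prod.cong) (use nnx G in \<open>auto simp: powr_divide less_imp_le dest: G\<close>)
        also have "\<dots> \<le> ?P * (\<Sum>i\<in>I. a i * (g i x / (LINT x|M. g i x)))"
          using nnx G by (intro mult_left_mono weighted_arith_geom_mean I a prod_nonneg) (auto simp: less_imp_le)
        finally show "(\<Prod>i\<in>I. g i x powr a i) \<le> ?P * (\<Sum>i\<in>I. a i * (g i x / (LINT x|M. g i x)))" .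
      qed
    qed
    also have "\<dots> = ?P * (\<Sum>i\<in>I. a i * ((LINT x|M. g i x) / (LINT x|M. g i x)))"
      using g(1) by (simp del: divide_self_if)
    also have "(\<Sum>i\<in>I. a i * ((LINT x|M. g i x) / (LINT x|M. g i x))) = sum a I"
      by (rule sum.cong) (auto dest: G)
    also have "?P * sum a I = ?P" by (simp add: a(2))
    finally show ?thesis .
  qed
qed

lemma Hoelder_2:
  fixes f g :: "'a \<Rightarrow> real"
  assumes "0 \<le> a" "0 \<le> b" "a + b = 1" "integrable M f" "integrable M g"
    "AE x in M. 0 \<le> f x" "AE x in M. 0 \<le> g x"
  shows "integrable M (\<lambda>x. f x powr a * g x powr b)"
    and "(LINT x|M. f x powr a * g x powr b) \<le> (LINT x|M. f x) powr a * (LINT x|M. g x) powr b"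
proof -
  let ?a = "\<lambda>i. if i then a else b" and ?g = "\<lambda>i. if i then f else g"
  have "integrable M (\<lambda>x. \<Prod>i\<in>UNIV. ?g i x powr ?a i)"
    "(LINT x|M. (\<Prod>i\<in>UNIV. ?g i x powr ?a i)) \<le> (\<Prod>i\<in>UNIV. (LINT x|M. ?g i x) powr ?a i)"
    by (rule Hoelder_prod; use assms in \<open>auto simp: UNIV_bool\<close>)+
  then show "integrable M (\<lambda>x. f x powr a * g x powr b)"
    "(LINT x|M. f x powr a * g x powr b) \<le> (LINT x|M. f x) powr a * (LINT x|M. g x) powr b"
    by (simp_all add: UNIV_bool mult.commute)
qed

subsection \<open>The Gagliardo-Nirenberg inequality\<close>

text \<open>The product over the coordinate directions is peeled off one direction at a time. Requiring
  \<open>f\<close> to be bounded and bounded away from \<open>0\<close> on a finite measure space makes all integrals finite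
  and keeps every base of a power positive.\<close>

lemma grid_lines_inequality:
  fixes \<mu> :: "'b measure" and f :: "('i \<Rightarrow> 'b) \<Rightarrow> real"
  assumes \<mu>: "finite_measure \<mu>" "0 < measure \<mu> (space \<mu>)" and B: "finite B"
    and p: "0 \<le> p" "(real (card B) - 1) * p \<le> 1"
    and f: "f \<in> borel_measurable (PiM B (\<lambda>_. \<mu>))" "0 < \<epsilon>"
      "\<And>x. x \<in> space (PiM B (\<lambda>_. \<mu>)) \<Longrightarrow> \<epsilon> \<le> f x \<and> f x \<le> K"
  shows "integrable (PiM B (\<lambda>_. \<mu>)) (\<lambda>x. f x powr (1 - (real (card B) - 1) * p) *
            (\<Prod>j\<in>B. (LINT t|\<mu>. f (x(j := t))) powr p)) \<and>
          (LINT x|PiM B (\<lambda>_. \<mu>). f x powr (1 - (real (card B) - 1) * p) *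
            (\<Prod>j\<in>B. (LINT t|\<mu>. f (x(j := t))) powr p))
          \<le> (LINT x|PiM B (\<lambda>_. \<mu>). f x) powr (1 + p)"
  using B p(2) f
proof (induction B arbitrary: f \<epsilon> K rule: finite_induct)
  case empty
  interpret product_sigma_finite "\<lambda>_::'i. \<mu>"
    using \<mu>(1) by (simp add: product_sigma_finite_def finite_measure_def)
  \<comment> \<open>Without directions the product space is a single point and the exponent 1 - (0 -
    1) p is 1 + p, so both sides are equal.\<close>
  show ?case
    by (simp add: PiM_empty lebesgue_integral_count_space_finite integrable_count_space)
next
  case (insert i B)
  interpret \<mu>: finite_measure \<mu> by fact
  interpret product_sigma_finite "\<lambda>_::'i. \<mu>"
    by (simp add: product_sigma_finite_def \<mu>.sigma_finite_measure_axioms)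
  interpret pair: pair_sigma_finite \<mu> \<mu>
    by (simp add: pair_sigma_finite_def \<mu>.sigma_finite_measure_axioms)
  have finP: "finite_measure (PiM J (\<lambda>_. \<mu>))" if "finite J" for J :: "'i set"
  proof (rule finite_measureI)
    have "emeasure (PiM J (\<lambda>_. \<mu>)) (space (PiM J (\<lambda>_. \<mu>))) = (\<Prod>j\<in>J. emeasure \<mu> (space \<mu>))"
      unfolding space_PiM by (rule emeasure_PiM[OF that]) simp
    then show "emeasure (PiM J (\<lambda>_. \<mu>)) (space (PiM J (\<lambda>_. \<mu>))) \<noteq> \<infinity>"
      by (simp add: \<mu>.emeasure_eq_measure ennreal_power)
  qed
  let ?P = "PiM B (\<lambda>_. \<mu>)" and ?P' = "PiM (insert i B) (\<lambda>_. \<mu>)"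
  let ?m = "measure \<mu> (space \<mu>)" and ?n = "real (card B)"
  interpret P: finite_measure ?P using insert by (intro finP) auto
  interpret P': finite_measure ?P' using insert by (intro finP) auto
  note fm = insert.prems(2) and eps = insert.prems(3) and fb = insert.prems(4)
  have np: "?n * p \<le> 1" and np': "(?n - 1) * p \<le> 1"
    using insert p by (auto simp: left_diff_distrib)
  have upd: "x(j := t) \<in> space ?P'" if "x \<in> space ?P'" "t \<in> space \<mu>" "j \<in> insert i B" for x t j
    using that by (auto simp: space_PiM PiE_iff extensional_def)
  have upd_i: "x(i := t) \<in> space ?P'" if "x \<in> space ?P" "t \<in> space \<mu>" for x t
    using that by (auto simp: space_PiM PiE_iff extensional_def)
  have bound_int: "\<epsilon> * ?m \<le> (LINT t|\<mu>. h t) \<and> (LINT t|\<mu>. h t) \<le> K * ?m \<and> integrable \<mu> h"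
    if "h \<in> borel_measurable \<mu>" "\<And>t. t \<in> space \<mu> \<Longrightarrow> \<epsilon> \<le> h t \<and> h t \<le> K" for h :: "'b \<Rightarrow> real" and \<epsilon> K
  proof -
    have i: "integrable \<mu> h"
      using that by (intro \<mu>.integrable_const_bound[of _ "\<bar>\<epsilon>\<bar> + \<bar>K\<bar>"] AE_I2) (auto simp: abs_le_iff, (smt (verit))+)
    have "(LINT t|\<mu>. \<epsilon>) \<le> (LINT t|\<mu>. h t)" "(LINT t|\<mu>. h t) \<le> (LINT t|\<mu>. K)"
      using that(2) by (intro integral_mono i \<mu>.integrable_const; simp)+
    then show ?thesis using i by (simp add: mult.commute[of "measure _ _"])
  qed
  have ext: "x \<in> extensional J" if "x \<in> space (PiM J (\<lambda>_. \<mu>))" for x and J :: "'i set"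
    using that by (simp add: space_PiM PiE_iff)
  have m_upd: "(\<lambda>(x, t). f (x(j := t))) \<in> borel_measurable (?P' \<Otimes>\<^sub>M \<mu>)" if "j \<in> insert i B" for j
  proof -
    have "(\<lambda>z. (fst z)(j := snd z)) \<in> measurable (?P' \<Otimes>\<^sub>M \<mu>) (PiM (insert j (insert i B)) (\<lambda>_. \<mu>))"
      by (rule measurable_fun_upd[where M = "\<lambda>_. \<mu>" and J = "insert i B"]) auto
    then have "(\<lambda>z. f ((fst z)(j := snd z))) \<in> borel_measurable (?P' \<Otimes>\<^sub>M \<mu>)"
      using that by (intro measurable_compose[OF _ fm]) (simp only: insert_absorb)
    then show ?thesis by (simp add: case_prod_beta')
  qed
  have m_upd_i: "(\<lambda>(x, t). f (x(i := t))) \<in> borel_measurable (?P \<Otimes>\<^sub>M \<mu>)"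
  proof -
    have "(\<lambda>z. (fst z)(i := snd z)) \<in> measurable (?P \<Otimes>\<^sub>M \<mu>) ?P'"
      by (rule measurable_fun_upd[where M = "\<lambda>_. \<mu>" and J = B]) (auto simp: space_pair_measure ext)
    then have "(\<lambda>z. f ((fst z)(i := snd z))) \<in> borel_measurable (?P \<Otimes>\<^sub>M \<mu>)"
      by (rule measurable_compose[OF _ fm])
    then show ?thesis by (simp add: case_prod_beta')
  qed
  \<comment> \<open>\<open>F\<close> is f with direction i integrated out; its lower and upper
    bounds are those of f times the mass of \<mu>, so the induction hypothesis applies to it.
    \<open>G j x y\<close> is the line integral in direction j while the coordinate i is frozen at
    y.\<close>
  define F where "F x = (LINT t|\<mu>. f (x(i := t)))" for x
  define G where "G j x y = (LINT t|\<mu>. f (x(i := y, j := t)))" for j x y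
  have m_fi: "(\<lambda>t. f (x(i := t))) \<in> borel_measurable \<mu>" if "x \<in> space ?P" for x
    using measurable_compose[OF measurable_Pair1'[OF that] m_upd_i] by simp
  have m_f: "(\<lambda>t. f (x(j := t))) \<in> borel_measurable \<mu>" if "x \<in> space ?P'" "j \<in> insert i B" for x j
    using measurable_compose[OF measurable_Pair1'[OF that(1)] m_upd[OF that(2)]] by simp
  have Fm: "F \<in> borel_measurable ?P"
    unfolding F_def by (rule \<mu>.borel_measurable_lebesgue_integral[OF m_upd_i])
  have Fb: "\<epsilon> * ?m \<le> F x \<and> F x \<le> K * ?m" if "x \<in> space ?P" for x
    unfolding F_def using bound_int[OF m_fi[OF that]] fb[OF upd_i[OF that]] by blast
  have Im: "(\<lambda>x. LINT t|\<mu>. f (x(j := t))) \<in> borel_measurable ?P'" if "j \<in> insert i B" for j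
    by (rule \<mu>.borel_measurable_lebesgue_integral[OF m_upd[OF that]])
  have Ib: "\<epsilon> * ?m \<le> (LINT t|\<mu>. f (x(j := t))) \<and> (LINT t|\<mu>. f (x(j := t))) \<le> K * ?m"
    if "x \<in> space ?P'" "j \<in> insert i B" for x j
    using bound_int[OF m_f[OF that]] fb[OF upd[OF that(1) _ that(2)]] by blast
  have em: "0 < \<epsilon> * ?m" using eps \<mu>(2) by simp
  have m_y: "(\<lambda>y. x(i := y)) \<in> measurable \<mu> ?P'" if "x \<in> space ?P" for x
    by (rule measurable_fun_upd[where M = "\<lambda>_. \<mu>" and J = B]) (use that ext in \<open>auto simp: measurable_const\<close>)
  have Gm: "G j x \<in> borel_measurable \<mu>" if "x \<in> space ?P" "j \<in> B" for x j
    unfolding G_def using measurable_compose[OF m_y[OF that(1)] Im[of j]] that by simp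
  have Gb: "\<epsilon> * ?m \<le> G j x y \<and> G j x y \<le> K * ?m" if "x \<in> space ?P" "j \<in> B" "y \<in> space \<mu>" for x j y
    unfolding G_def using Ib[OF upd_i[OF that(1,3)], of j] that by simp
  define h where "h x = f x powr (1 - ?n * p) * (\<Prod>j\<in>insert i B. (LINT t|\<mu>. f (x(j := t))) powr p)" for x
  have hm: "h \<in> borel_measurable ?P'"
    unfolding h_def
    by (intro borel_measurable_times borel_measurable_prod powr_real_measurable fm Im borel_measurable_const)
  have hi: "integrable ?P' h"
  proof (rule P'.integrable_const_bound[OF _ hm, of "K powr (1 - ?n * p) * (\<Prod>j\<in>insert i B. (K * ?m) powr p)"], rule AE_I2)
    fix x assume x: "x \<in> space ?P'"
    have "(\<Prod>j\<in>insert i B. (LINT t|\<mu>. f (x(j := t))) powr p) \<le> (\<Prod>j\<in>insert i B. (K * ?m) powr p)"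
      using Ib[OF x] em p by (intro prod_mono) (auto intro!: powr_mono2 less_imp_le[OF less_le_trans[OF em]])
    moreover have "f x powr (1 - ?n * p) \<le> K powr (1 - ?n * p)"
      using fb[OF x] eps np by (intro powr_mono2) auto
    ultimately show "norm (h x) \<le> K powr (1 - ?n * p) * (\<Prod>j\<in>insert i B. (K * ?m) powr p)"
      unfolding h_def by (auto simp: abs_mult abs_prod prod_nonneg intro!: mult_mono)
  qed
  define h' where "h' x = F x powr (1 - (?n - 1) * p) * (\<Prod>j\<in>B. (LINT t|\<mu>. F (x(j := t))) powr p)" for x
  have IH: "integrable ?P h'" "(LINT x|?P. h' x) \<le> (LINT x|?P. F x) powr (1 + p)"
    unfolding h'_def using insert.IH[OF np' Fm em Fb] by blast+
  have inner: "(LINT y|\<mu>. h (x(i := y))) \<le> h' x" if x: "x \<in> space ?P" for x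
  proof -
    \<comment> \<open>The line integral in direction i does not depend on y and leaves the integral
      as F x powr p. The remaining exponents, one 1 - n p and n times p, sum to 1, as Hoelder's
      inequality requires.\<close>
    let ?a = "\<lambda>k. if k = i then 1 - ?n * p else p"
    let ?g = "\<lambda>k y. if k = i then f (x(i := y)) else G k x y"
    have F0: "0 < F x" using Fb[OF x] em by linarith
    have "h (x(i := y)) = F x powr p * (\<Prod>k\<in>insert i B. ?g k y powr ?a k)" for y
    proof -
      have "h (x(i := y)) = f (x(i := y)) powr (1 - ?n * p) * (F x powr p * (\<Prod>j\<in>B. G j x y powr p))"
        using insert.hyps by (simp add: h_def F_def G_def)
      also have "(\<Prod>j\<in>B. G j x y powr p) = (\<Prod>k\<in>B. ?g k y powr ?a k)"
        using insert.hyps by (intro prod.cong) auto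
      finally show ?thesis using insert.hyps by (simp del: fun_upd_apply)
    qed
    then have "(LINT y|\<mu>. h (x(i := y))) = F x powr p * (LINT y|\<mu>. (\<Prod>k\<in>insert i B. ?g k y powr ?a k))"
      by simp
    also have "(LINT y|\<mu>. (\<Prod>k\<in>insert i B. ?g k y powr ?a k)) \<le> (\<Prod>k\<in>insert i B. (LINT y|\<mu>. ?g k y) powr ?a k)"
    proof (rule Hoelder_prod(2))
      have "sum ?a B = ?n * p"
        using insert.hyps by (subst sum.cong[where h = "\<lambda>_. p", OF refl]) auto
      then show "sum ?a (insert i B) = 1" using insert.hyps by simp
      show "integrable \<mu> (?g k)" if "k \<in> insert i B" for k
      proof (cases "k = i")
        case True
        then show ?thesis using bound_int[OF m_fi[OF x] fb[OF upd_i[OF x]]] by (simp del: fun_upd_apply)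
      next
        case False
        then have "k \<in> B" using that by simp
        then show ?thesis using bound_int[OF Gm[OF x] Gb[OF x]] False by simp
      qed
      show "AE y in \<mu>. 0 \<le> ?g k y" if "k \<in> insert i B" for k
      proof (rule AE_I2)
        fix y assume y: "y \<in> space \<mu>"
        show "0 \<le> ?g k y"
        proof (cases "k = i")
          case True
          then show ?thesis using fb[OF upd_i[OF x y]] eps by (simp del: fun_upd_apply)
        next
          case False
          then have "k \<in> B" using that by simp
          from Gb[OF x this y] show ?thesis using False em by simp
        qed
      qed
    qed (use insert.hyps p np in auto)
    also have "(\<Prod>k\<in>insert i B. (LINT y|\<mu>. ?g k y) powr ?a k)
        = F x powr (1 - ?n * p) * (\<Prod>j\<in>B. (LINT y|\<mu>. G j x y) powr p)"
    proof -
      have "(\<Prod>k\<in>B. (LINT y|\<mu>. ?g k y) powr ?a k) = (\<Prod>j\<in>B. (LINT y|\<mu>. G j x y) powr p)"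
        using insert.hyps by (intro prod.cong) auto
      then show ?thesis using insert.hyps by (simp add: F_def)
    qed
    \<comment> \<open>Fubini exchanges the integrations in the different directions i and j, which
      turns G into line integrals of F.\<close>
    also have "(\<Prod>j\<in>B. (LINT y|\<mu>. G j x y) powr p) = (\<Prod>j\<in>B. (LINT t|\<mu>. F (x(j := t))) powr p)"
    proof (rule prod.cong[OF refl])
      fix j assume j: "j \<in> B"
      then have ji: "j \<noteq> i" using insert.hyps by blast
      have mm: "(\<lambda>(y, t). f (x(i := y, j := t))) \<in> borel_measurable (\<mu> \<Otimes>\<^sub>M \<mu>)"
      proof -
        have "(\<lambda>z. (x(i := fst z), snd z)) \<in> measurable (\<mu> \<Otimes>\<^sub>M \<mu>) (?P' \<Otimes>\<^sub>M \<mu>)"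
          by (intro measurable_Pair measurable_compose[OF measurable_fst m_y[OF x]] measurable_snd)
        from measurable_compose[OF this m_upd[of j]] j show ?thesis by (simp add: case_prod_beta')
      qed
      have fin2: "finite_measure (\<mu> \<Otimes>\<^sub>M \<mu>)"
        by (rule finite_measure_pair_measure) fact+
      have "integrable (\<mu> \<Otimes>\<^sub>M \<mu>) (\<lambda>(y, t). f (x(i := y, j := t)))"
      proof (rule finite_measure.integrable_const_bound[OF fin2 _ mm, of K], rule AE_I2)
        fix z assume z: "z \<in> space (\<mu> \<Otimes>\<^sub>M \<mu>)"
        have "x(i := fst z, j := snd z) \<in> space ?P'"
          using z j by (intro upd upd_i x) (auto simp: space_pair_measure)
        from fb[OF this] eps have "norm (f (x(i := fst z, j := snd z))) \<le> K"
          unfolding real_norm_def abs_le_iff by linarith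
        then show "norm (case z of (y, t) \<Rightarrow> f (x(i := y, j := t))) \<le> K"
          by (cases z) (simp only: split fst_conv snd_conv)
      qed
      from pair.Fubini_integral[OF this]
      have "(LINT y|\<mu>. G j x y) = (LINT t|\<mu>. LINT y|\<mu>. f (x(i := y, j := t)))"
        by (simp add: G_def)
      also have "\<dots> = (LINT t|\<mu>. F (x(j := t)))"
        using ji by (simp add: F_def fun_upd_twist)
      finally show "(LINT y|\<mu>. G j x y) powr p = (LINT t|\<mu>. F (x(j := t))) powr p" by simp
    qed
    \<comment> \<open>The exponents p and 1 - n p of F add up to 1 - (n - 1) p, the exponent that
      belongs to n directions.\<close>
    also have "F x powr p * (F x powr (1 - ?n * p) * (\<Prod>j\<in>B. (LINT t|\<mu>. F (x(j := t))) powr p)) = h' x"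
      using F0 by (simp add: h'_def mult.assoc[symmetric] powr_add[symmetric] algebra_simps)
    finally show ?thesis by (simp only: mult_left_mono powr_ge_zero)
  qed
  have "(LINT x|?P'. h x) = (LINT x|?P. LINT y|\<mu>. h (x(i := y)))"
    by (rule product_integral_insert[OF insert.hyps hi])
  also have "\<dots> \<le> (LINT x|?P. h' x)"
  proof (rule integral_mono[OF _ IH(1) inner])
    show "integrable ?P (\<lambda>x. LINT y|\<mu>. h (x(i := y)))"
    proof (rule Bochner_Integration.integrable_bound[OF IH(1)])
      have "(\<lambda>z. (fst z)(i := snd z)) \<in> measurable (?P \<Otimes>\<^sub>M \<mu>) ?P'"
        by (rule measurable_fun_upd[where M = "\<lambda>_. \<mu>" and J = B]) auto
      from measurable_compose[OF this hm]
      show "(\<lambda>x. LINT y|\<mu>. h (x(i := y))) \<in> borel_measurable ?P"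
        by (intro \<mu>.borel_measurable_lebesgue_integral) (simp add: case_prod_beta')
      have h0: "0 \<le> (LINT y|\<mu>. h (x(i := y)))" for x
        unfolding h_def by (intro Bochner_Integration.integral_nonneg mult_nonneg_nonneg prod_nonneg) auto
      show "AE x in ?P. norm (LINT y|\<mu>. h (x(i := y))) \<le> norm (h' x)"
        using h0 inner by (intro AE_I2) (simp add: order_trans[OF _ abs_ge_self] del: fun_upd_apply)
    qed
  qed
  also have "\<dots> \<le> (LINT x|?P. F x) powr (1 + p)"
    by (rule IH(2))
  also have "(LINT x|?P. F x) = (LINT x|?P'. f x)"
    unfolding F_def
    by (rule product_integral_insert[symmetric, OF insert.hyps])
       (use fb eps in \<open>force intro!: P'.integrable_const_bound[of _ K] fm AE_I2 simp: abs_le_iff\<close>)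
  finally have "(LINT x|?P'. h x) \<le> (LINT x|?P'. f x) powr (1 + p)" .
  moreover have "real (card (insert i B)) - 1 = ?n" using insert.hyps by simp
  ultimately show ?case using hi unfolding h_def by (simp only: simp_thms)
qed

text \<open>The grid inequality needs factors of finite mass, while the claim concerns Lebesgue
  measure; cutting every factor down to J is the same as cutting the product down to a cube. It
  suffices to compare both sides on rectangles.\<close>

lemma PiM_density_interval:
  fixes I :: "'i set" and J :: "real set"
  assumes I: "finite I" and J: "J \<in> sets borel"
  shows "PiM I (\<lambda>_. density lborel (indicator J)) =
    density (PiM I (\<lambda>_. lborel)) (indicator (\<Pi>\<^sub>E i\<in>I. J))"
proof -
  interpret L: product_sigma_finite "\<lambda>_::'i. lborel :: real measure" ..
  interpret sigma_finite_measure "density lborel (indicator J) :: real measure"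
    by (subst sigma_finite_measure.sigma_finite_iff_density_finite[OF sigma_finite_lborel]) (use J in simp, simp add: indicator_def)
  interpret D: product_sigma_finite "\<lambda>_::'i. density lborel (indicator J) :: real measure" ..
  have JI: "(\<Pi>\<^sub>E i\<in>I. J) \<in> sets (PiM I (\<lambda>_. lborel))"
    using I J by (intro sets_PiM_I_finite) auto
  show ?thesis
  proof (rule D.PiM_eqI[OF I, symmetric])
    show "sets (density (PiM I (\<lambda>_. lborel)) (indicator (\<Pi>\<^sub>E i\<in>I. J))) = sets (PiM I (\<lambda>_. density lborel (indicator J)))"
      by (simp cong: sets_PiM_cong)
    fix A :: "'i \<Rightarrow> real set" assume A: "\<And>i. i \<in> I \<Longrightarrow> A i \<in> sets (density lborel (indicator J))"
    then have A': "A i \<inter> J \<in> sets lborel" "A i \<in> sets borel" if "i \<in> I" for i using J that by auto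
    have PA: "Pi\<^sub>E I A \<in> sets (PiM I (\<lambda>_. lborel))" using I A by (intro sets_PiM_I_finite) auto
    have "emeasure (density (PiM I (\<lambda>_. lborel)) (indicator (\<Pi>\<^sub>E i\<in>I. J))) (Pi\<^sub>E I A) =
        (\<integral>\<^sup>+x. indicator (\<Pi>\<^sub>E i\<in>I. A i \<inter> J) x \<partial>PiM I (\<lambda>_. lborel))"
      using PA JI by (subst emeasure_density) (auto intro!: nn_integral_cong simp: indicator_def PiE_iff)
    also have "\<dots> = emeasure (PiM I (\<lambda>_. lborel)) (\<Pi>\<^sub>E i\<in>I. A i \<inter> J)"
      using I A' by (intro nn_integral_indicator sets_PiM_I_finite) auto
    also have "\<dots> = (\<Prod>i\<in>I. emeasure lborel (A i \<inter> J))"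
      using A' by (intro L.emeasure_PiM I) auto
    also have "\<dots> = (\<Prod>i\<in>I. emeasure (density lborel (indicator J)) (A i))"
    proof (rule prod.cong[OF refl])
      fix i assume i: "i \<in> I"
      have "emeasure (density lborel (indicator J)) (A i) = (\<integral>\<^sup>+x. indicator (A i \<inter> J) x \<partial>lborel)"
      proof -
        have "emeasure (density lborel (indicator J)) (A i) = (\<integral>\<^sup>+x. indicator J x * indicator (A i) x \<partial>lborel)"
          using A'[OF i] J by (intro emeasure_density) auto
        also have "\<dots> = (\<integral>\<^sup>+x. indicator (A i \<inter> J) x \<partial>lborel)"
          by (rule nn_integral_cong) (auto simp: indicator_def)
        finally show ?thesis .
      qed
      then show "emeasure lborel (A i \<inter> J) = emeasure (density lborel (indicator J)) (A i)"
        using A'(1)[OF i] by simp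
    qed
    finally show "emeasure (density (PiM I (\<lambda>_. lborel)) (indicator (\<Pi>\<^sub>E i\<in>I. J))) (Pi\<^sub>E I A) =
      (\<Prod>i\<in>I. emeasure (density lborel (indicator J)) (A i))" .
  qed
qed

text \<open>By the fundamental theorem of calculus, |\<phi>(x)| is at most the integral of |grad
  \<phi>| along each of the N coordinate lines through x. Multiplying these N bounds, each to the
  power 1/(N - 1), gives the integrand of \<open>grid_lines_inequality\<close>, in which f itself
  then has exponent 0. The grid inequality wants f bounded away from 0, so the norm of the gradient
  is raised by \<epsilon>, which tends to 0 at the end.\<close>

lemma Gagliardo_Nirenberg:
  fixes \<phi> :: "'a::euclidean_space \<Rightarrow> real"
  assumes \<phi>: "\<phi> \<in> Cc_infinity \<Omega>" and dim: "DIM('a) \<ge> 2"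
  defines "q \<equiv> real DIM('a) / (real DIM('a) - 1)"
  shows "(LINT x|lborel. \<bar>\<phi> x\<bar> powr q) \<le> (LINT x|lborel. norm (gradient \<phi> x)) powr q"
proof -
  define N where "N = real DIM('a)"
  define p where "p = 1 / (N - 1)"
  have N2: "N \<ge> 2" using dim by (simp add: N_def)
  have p: "0 < p" "(N - 1) * p = 1" "1 + p = q" "N * p = q"
    using N2 by (auto simp: p_def q_def N_def[symmetric] field_simps)
  note sm = Cc_infinity_smooth[OF \<phi>]
  obtain K where K: "compact K" "K \<subseteq> \<Omega>" "\<And>x. x \<notin> K \<Longrightarrow> \<phi> x = 0" "\<And>x. x \<notin> K \<Longrightarrow> gradient \<phi> x = 0"
    using Cc_infinity_support[OF \<phi>] by metis
  obtain L where L: "\<And>x. \<bar>\<phi> x\<bar> \<le> L" "\<And>x. norm (gradient \<phi> x) \<le> L"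
    using Cc_infinity_bounded[OF \<phi>] by blast
  obtain R0 where R0: "\<And>x. x \<in> K \<Longrightarrow> norm x \<le> R0"
    using compact_imp_bounded[OF K(1)] by (auto simp: bounded_iff)
  \<comment> \<open>The extra 1 puts K strictly inside the cube, so that on every coordinate line
    through K the function vanishes at the end -R.\<close>
  define R where "R = \<bar>R0\<bar> + 1"
  have R: "0 < R" "\<And>x. x \<in> K \<Longrightarrow> norm x < R" using R0 by (force simp: R_def)+
  define J where "J = {-R..R}"
  define \<mu> where "\<mu> = density lborel (indicator J :: real \<Rightarrow> ennreal)"
  define P where "P = PiM (Basis :: 'a set) (\<lambda>_. \<mu>)"
  define S where "S \<xi> = (\<Sum>b\<in>Basis. \<xi> b *\<^sub>R b)" for \<xi> :: "'a \<Rightarrow> real"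
  have Jm: "J \<in> sets borel" by (simp add: J_def)
  have space_\<mu>: "space \<mu> = UNIV" by (simp add: \<mu>_def)
  have em: "emeasure \<mu> UNIV = ennreal (2 * R)"
    using R(1) by (simp add: \<mu>_def emeasure_density J_def)
  interpret \<mu>: finite_measure \<mu>
    by (rule finite_measureI) (simp add: space_\<mu> em)
  have mu_m: "measure \<mu> (space \<mu>) = 2 * R"
    using em R(1) by (simp add: measure_def space_\<mu>)
  have int\<mu>: "(LINT t|\<mu>. h t) = (LINT t|lborel. indicator J t * h t)" if "h \<in> borel_measurable borel" for h :: "real \<Rightarrow> real"
  proof -
    have "\<mu> = density lborel (\<lambda>t. ennreal (indicator J t))"
      by (simp add: \<mu>_def ennreal_indicator)
    then show ?thesis using that Jm by (simp add: integral_density)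
  qed
  have Sm: "S \<in> borel_measurable (PiM Basis (\<lambda>_. lborel))"
    unfolding S_def[abs_def] by measurable
  have setsP: "sets P = sets (PiM Basis (\<lambda>_. lborel))"
    unfolding P_def \<mu>_def by (rule sets_PiM_cong) auto
  have SmP: "S \<in> borel_measurable P"
    using Sm measurable_cong_sets[OF setsP refl] by blast
  have S_inner: "S \<xi> \<bullet> b = \<xi> b" if "b \<in> Basis" for \<xi> b
    using that by (simp add: S_def inner_sum_left inner_Basis if_distrib cong: if_cong)
  \<comment> \<open>\<open>S\<close> assembles a vector from its coordinates and carries the product
    of the lines to Lebesgue measure. Restricting to the cube loses nothing for functions that
    vanish off K.\<close>
  have transfer: "(LINT \<xi>|P. H (S \<xi>)) = (LINT x|lborel. H x)"
    if H: "H \<in> borel_measurable borel" "\<And>x. x \<notin> K \<Longrightarrow> H x = 0" for H :: "'a \<Rightarrow> real"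
  proof -
    have "P = density (PiM Basis (\<lambda>_. lborel)) (\<lambda>\<xi>. ennreal (indicator (\<Pi>\<^sub>E i\<in>Basis. J) \<xi>))"
      unfolding P_def \<mu>_def by (subst PiM_density_interval[OF finite_Basis Jm]) (simp add: ennreal_indicator)
    moreover have "(\<Pi>\<^sub>E i\<in>Basis. J) \<in> sets (PiM (Basis :: 'a set) (\<lambda>_. lborel))"
      using Jm by (intro sets_PiM_I_finite) auto
    ultimately have "(LINT \<xi>|P. H (S \<xi>)) = (LINT \<xi>|PiM Basis (\<lambda>_. lborel). indicator (\<Pi>\<^sub>E i\<in>Basis. J) \<xi> *\<^sub>R H (S \<xi>))"
      using measurable_compose[OF Sm H(1)] by (simp only:) (rule integral_density; auto)
    also have "\<dots> = (LINT \<xi>|PiM Basis (\<lambda>_. lborel). H (S \<xi>))"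
    proof (rule Bochner_Integration.integral_cong[OF refl])
      fix \<xi> assume \<xi>: "\<xi> \<in> space (PiM (Basis :: 'a set) (\<lambda>_. lborel :: real measure))"
      show "indicator (\<Pi>\<^sub>E i\<in>Basis. J) \<xi> *\<^sub>R H (S \<xi>) = H (S \<xi>)"
      proof (cases "S \<xi> \<in> K")
        case True
        have "\<xi> b \<in> J" if b: "b \<in> Basis" for b
          using Basis_le_norm[OF b, of "S \<xi>"] R(2)[OF True] S_inner[OF b] by (auto simp: J_def)
        then have "\<xi> \<in> (\<Pi>\<^sub>E i\<in>Basis. J)" using \<xi> by (auto simp: space_PiM PiE_iff)
        then show ?thesis by simp
      qed (use H(2) in simp)
    qed
    also have "\<dots> = (LINT x|distr (PiM Basis (\<lambda>_. lborel)) borel S. H x)"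
      by (rule integral_distr[symmetric, OF Sm H(1)])
    also have "distr (PiM Basis (\<lambda>_. lborel)) borel S = lborel"
      unfolding S_def[abs_def] by (rule lborel_eq[symmetric])
    finally show ?thesis .
  qed
  have finP: "finite_measure P"
  proof (rule finite_measureI)
    interpret product_sigma_finite "\<lambda>_::'a. \<mu>"
      by (simp add: product_sigma_finite_def \<mu>.sigma_finite_measure_axioms)
    have "emeasure P (space P) = (\<Prod>j\<in>(Basis :: 'a set). emeasure \<mu> (space \<mu>))"
      unfolding P_def space_PiM by (rule emeasure_PiM) auto
    then show "emeasure P (space P) \<noteq> \<infinity>"
      by (simp add: \<mu>.emeasure_eq_measure ennreal_power)
  qed
  interpret P: finite_measure P by fact
  define G where "G = (LINT x|lborel. norm (gradient \<phi> x))"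
  have cg: "continuous_on UNIV (\<lambda>x. norm (gradient \<phi> x))"
    by (intro continuous_intros smooth_on_continuous_gradient[OF sm])
  have gm: "(\<lambda>x. norm (gradient \<phi> x)) \<in> borel_measurable borel"
    by (rule borel_measurable_continuous_onI[OF cg])
  have \<phi>m: "(\<lambda>x. \<bar>\<phi> x\<bar> powr q) \<in> borel_measurable borel"
    using borel_measurable_continuous_onI[OF smooth_on_continuous[OF sm]] by measurable
  have main: "(LINT x|lborel. \<bar>\<phi> x\<bar> powr q) \<le> (G + \<epsilon> * measure P (space P)) powr q" if \<epsilon>: "0 < \<epsilon>" for \<epsilon>
  proof -
    define f where "f \<xi> = norm (gradient \<phi> (S \<xi>)) + \<epsilon>" for \<xi>
    have fm: "f \<in> borel_measurable P"
      unfolding f_def[abs_def] using measurable_compose[OF SmP gm] by measurable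
    have fb: "\<epsilon> \<le> f \<xi> \<and> f \<xi> \<le> L + \<epsilon>" for \<xi> using L(2) by (simp add: f_def)
    have fi: "(LINT \<xi>|P. f \<xi>) = G + \<epsilon> * measure P (space P)"
    proof -
      have "integrable P (\<lambda>\<xi>. norm (gradient \<phi> (S \<xi>)))"
        using measurable_compose[OF SmP gm] L(2) by (intro P.integrable_const_bound[of _ L]) auto
      moreover have "(LINT \<xi>|P. norm (gradient \<phi> (S \<xi>))) = G"
        unfolding G_def by (rule transfer[OF gm]) (simp add: K(4))
      ultimately show ?thesis by (simp add: f_def mult.commute)
    qed
    have line: "\<bar>\<phi> (S \<xi>)\<bar> \<le> (LINT t|\<mu>. f (\<xi>(b := t)))" if b: "b \<in> Basis" for \<xi> b
    proof -
      have Supd: "S (\<xi>(b := t)) = S \<xi> + (t - \<xi> b) *\<^sub>R b" for t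
      proof -
        have "S (\<xi>(b := t)) = t *\<^sub>R b + (\<Sum>c\<in>Basis - {b}. \<xi> c *\<^sub>R c)"
          unfolding S_def using b by (subst sum.remove[of _ b]) (auto intro!: sum.cong)
        moreover have "S \<xi> = \<xi> b *\<^sub>R b + (\<Sum>c\<in>Basis - {b}. \<xi> c *\<^sub>R c)"
          unfolding S_def using b by (subst sum.remove[of _ b]) auto
        ultimately show ?thesis by (simp add: algebra_simps)
      qed
      define h where "h t = \<phi> (S \<xi> + (t - \<xi> b) *\<^sub>R b)" for t
      define h' where "h' t = gradient \<phi> (S \<xi> + (t - \<xi> b) *\<^sub>R b) \<bullet> b" for t
      have ch: "continuous_on A (\<lambda>t. norm (gradient \<phi> (S \<xi> + (t - \<xi> b) *\<^sub>R b)))" for A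
        by (intro continuous_on_compose2[OF cg] continuous_intros) auto
      have ch': "continuous_on A h'" for A
        unfolding h'_def by (intro continuous_intros continuous_on_compose2[OF smooth_on_continuous_gradient[OF sm, of UNIV]]) auto
      have dh: "(h has_vector_derivative h' t) (at t within A)" for t A
      proof -
        have "(\<phi> has_derivative (\<lambda>v. v \<bullet> gradient \<phi> (S \<xi> + (t - \<xi> b) *\<^sub>R b))) (at (S \<xi> + (t - \<xi> b) *\<^sub>R b))"
          using smooth_on_gderiv[OF sm] by (simp add: gderiv_def)
        then have "(h has_derivative (\<lambda>s. (s *\<^sub>R b) \<bullet> gradient \<phi> (S \<xi> + (t - \<xi> b) *\<^sub>R b))) (at t)"
          unfolding h_def[abs_def]
          by (intro has_derivative_compose[of "\<lambda>t. S \<xi> + (t - \<xi> b) *\<^sub>R b" "\<lambda>s. s *\<^sub>R b" t UNIV \<phi>])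
             (auto intro!: derivative_eq_intros)
        then have "(h has_vector_derivative h' t) (at t)"
          by (simp add: has_vector_derivative_def h'_def inner_commute)
        then show ?thesis by (rule has_vector_derivative_at_within)
      qed
      have h'm: "h' \<in> borel_measurable borel" using borel_measurable_continuous_onI[OF ch'] .
      have abs_h': "\<bar>h' t\<bar> \<le> f (\<xi>(b := t))" for t
        using Cauchy_Schwarz_ineq2[of "gradient \<phi> (S \<xi> + (t - \<xi> b) *\<^sub>R b)" b] b \<epsilon>
        by (simp add: h'_def f_def Supd norm_Basis del: fun_upd_apply)
      have fbm: "(\<lambda>t. f (\<xi>(b := t))) \<in> borel_measurable borel"
        unfolding f_def Supd using borel_measurable_continuous_onI[OF ch] by measurable
      have f0: "0 \<le> f (\<xi>(b := t))" for t using fb[of "\<xi>(b := t)"] \<epsilon> by linarith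
      have ind_i: "integrable lborel (\<lambda>t. indicator A t * g t)"
        if A: "A \<subseteq> J" "A \<in> sets borel" and g: "g \<in> borel_measurable borel" "\<And>t. \<bar>g t\<bar> \<le> C" for A C and g :: "real \<Rightarrow> real"
      proof (rule Bochner_Integration.integrable_bound)
        show "integrable lborel (\<lambda>t. indicator J t *\<^sub>R C)" unfolding J_def by (intro borel_integrable_compact) auto
        show "(\<lambda>t. indicator A t * g t) \<in> borel_measurable lborel" using A g by simp
        have "0 \<le> C" using g(2)[of 0] by linarith
        then show "AE t in lborel. norm (indicator A t * g t) \<le> norm (indicator J t *\<^sub>R C)"
          using A(1) g(2) by (intro AE_I2) (auto simp: indicator_def)
      qed
      show ?thesis
      proof (cases "S \<xi> \<in> K")
        case True
        have xb: "-R \<le> \<xi> b" "\<xi> b \<le> R"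
          using Basis_le_norm[OF b, of "S \<xi>"] R(2)[OF True] S_inner[OF b] by auto
        have "S \<xi> + (-R - \<xi> b) *\<^sub>R b \<notin> K"
        proof
          assume "S \<xi> + (-R - \<xi> b) *\<^sub>R b \<in> K"
          from R(2)[OF this] Basis_le_norm[OF b, of "S \<xi> + (-R - \<xi> b) *\<^sub>R b"] S_inner[OF b] b R(1)
          show False by (simp add: inner_add_left)
        qed
        then have h0: "h (-R) = 0" by (simp add: h_def K(3))
        have "\<phi> (S \<xi>) = h (\<xi> b) - h (-R)" by (simp add: h0) (simp add: h_def)
        also have "\<dots> = (LINT t|lborel. indicator {-R..\<xi> b} t *\<^sub>R h' t)"
          by (rule integral_FTC_atLeastAtMost[symmetric, OF xb(1) dh ch'])
        finally have "\<bar>\<phi> (S \<xi>)\<bar> \<le> (LINT t|lborel. \<bar>indicator {-R..\<xi> b} t * h' t\<bar>)"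
          using integral_abs_bound[of lborel "\<lambda>t. indicator {-R..\<xi> b} t * h' t"] by simp
        also have "\<dots> \<le> (LINT t|lborel. indicator J t * f (\<xi>(b := t)))"
        proof (rule integral_mono)
          have "\<bar>h' t\<bar> \<le> L + \<epsilon>" for t using abs_h'[of t] fb[of "\<xi>(b := t)"] by linarith
          then show "integrable lborel (\<lambda>t. \<bar>indicator {-R..\<xi> b} t * h' t\<bar>)"
            using xb by (intro integrable_abs ind_i[OF _ _ h'm]) (auto simp: J_def)
          show "integrable lborel (\<lambda>t. indicator J t * f (\<xi>(b := t)))"
            using fb f0 by (intro ind_i[OF _ Jm fbm, of "L + \<epsilon>"]) (auto simp del: fun_upd_apply)
          show "\<bar>indicator {-R..\<xi> b} t * h' t\<bar> \<le> indicator J t * f (\<xi>(b := t))" for t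
            using abs_h'[of t] f0[of t] xb by (auto simp: indicator_def J_def simp del: fun_upd_apply)
        qed
        also have "\<dots> = (LINT t|\<mu>. f (\<xi>(b := t)))" by (rule int\<mu>[OF fbm, symmetric])
        finally show ?thesis .
      next
        case False
        then show ?thesis using K(3) f0 by (simp del: fun_upd_apply)
      qed
    qed
    let ?prod = "\<lambda>\<xi>. f \<xi> powr (1 - (real (card (Basis :: 'a set)) - 1) * p) *
        (\<Prod>b\<in>Basis. (LINT t|\<mu>. f (\<xi>(b := t))) powr p)"
    have grid: "integrable P ?prod \<and> (LINT \<xi>|P. ?prod \<xi>) \<le> (LINT \<xi>|P. f \<xi>) powr (1 + p)"
      unfolding P_def
    proof (rule grid_lines_inequality)
      show "(real (card (Basis :: 'a set)) - 1) * p \<le> 1" using p(2) by (simp add: N_def)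
      show "f \<in> borel_measurable (PiM Basis (\<lambda>_. \<mu>))" using fm by (simp add: P_def)
      show "\<epsilon> \<le> f \<xi> \<and> f \<xi> \<le> L + \<epsilon>" for \<xi> by (rule fb)
      show "0 < measure \<mu> (space \<mu>)" using mu_m R(1) by simp
    qed (use p \<epsilon> \<mu>.finite_measure_axioms in auto)
    have "(LINT x|lborel. \<bar>\<phi> x\<bar> powr q) = (LINT \<xi>|P. \<bar>\<phi> (S \<xi>)\<bar> powr q)"
      by (rule transfer[symmetric, OF \<phi>m]) (simp add: K(3))
    also have "\<dots> \<le> (LINT \<xi>|P. ?prod \<xi>)"
    proof (rule integral_mono)
      show "integrable P (\<lambda>\<xi>. \<bar>\<phi> (S \<xi>)\<bar> powr q)"
        using measurable_compose[OF SmP \<phi>m] L(1) p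
        by (intro P.integrable_const_bound[of _ "L powr q"]) (auto intro!: AE_I2 powr_mono2)
      show "\<bar>\<phi> (S \<xi>)\<bar> powr q \<le> ?prod \<xi>" for \<xi>
      proof -
        have "\<bar>\<phi> (S \<xi>)\<bar> powr q = (\<Prod>b\<in>(Basis :: 'a set). \<bar>\<phi> (S \<xi>)\<bar> powr p)"
        proof (cases "\<phi> (S \<xi>) = 0")
          case False
          then show ?thesis using p(4) by (simp add: powr_power N_def mult.commute)
        qed (use N2 N_def in \<open>simp add: zero_power\<close>)
        also have "\<dots> \<le> (\<Prod>b\<in>Basis. (LINT t|\<mu>. f (\<xi>(b := t))) powr p)"
          using line p by (intro prod_mono conjI powr_mono2) auto
        \<comment> \<open>A power with exponent 0 equals 1 only for a nonzero base; positivity of f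
          comes from \<epsilon>.\<close>
        also have "f \<xi> powr (1 - (real (card (Basis :: 'a set)) - 1) * p) = 1"
          using fb[of \<xi>] \<epsilon> p(2) by (simp add: N_def)
        then have "(\<Prod>b\<in>Basis. (LINT t|\<mu>. f (\<xi>(b := t))) powr p) = ?prod \<xi>" by simp
        finally show ?thesis .
      qed
    qed (use grid in blast)
    also note conjunct2[OF grid]
    also have "(LINT \<xi>|P. f \<xi>) powr (1 + p) = (G + \<epsilon> * measure P (space P)) powr q" by (simp add: fi p(3))
    finally show ?thesis .
  qed
  have G0: "0 \<le> G" by (simp add: G_def)
  have q0: "0 < q" using p(1,3) by linarith
  have "(\<lambda>n. (G + 1 / real (Suc n) * measure P (space P)) powr q) \<longlonglongrightarrow> (G + 0 * measure P (space P)) powr q"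
    using G0 q0 by (intro tendsto_powr2 tendsto_intros LIMSEQ_Suc[OF lim_1_over_n]) (auto intro!: always_eventually add_nonneg_nonneg)
  then have "(LINT x|lborel. \<bar>\<phi> x\<bar> powr q) \<le> (G + 0 * measure P (space P)) powr q"
    by (rule LIMSEQ_le_const) (intro exI allI impI main; simp)
  then show ?thesis by (simp add: G_def)
qed

subsection \<open>The weighted energy space\<close>

lemma powr_norm_add_le:
  fixes a b :: "'b::real_normed_vector"
  assumes "1 \<le> p"
  shows "norm (a + b) powr p \<le> 2 powr p * (norm a powr p + norm b powr p)"
proof -
  have "norm (a + b) powr p \<le> (2 * max (norm a) (norm b)) powr p"
    using norm_triangle_ineq[of a b] assms by (intro powr_mono2) auto
  also have "\<dots> = 2 powr p * max (norm a) (norm b) powr p" by (simp add: powr_mult)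
  also have "\<dots> \<le> 2 powr p * (norm a powr p + norm b powr p)"
    by (intro mult_left_mono) (auto simp: max_def)
  finally show ?thesis .
qed

text \<open>The power -1/(p - 1) of the weight is the Hoelder partner of w: its integrability embeds
  the weighted L^p space into L^1, so that limits of test functions are integrable and keep weak
  gradients.\<close>

locale weighted_domain =
  fixes \<Omega> :: "'a::euclidean_space set" and p :: real and w :: "'a \<Rightarrow> real"
  assumes open_domain: "open \<Omega>" and bounded_domain: "bounded \<Omega>" and p_gt_1: "1 < p"
    and weight_integrable: "integrable (lebesgue_on \<Omega>) w"
    and weight_pos: "AE x in lebesgue_on \<Omega>. 0 < w x"
    and dual_weight_integrable: "integrable (lebesgue_on \<Omega>) (\<lambda>x. w x powr (- 1 / (p - 1)))"
begin

abbreviation "M \<equiv> lebesgue_on \<Omega>"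

lemma domain_sets: "\<Omega> \<in> sets lebesgue"
  using open_domain by simp

lemma finite_measure_M: "finite_measure M"
proof (rule finite_measureI)
  have "\<Omega> \<in> lmeasurable" using open_domain bounded_domain by (simp add: lmeasurable_open)
  then show "emeasure M (space M) \<noteq> \<infinity>"
    using fmeasurableD2[of \<Omega> lebesgue] domain_sets
    by (simp add: emeasure_restrict_space del: emeasure_completion)
qed

sublocale finite_measure M by (rule finite_measure_M)

lemma weight_measurable [measurable]: "w \<in> borel_measurable M"
  using weight_integrable by simp

lemma continuous_measurable:
  fixes f :: "'a \<Rightarrow> 'b::topological_space"
  assumes "continuous_on UNIV f"
  shows "f \<in> borel_measurable M"
proof -
  have "f \<in> borel_measurable lborel"
    using borel_measurable_continuous_onI[OF assms] by simp
  then show ?thesis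
    by (intro measurable_restrict_space1 measurable_completion)
qed

section \<open>The weighted Lebesgue space\<close>

definition Lpw :: "('a \<Rightarrow> 'b::euclidean_space) set" where
  "Lpw = {V \<in> borel_measurable M. integrable M (\<lambda>x. norm (V x) powr p * w x)}"

text \<open>The p-th power of the weighted norm. The triangle inequality then costs a factor 2^p,
  harmless wherever energies are sent to 0.\<close>

abbreviation energy :: "('a \<Rightarrow> 'b::euclidean_space) \<Rightarrow> real" where
  "energy V \<equiv> (LINT x|M. norm (V x) powr p * w x)"

lemma LpwD: "V \<in> Lpw \<Longrightarrow> V \<in> borel_measurable M" "V \<in> Lpw \<Longrightarrow> integrable M (\<lambda>x. norm (V x) powr p * w x)"
  by (auto simp: Lpw_def)

lemma energy_nonneg: "0 \<le> energy V"
  using weight_pos by (intro integral_nonneg_AE) (auto elim: eventually_mono)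

lemma Lpw_dominated:
  assumes V: "V \<in> borel_measurable M" and g: "integrable M g"
    and le: "AE x in M. norm (V x) powr p * w x \<le> g x"
  shows "V \<in> Lpw" "energy V \<le> (LINT x|M. g x)"
proof -
  show *: "V \<in> Lpw"
    unfolding Lpw_def mem_Collect_eq
  proof (intro conjI Bochner_Integration.integrable_bound[OF g])
    show "(\<lambda>x. norm (V x) powr p * w x) \<in> borel_measurable M" using V by measurable
    show "AE x in M. norm (norm (V x) powr p * w x) \<le> norm (g x)"
      using le weight_pos by eventually_elim auto
  qed (rule V)
  show "energy V \<le> (LINT x|M. g x)"
    by (rule integral_mono_AE[OF LpwD(2)[OF *] g le])
qed

lemma Lpw_mono:
  assumes V: "V \<in> borel_measurable M" and U: "U \<in> Lpw" and le: "AE x in M. norm (V x) \<le> norm (U x)"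
  shows "V \<in> Lpw" "energy V \<le> energy U"
proof -
  have "AE x in M. norm (V x) powr p * w x \<le> norm (U x) powr p * w x"
    using le weight_pos by eventually_elim (use p_gt_1 in \<open>auto intro!: mult_right_mono powr_mono2\<close>)
  from Lpw_dominated[OF V LpwD(2)[OF U] this] show "V \<in> Lpw" "energy V \<le> energy U" .
qed

lemma Lpw_const: "(\<lambda>x. c) \<in> Lpw"
  using weight_integrable by (simp add: Lpw_def)

lemma Lpw_bounded:
  fixes V :: "'a \<Rightarrow> 'b::euclidean_space"
  assumes "V \<in> borel_measurable M" "AE x in M. norm (V x) \<le> B"
  shows "V \<in> Lpw"
  using assms(2) by (intro Lpw_mono(1)[OF assms(1) Lpw_const[of B]]) (auto elim: eventually_mono)

lemma Lpw_add:
  assumes U: "U \<in> Lpw" and V: "V \<in> Lpw"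
  shows "(\<lambda>x. U x + V x) \<in> Lpw" "energy (\<lambda>x. U x + V x) \<le> 2 powr p * (energy U + energy V)"
proof -
  have m: "(\<lambda>x. U x + V x) \<in> borel_measurable M" using U V by (auto simp: Lpw_def)
  have i: "integrable M (\<lambda>x. 2 powr p * (norm (U x) powr p * w x + norm (V x) powr p * w x))"
    using U V by (auto simp: Lpw_def)
  have le: "AE x in M. norm (U x + V x) powr p * w x \<le> 2 powr p * (norm (U x) powr p * w x + norm (V x) powr p * w x)"
    using weight_pos
  proof eventually_elim
    fix x assume "0 < w x"
    then have "norm (U x + V x) powr p * w x \<le> (2 powr p * (norm (U x) powr p + norm (V x) powr p)) * w x"
      using p_gt_1 by (intro mult_right_mono powr_norm_add_le) auto
    then show "norm (U x + V x) powr p * w x \<le> 2 powr p * (norm (U x) powr p * w x + norm (V x) powr p * w x)"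
      by (simp add: algebra_simps)
  qed
  show "(\<lambda>x. U x + V x) \<in> Lpw" by (rule Lpw_dominated(1)[OF m i le])
  have "energy (\<lambda>x. U x + V x) \<le> (LINT x|M. 2 powr p * (norm (U x) powr p * w x + norm (V x) powr p * w x))"
    by (rule Lpw_dominated(2)[OF m i le])
  then show "energy (\<lambda>x. U x + V x) \<le> 2 powr p * (energy U + energy V)"
    using LpwD(2)[OF U] LpwD(2)[OF V] by simp
qed

lemma Lpw_uminus: "V \<in> Lpw \<Longrightarrow> (\<lambda>x. - V x) \<in> Lpw"
  by (simp add: Lpw_def)

lemma Lpw_diff:
  assumes "U \<in> Lpw" "V \<in> Lpw"
  shows "(\<lambda>x. U x - V x) \<in> Lpw"
  using Lpw_add(1)[OF assms(1) Lpw_uminus[OF assms(2)]] by simp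

lemma energy_triangle:
  assumes "U \<in> Lpw" "V \<in> Lpw" "W \<in> Lpw"
  shows "energy (\<lambda>x. U x - W x) \<le> 2 powr p * (energy (\<lambda>x. U x - V x) + energy (\<lambda>x. V x - W x))"
  using Lpw_add(2)[OF Lpw_diff[OF assms(1,2)] Lpw_diff[OF assms(2,3)]] by simp

text \<open>L^1 convergence of |V k - U|^p w gives almost everywhere convergence along a
  subsequence; the weight is positive and can be divided out before taking the p-th root.\<close>

lemma energy_tendsto_AE_subseq:
  fixes V :: "nat \<Rightarrow> 'a \<Rightarrow> 'b::euclidean_space"
  assumes V: "\<And>k. V k \<in> Lpw" "U \<in> Lpw" and lim: "(\<lambda>k. energy (\<lambda>x. V k x - U x)) \<longlonglongrightarrow> 0"
  shows "\<exists>r. strict_mono r \<and> (AE x in M. (\<lambda>k. V (r k) x) \<longlonglongrightarrow> U x)"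
proof -
  let ?g = "\<lambda>k x. norm (V k x - U x) powr p * w x"
  have "(LINT x|M. norm (?g k x)) = energy (\<lambda>x. V k x - U x)" for k
    using LpwD(2)[OF Lpw_diff[OF V(1)[of k] V(2)]] weight_pos
    by (intro integral_cong_AE) (auto elim: eventually_mono)
  then have "(\<lambda>k. LINT x|M. norm (?g k x)) \<longlonglongrightarrow> 0" using lim by simp
  then obtain r where r: "strict_mono r" "AE x in M. (\<lambda>k. ?g (r k) x) \<longlonglongrightarrow> 0"
    using tendsto_L1_AE_subseq[of M ?g] LpwD(2)[OF Lpw_diff[OF V(1) V(2)]] by blast
  have "AE x in M. (\<lambda>k. V (r k) x) \<longlonglongrightarrow> U x"
    using r(2) weight_pos
  proof eventually_elim
    fix x assume l: "(\<lambda>k. ?g (r k) x) \<longlonglongrightarrow> 0" and wx: "0 < w x"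
    have "(\<lambda>k. (?g (r k) x / w x) powr (1 / p)) \<longlonglongrightarrow> (0 / w x) powr (1 / p)"
      using wx p_gt_1 by (intro tendsto_powr2 tendsto_intros l) auto
    then have "(\<lambda>k. norm (V (r k) x - U x)) \<longlonglongrightarrow> 0"
      using wx p_gt_1 by (simp add: powr_powr)
    then show "(\<lambda>k. V (r k) x) \<longlonglongrightarrow> U x"
      by (rule LIM_zero_cancel[OF tendsto_norm_zero_cancel])
  qed
  then show ?thesis using r(1) by blast
qed

lemma energy_dominated_convergence:
  fixes V :: "nat \<Rightarrow> 'a \<Rightarrow> 'b::euclidean_space"
  assumes V: "\<And>k. V k \<in> borel_measurable M" "U \<in> borel_measurable M" and H: "H \<in> Lpw"
    and lim: "AE x in M. (\<lambda>k. V k x) \<longlonglongrightarrow> U x" and le: "\<And>k. AE x in M. norm (V k x) \<le> norm (H x)"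
  shows "\<And>k. V k \<in> Lpw" "U \<in> Lpw" "(\<lambda>k. energy (\<lambda>x. V k x - U x)) \<longlonglongrightarrow> 0"
proof -
  show Vk: "V k \<in> Lpw" for k by (rule Lpw_mono(1)[OF V(1) H le])
  have "AE x in M. \<forall>k. norm (V k x) \<le> norm (H x)" using le by (simp add: AE_all_countable)
  with lim have leU: "AE x in M. norm (U x) \<le> norm (H x)"
  proof eventually_elim
    fix x assume "(\<lambda>k. V k x) \<longlonglongrightarrow> U x" "\<forall>k. norm (V k x) \<le> norm (H x)"
    then show "norm (U x) \<le> norm (H x)"
      using LIMSEQ_le_const2[OF tendsto_norm[of "\<lambda>k. V k x" "U x" sequentially], of "norm (H x)"] by blast
  qed
  show U: "U \<in> Lpw" by (rule Lpw_mono(1)[OF V(2) H leU])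
  have "(\<lambda>k. LINT x|M. norm (V k x - U x) powr p * w x) \<longlonglongrightarrow> (LINT x|M. 0)"
  proof (rule integral_dominated_convergence)
    show "integrable M (\<lambda>x. 2 powr p * (norm (H x) powr p * w x + norm (H x) powr p * w x))"
      using LpwD(2)[OF H] by (intro integrable_mult_right Bochner_Integration.integrable_add)
    show "(\<lambda>x. norm (V k x - U x) powr p * w x) \<in> borel_measurable M" for k
      using V by measurable
    show "AE x in M. (\<lambda>k. norm (V k x - U x) powr p * w x) \<longlonglongrightarrow> 0"
      using lim
    proof eventually_elim
      fix x assume "(\<lambda>k. V k x) \<longlonglongrightarrow> U x"
      then have "(\<lambda>k. norm (V k x - U x)) \<longlonglongrightarrow> 0" by (simp add: LIM_zero tendsto_norm_zero)
      then have "(\<lambda>k. norm (V k x - U x) powr p * w x) \<longlonglongrightarrow> 0 powr p * w x"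
        using p_gt_1 by (intro tendsto_powr2 tendsto_intros) auto
      then show "(\<lambda>k. norm (V k x - U x) powr p * w x) \<longlonglongrightarrow> 0" by simp
    qed
    show "AE x in M. norm (norm (V k x - U x) powr p * w x) \<le>
        2 powr p * (norm (H x) powr p * w x + norm (H x) powr p * w x)" for k
      using le[of k] leU weight_pos
    proof eventually_elim
      fix x assume *: "norm (V k x) \<le> norm (H x)" "norm (U x) \<le> norm (H x)" "0 < w x"
      have "norm (V k x - U x) powr p * w x \<le> (2 powr p * (norm (V k x) powr p + norm (U x) powr p)) * w x"
        using powr_norm_add_le[of p "V k x" "- U x"] p_gt_1 *(3) by (intro mult_right_mono) auto
      also have "\<dots> \<le> (2 powr p * (norm (H x) powr p + norm (H x) powr p)) * w x"
        using * p_gt_1 by (intro mult_right_mono mult_left_mono add_mono powr_mono2) auto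
      finally show "norm (norm (V k x - U x) powr p * w x) \<le>
        2 powr p * (norm (H x) powr p * w x + norm (H x) powr p * w x)"
        using *(3) by (simp add: algebra_simps)
    qed
  qed simp
  then show "(\<lambda>k. energy (\<lambda>x. V k x - U x)) \<longlonglongrightarrow> 0" by simp
qed

definition dual_const :: real where
  "dual_const = (LINT x|M. w x powr (- 1 / (p - 1))) powr (1 - 1 / p)"

text \<open>Hoelder's inequality for |V| = (|V|^p w)^(1/p) (w^(-1/(p - 1)))^(1 - 1/p).\<close>

lemma Lpw_integrable:
  assumes V: "V \<in> Lpw"
  shows "integrable M V" "(LINT x|M. norm (V x)) \<le> energy V powr (1 / p) * dual_const"
proof -
  have a: "0 \<le> 1 / p" "0 \<le> 1 - 1 / p" "1 / p + (1 - 1 / p) = 1" using p_gt_1 by auto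
  have nn: "AE x in M. 0 \<le> norm (V x) powr p * w x" using weight_pos by (auto elim: eventually_mono)
  have nn': "AE x in M. 0 \<le> w x powr (- 1 / (p - 1))" by simp
  note H = Hoelder_2[OF a LpwD(2)[OF V] dual_weight_integrable nn nn']
  have eq: "AE x in M. (norm (V x) powr p * w x) powr (1 / p) * (w x powr (- 1 / (p - 1))) powr (1 - 1 / p) = norm (V x)"
    using weight_pos
  proof eventually_elim
    fix x assume wx: "0 < w x"
    have e: "- 1 / (p - 1) * (1 - 1 / p) = - (1 / p)" using p_gt_1 by (simp add: field_simps)
    have "(norm (V x) powr p * w x) powr (1 / p) = norm (V x) * w x powr (1 / p)"
      using wx p_gt_1 by (simp add: powr_mult powr_powr)
    then show "(norm (V x) powr p * w x) powr (1 / p) * (w x powr (- 1 / (p - 1))) powr (1 - 1 / p) = norm (V x)"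
      unfolding powr_powr e using wx by (simp add: powr_minus)
  qed
  have Vm: "V \<in> borel_measurable M" using V by (rule LpwD)
  have m: "(\<lambda>x. (norm (V x) powr p * w x) powr (1 / p) * (w x powr (- 1 / (p - 1))) powr (1 - 1 / p)) \<in> borel_measurable M"
    using H(1) by simp
  have "integrable M (\<lambda>x. norm (V x))"
    using H(1) Vm by (subst integrable_cong_AE[OF _ m]) (use eq in \<open>auto elim: eventually_mono\<close>)
  then show "integrable M V" using Vm by (simp add: integrable_norm_iff)
  have "(LINT x|M. norm (V x)) = (LINT x|M. (norm (V x) powr p * w x) powr (1 / p) * (w x powr (- 1 / (p - 1))) powr (1 - 1 / p))"
    using Vm eq by (intro integral_cong_AE m) (auto elim: eventually_mono)
  then show "(LINT x|M. norm (V x)) \<le> energy V powr (1 / p) * dual_const"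
    using H(2) by (simp add: dual_const_def)
qed

text \<open>\<open>X\<close> consists of the pairs of a function of \<open>W1p_0\<close> and its weak gradient.\<close>

definition test :: "('a \<Rightarrow> real) \<Rightarrow> 'a \<Rightarrow> real \<times> 'a" where
  "test \<phi> x = (\<phi> x, gradient \<phi> x)"

definition X :: "('a \<Rightarrow> real \<times> 'a) set" where
  "X = {V \<in> Lpw. \<forall>\<epsilon>>0. \<exists>\<phi>\<in>Cc_infinity \<Omega>. energy (\<lambda>x. V x - test \<phi> x) < \<epsilon>}"

lemma test_Lpw:
  assumes "\<phi> \<in> Cc_infinity \<Omega>"
  shows "test \<phi> \<in> Lpw"
proof -
  obtain B where B: "\<And>x. \<bar>\<phi> x\<bar> \<le> B" "\<And>x. norm (gradient \<phi> x) \<le> B"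
    using Cc_infinity_bounded[OF assms] by blast
  have "continuous_on UNIV (test \<phi>)"
    unfolding test_def[abs_def]
    by (intro continuous_intros smooth_on_continuous smooth_on_continuous_gradient Cc_infinity_smooth[OF assms])
  moreover have "norm (test \<phi> x) \<le> B + B" for x
    using norm_Pair_le[of "\<phi> x" "gradient \<phi> x"] B[of x] by (simp add: test_def)
  ultimately show ?thesis by (intro Lpw_bounded continuous_measurable AE_I2)
qed

lemma X_LpwD: "V \<in> X \<Longrightarrow> V \<in> Lpw"
  by (simp add: X_def)

lemma X_seq:
  assumes "V \<in> X"
  shows "\<exists>\<phi>. (\<forall>k. \<phi> k \<in> Cc_infinity \<Omega>) \<and> (\<lambda>k. energy (\<lambda>x. test (\<phi> k) x - V x)) \<longlonglongrightarrow> 0 \<and>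
    (AE x in M. (\<lambda>k. test (\<phi> k) x) \<longlonglongrightarrow> V x)"
proof -
  have "\<forall>k. \<exists>\<phi>\<in>Cc_infinity \<Omega>. energy (\<lambda>x. V x - test \<phi> x) < inverse (real (Suc k))"
    using assms by (simp add: X_def)
  then obtain \<phi> where \<phi>: "\<And>k. \<phi> k \<in> Cc_infinity \<Omega>" "\<And>k. energy (\<lambda>x. V x - test (\<phi> k) x) < inverse (real (Suc k))"
    by metis
  have lim: "(\<lambda>k. energy (\<lambda>x. test (\<phi> k) x - V x)) \<longlonglongrightarrow> 0"
  proof (rule tendsto_sandwich[OF _ _ tendsto_const LIMSEQ_inverse_real_of_nat])
    show "\<forall>\<^sub>F k in sequentially. energy (\<lambda>x. test (\<phi> k) x - V x) \<le> inverse (real (Suc k))"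
      using \<phi>(2) by (intro always_eventually allI) (simp add: norm_minus_commute less_imp_le)
  qed (simp add: energy_nonneg)
  obtain r where r: "strict_mono r" "AE x in M. (\<lambda>k. test (\<phi> (r k)) x) \<longlonglongrightarrow> V x"
    using energy_tendsto_AE_subseq[OF test_Lpw[OF \<phi>(1)] X_LpwD[OF assms] lim] by blast
  then show ?thesis
    using \<phi>(1) LIMSEQ_subseq_LIMSEQ[OF lim r(1)] by (intro exI[of _ "\<phi> \<circ> r"]) (auto simp: o_def)
qed

lemma X_closed:
  assumes V: "\<And>k. V k \<in> X" and U: "U \<in> Lpw" and lim: "(\<lambda>k. energy (\<lambda>x. V k x - U x)) \<longlonglongrightarrow> 0"
  shows "U \<in> X"
  unfolding X_def
proof (intro CollectI conjI U allI impI)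
  fix \<epsilon> :: real assume \<epsilon>: "0 < \<epsilon>"
  define \<eta> where "\<eta> = \<epsilon> / (2 * 2 powr p)"
  have \<eta>: "0 < \<eta>" using \<epsilon> by (simp add: \<eta>_def)
  obtain k where k: "energy (\<lambda>x. V k x - U x) < \<eta>"
    using order_tendstoD(2)[OF lim \<eta>] by (auto simp: eventually_sequentially)
  obtain \<phi> where \<phi>: "\<phi> \<in> Cc_infinity \<Omega>" "energy (\<lambda>x. V k x - test \<phi> x) < \<eta>"
    using V[of k] \<eta> by (auto simp: X_def)
  have "energy (\<lambda>x. U x - test \<phi> x) \<le> 2 powr p * (energy (\<lambda>x. U x - V k x) + energy (\<lambda>x. V k x - test \<phi> x))"
    by (rule energy_triangle[OF U X_LpwD[OF V] test_Lpw[OF \<phi>(1)]])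
  also have "\<dots> < 2 powr p * (\<eta> + \<eta>)"
    using k \<phi>(2) by (intro mult_strict_left_mono add_strict_mono) (auto simp: norm_minus_commute)
  also have "\<dots> = \<epsilon>" by (simp add: \<eta>_def)
  finally show "\<exists>\<phi>\<in>Cc_infinity \<Omega>. energy (\<lambda>x. U x - test \<phi> x) < \<epsilon>" using \<phi>(1) by blast
qed

text \<open>The way in which nonlinear operations enter \<open>X\<close>: pointwise limits under a
  majorant suffice, and energies need not be computed.\<close>

lemma X_dominated_closed:
  fixes V :: "nat \<Rightarrow> 'a \<Rightarrow> real \<times> 'a"
  assumes "\<And>k. V k \<in> X" "U \<in> borel_measurable M" "H \<in> Lpw"
    "AE x in M. (\<lambda>k. V k x) \<longlonglongrightarrow> U x" "\<And>k. AE x in M. norm (V k x) \<le> norm (H x)"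
  shows "U \<in> X"
proof -
  note * = energy_dominated_convergence[OF LpwD(1)[OF X_LpwD[OF assms(1)]] assms(2-5)]
  show ?thesis by (rule X_closed[OF assms(1) *(2,3)])
qed

lemma X_cong_AE:
  assumes "V \<in> X" "U \<in> borel_measurable M" "AE x in M. U x = V x"
  shows "U \<in> X"
  by (rule X_dominated_closed[of "\<lambda>k. V", OF assms(1,2) X_LpwD[OF assms(1)]])
     (use assms(3) in \<open>auto elim: eventually_mono\<close>)

text \<open>For a fixed test function, integration by parts says that a functional vanishes at V.
  The functional is continuous for the L^1 norm and vanishes at every pair
  \<open>test \<phi>\<close>; these pairs approximate V in energy and therefore in L^1.\<close>

lemma has_weak_gradient_X:
  assumes V: "V \<in> X"
  shows "has_weak_gradient \<Omega> (\<lambda>x. fst (V x)) (\<lambda>x. snd (V x))"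
proof -
  have Vi: "integrable M V" by (rule Lpw_integrable(1)[OF X_LpwD[OF V]])
  then have i: "integrable M (\<lambda>x. fst (V x))" "integrable M (\<lambda>x. snd (V x))"
    using integrable_bounded_linear[OF bounded_linear_fst Vi] integrable_bounded_linear[OF bounded_linear_snd Vi]
    by simp_all
  have loc: "locally_integrable_on (\<lambda>x. fst (V x)) \<Omega>" "locally_integrable_on (\<lambda>x. snd (V x)) \<Omega>"
    unfolding locally_integrable_on_def
    using integrable_lebesgue_on_subset[OF i(1) _ domain_sets] integrable_lebesgue_on_subset[OF i(2) _ domain_sets]
    by (auto simp: compact_imp_closed)
  have "(LINT x|M. fst (V x) * (gradient \<eta> x \<bullet> b)) = - (LINT x|M. (snd (V x) \<bullet> b) * \<eta> x)"
    if \<eta>: "\<eta> \<in> Cc_infinity \<Omega>" and b: "b \<in> Basis" for \<eta> b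
  proof -
    obtain B where B: "\<And>x. \<bar>\<eta> x\<bar> \<le> B" "\<And>x. norm (gradient \<eta> x) \<le> B"
      using Cc_infinity_bounded[OF \<eta>] by blast
    \<comment> \<open>The pairing V x \<bullet> \<psi> x in the product space collects both sides of
      the integration by parts formula in one integrand.\<close>
    define \<psi> where "\<psi> x = (gradient \<eta> x \<bullet> b, \<eta> x *\<^sub>R b)" for x
    have \<psi>m: "\<psi> \<in> borel_measurable M"
      unfolding \<psi>_def[abs_def]
      by (intro continuous_measurable continuous_intros smooth_on_continuous
          smooth_on_continuous_gradient Cc_infinity_smooth[OF \<eta>])
    have \<psi>B: "norm (\<psi> x) \<le> B + B" for x
      using norm_Pair_le[of "gradient \<eta> x \<bullet> b" "\<eta> x *\<^sub>R b"] Basis_le_norm[OF b, of "gradient \<eta> x"] B[of x] b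
      by (simp add: \<psi>_def)
    have bd: "\<bar>U x \<bullet> \<psi> x\<bar> \<le> norm (U x) * (B + B)" for U :: "'a \<Rightarrow> real \<times> 'a" and x
      using Cauchy_Schwarz_ineq2[of "U x" "\<psi> x"] mult_left_mono[OF \<psi>B, of "norm (U x)" x] by simp
    have int: "integrable M (\<lambda>x. U x \<bullet> \<psi> x)" if "integrable M U" for U :: "'a \<Rightarrow> real \<times> 'a"
    proof (rule Bochner_Integration.integrable_bound)
      show "integrable M (\<lambda>x. norm (U x) * (B + B))" using that by simp
      show "(\<lambda>x. U x \<bullet> \<psi> x) \<in> borel_measurable M" using that \<psi>m by (intro borel_measurable_inner) auto
    qed (use bd in \<open>auto simp: abs_le_iff intro!: AE_I2 order_trans[OF _ abs_ge_self]\<close>)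
    have split: "(LINT x|M. U x \<bullet> \<psi> x) =
        (LINT x|M. fst (U x) * (gradient \<eta> x \<bullet> b)) + (LINT x|M. (snd (U x) \<bullet> b) * \<eta> x)"
      if "locally_integrable_on (\<lambda>x. fst (U x)) \<Omega>" "locally_integrable_on (\<lambda>x. snd (U x)) \<Omega>" for U
    proof -
      have "U x \<bullet> \<psi> x = fst (U x) * (gradient \<eta> x \<bullet> b) + (snd (U x) \<bullet> b) * \<eta> x" for x
        by (simp add: \<psi>_def inner_prod_def mult.commute)
      then show ?thesis
        using locally_integrable_mult_test[OF that(1) domain_sets \<eta>]
          locally_integrable_mult_test[OF locally_integrable_inner[OF that(2)] domain_sets \<eta>]
        by simp
    qed
    obtain \<phi> where \<phi>: "\<And>k. \<phi> k \<in> Cc_infinity \<Omega>" "(\<lambda>k. energy (\<lambda>x. test (\<phi> k) x - V x)) \<longlonglongrightarrow> 0"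
      using X_seq[OF V] by blast
    have "\<bar>LINT x|M. V x \<bullet> \<psi> x\<bar> \<le> energy (\<lambda>x. test (\<phi> k) x - V x) powr (1 / p) * dual_const * (B + B)" for k
    proof -
      let ?D = "\<lambda>x. test (\<phi> k) x - V x"
      note Di = Lpw_integrable[OF Lpw_diff[OF test_Lpw[OF \<phi>(1)] X_LpwD[OF V]]]
      have "(LINT x|M. test (\<phi> k) x \<bullet> \<psi> x) = 0"
        using has_weak_gradient_test[OF domain_sets \<phi>(1)[of k]] Cc_infinity_integration_by_parts[OF domain_sets \<phi>(1) \<eta>]
        by (subst split) (auto simp: test_def has_weak_gradient_def)
      then have "\<bar>LINT x|M. V x \<bullet> \<psi> x\<bar> = \<bar>LINT x|M. ?D x \<bullet> \<psi> x\<bar>"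
        using int[OF Vi] int[OF Lpw_integrable(1)[OF test_Lpw[OF \<phi>(1)]]] by (simp add: inner_diff_left)
      also have "\<dots> \<le> (LINT x|M. norm (?D x) * (B + B))"
        using int[OF Di(1)] Di(1) bd
        by (intro order_trans[OF integral_abs_bound] integral_mono) auto
      also have "\<dots> \<le> energy ?D powr (1 / p) * dual_const * (B + B)"
        using Di(2) B(1)[of 0] by (simp only: Bochner_Integration.integral_mult_left_zero) (intro mult_right_mono, auto)
      finally show ?thesis .
    qed
    moreover have "(\<lambda>k. energy (\<lambda>x. test (\<phi> k) x - V x) powr (1 / p) * dual_const * (B + B)) \<longlonglongrightarrow> 0 powr (1 / p) * dual_const * (B + B)"
      using p_gt_1 by (intro tendsto_intros tendsto_powr2 \<phi>(2)) (auto simp: energy_nonneg)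
    ultimately have "\<bar>LINT x|M. V x \<bullet> \<psi> x\<bar> \<le> 0" using LIMSEQ_le_const by fastforce
    then show ?thesis using split[OF loc] by simp
  qed
  then show ?thesis using loc by (simp add: has_weak_gradient_def)
qed

section \<open>Translation between \<open>X\<close> and \<open>W1p_0\<close>\<close>

lemma weak_gradient_measurable:
  "has_weak_gradient \<Omega> u g \<Longrightarrow> weak_gradient \<Omega> u \<in> borel_measurable M"
  using locally_integrable_measurable[OF open_domain] has_weak_gradient_weak_gradient
  unfolding has_weak_gradient_def by blast

text \<open>The norm of \<open>W1p_0\<close> measures the chosen weak gradient of u - \<phi>; by
  uniqueness it is almost everywhere the difference of the gradients, which is what \<open>X\<close>
  measures. Both components are estimated separately and then added.\<close>

lemma W1p_0_imp_X:
  assumes u: "u \<in> W1p_0 \<Omega> p w"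
  shows "(\<lambda>x. (u x, weak_gradient \<Omega> u x)) \<in> X"
proof -
  have uW: "u \<in> borel_measurable M" "\<exists>g. has_weak_gradient \<Omega> u g"
    "integrable M (\<lambda>x. \<bar>u x\<bar> powr p * w x)" "integrable M (\<lambda>x. norm (weak_gradient \<Omega> u x) powr p * w x)"
    using u by (auto simp: W1p_0_def W1p_def)
  have wg: "has_weak_gradient \<Omega> u (weak_gradient \<Omega> u)"
    using uW(2) has_weak_gradient_weak_gradient by blast
  note gm = weak_gradient_measurable[OF wg]
  have uL: "(\<lambda>x. (u x, weak_gradient \<Omega> u x)) = (\<lambda>x. (u x, 0) + (0, weak_gradient \<Omega> u x))" by simp
  have pair1: "(\<lambda>x. (v x, 0 :: 'a)) \<in> Lpw" if "v \<in> borel_measurable M" "integrable M (\<lambda>x. \<bar>v x\<bar> powr p * w x)" for v :: "'a \<Rightarrow> real"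
    using that by (simp add: Lpw_def norm_Pair)
  have pair2: "(\<lambda>x. (0 :: real, g x)) \<in> Lpw" if "g \<in> borel_measurable M" "integrable M (\<lambda>x. norm (g x) powr p * w x)" for g :: "'a \<Rightarrow> 'a"
    using that by (simp add: Lpw_def norm_Pair)
  have VL: "(\<lambda>x. (u x, weak_gradient \<Omega> u x)) \<in> Lpw"
    unfolding uL using uW gm by (intro Lpw_add(1) pair1 pair2)
  show ?thesis
    unfolding X_def
  proof (intro CollectI conjI VL allI impI)
    fix \<epsilon> :: real assume \<epsilon>: "0 < \<epsilon>"
    \<comment> \<open>Chosen so that two energies below \<eta>^p, added at the cost of 2^p, stay
      below \<epsilon>.\<close>
    define \<eta> where "\<eta> = (\<epsilon> / (2 * 2 powr p)) powr (1 / p)"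
    have \<eta>: "0 < \<eta>" "\<eta> powr p = \<epsilon> / (2 * 2 powr p)" using \<epsilon> p_gt_1 by (auto simp: \<eta>_def powr_powr)
    obtain \<phi> where \<phi>: "\<phi> \<in> Cc_infinity \<Omega>" "W1p_norm \<Omega> p w (\<lambda>x. u x - \<phi> x) < \<eta>"
      using u \<eta>(1) by (auto simp: W1p_0_def)
    let ?v = "\<lambda>x. u x - \<phi> x" and ?g = "\<lambda>x. weak_gradient \<Omega> u x - gradient \<phi> x"
    have wt: "has_weak_gradient \<Omega> \<phi> (gradient \<phi>)" by (rule has_weak_gradient_test[OF domain_sets \<phi>(1)])
    have hw: "has_weak_gradient \<Omega> ?v ?g" by (rule has_weak_gradient_diff[OF domain_sets wg wt])
    have ae: "AE x in M. weak_gradient \<Omega> ?v x = ?g x" by (rule weak_gradient_eq_AE[OF open_domain hw])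
    note wgm = weak_gradient_measurable[OF hw]
    have DL: "(\<lambda>x. (u x, weak_gradient \<Omega> u x) - test \<phi> x) \<in> Lpw"
      by (rule Lpw_diff[OF VL test_Lpw[OF \<phi>(1)]])
    have vm: "?v \<in> borel_measurable M" "?g \<in> borel_measurable M"
      using uW(1) gm continuous_measurable[OF smooth_on_continuous[OF Cc_infinity_smooth[OF \<phi>(1)]]]
        continuous_measurable[OF smooth_on_continuous_gradient[OF Cc_infinity_smooth[OF \<phi>(1)]]] by auto
    have vL: "(\<lambda>x. (?v x, 0 :: 'a)) \<in> Lpw" "(\<lambda>x. (0 :: real, ?g x)) \<in> Lpw"
      by (rule Lpw_mono(1)[OF _ DL]; use vm in \<open>auto simp: test_def norm_Pair\<close>)+
    have e1: "energy (\<lambda>x. (?v x, 0 :: 'a)) = (LINT x|M. \<bar>?v x\<bar> powr p * w x)" by (simp add: norm_Pair)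
    have e2: "energy (\<lambda>x. (0 :: real, ?g x)) = (LINT x|M. norm (weak_gradient \<Omega> ?v x) powr p * w x)"
      using ae vm wgm by (intro integral_cong_AE) (auto simp: norm_Pair elim: eventually_mono)
    have "energy (\<lambda>x. (?v x, 0 :: 'a)) powr (1 / p) + energy (\<lambda>x. (0 :: real, ?g x)) powr (1 / p) < \<eta>"
      using \<phi>(2) unfolding e1 e2 by (simp add: W1p_norm_def)
    moreover have lt: "e < \<eta> powr p" if "e powr (1 / p) < \<eta>" "0 \<le> e" for e
    proof -
      have "(e powr (1 / p)) powr p < \<eta> powr p" using that p_gt_1 by (intro powr_less_mono2) auto
      then show ?thesis using that p_gt_1 by (simp add: powr_powr)
    qed
    ultimately have small: "energy (\<lambda>x. (?v x, 0 :: 'a)) < \<eta> powr p" "energy (\<lambda>x. (0 :: real, ?g x)) < \<eta> powr p"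
      using energy_nonneg by (smt (verit) powr_ge_zero)+
    have "energy (\<lambda>x. (u x, weak_gradient \<Omega> u x) - test \<phi> x) = energy (\<lambda>x. (?v x, 0) + (0, ?g x))"
      by (simp add: test_def)
    also have "\<dots> \<le> 2 powr p * (energy (\<lambda>x. (?v x, 0 :: 'a)) + energy (\<lambda>x. (0 :: real, ?g x)))"
      by (rule Lpw_add(2)[OF vL])
    also have "\<dots> < 2 powr p * (\<eta> powr p + \<eta> powr p)"
      using small by (intro mult_strict_left_mono add_strict_mono) auto
    also have "\<dots> = \<epsilon>" by (simp add: \<eta>(2))
    finally show "\<exists>\<phi>\<in>Cc_infinity \<Omega>. energy (\<lambda>x. (u x, weak_gradient \<Omega> u x) - test \<phi> x) < \<epsilon>" using \<phi>(1) by blast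
  qed
qed

text \<open>By uniqueness the second component is the chosen weak gradient almost everywhere.
  Through this lemma functions built in \<open>X\<close> become test functions of the approximating
  problems, with an explicitly known gradient.\<close>

lemma X_imp_W1p_0:
  assumes V: "(\<lambda>x. (u x, g x)) \<in> X"
  shows "u \<in> W1p_0 \<Omega> p w" "AE x in M. weak_gradient \<Omega> u x = g x"
proof -
  have hw: "has_weak_gradient \<Omega> u g" using has_weak_gradient_X[OF V] by simp
  show ae: "AE x in M. weak_gradient \<Omega> u x = g x" by (rule weak_gradient_eq_AE[OF open_domain hw])
  have m: "f \<in> borel_measurable M" "h \<in> borel_measurable M" if "(\<lambda>x. (f x, h x)) \<in> borel_measurable M" for f :: "'a \<Rightarrow> real" and h :: "'a \<Rightarrow> 'a"
    using measurable_compose[OF that, of fst borel] measurable_compose[OF that, of snd borel]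
    by (simp_all add: borel_measurable_continuous_onI continuous_on_fst continuous_on_snd)
  have comp: "f \<in> Lpw" "h \<in> Lpw" "energy f \<le> energy (\<lambda>x. (f x, h x))" "energy h \<le> energy (\<lambda>x. (f x, h x))"
    if L: "(\<lambda>x. (f x, h x)) \<in> Lpw" for f :: "'a \<Rightarrow> real" and h :: "'a \<Rightarrow> 'a"
    using Lpw_mono[OF m(1)[OF LpwD(1)[OF L]] L AE_I2] Lpw_mono[OF m(2)[OF LpwD(1)[OF L]] L AE_I2] norm_fst_le norm_snd_le
    by blast+
  note uL = comp[OF X_LpwD[OF V]]
  have "u \<in> W1p \<Omega> p w"
    unfolding W1p_def
  proof (intro CollectI conjI)
    show "u \<in> borel_measurable M" by (rule LpwD(1)[OF uL(1)])
    show "integrable M (\<lambda>x. \<bar>u x\<bar> powr p * w x)" using LpwD(2)[OF uL(1)] by simp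
    have "weak_gradient \<Omega> u \<in> Lpw"
      using ae by (intro Lpw_mono(1)[OF weak_gradient_measurable[OF hw] uL(2)]) (auto elim: eventually_mono)
    then show "integrable M (\<lambda>x. norm (weak_gradient \<Omega> u x) powr p * w x)" by (rule LpwD)
  qed (use hw in blast)
  moreover have "\<exists>\<phi>\<in>Cc_infinity \<Omega>. W1p_norm \<Omega> p w (\<lambda>x. u x - \<phi> x) < \<epsilon>" if \<epsilon>: "0 < \<epsilon>" for \<epsilon>
  proof -
    have \<epsilon>p: "0 < (\<epsilon> / 2) powr p" using \<epsilon> by simp
    have "\<forall>\<epsilon>>0. \<exists>\<phi>\<in>Cc_infinity \<Omega>. energy (\<lambda>x. (u x, g x) - test \<phi> x) < \<epsilon>"
      using V by (simp add: X_def)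
    from this[rule_format, OF \<epsilon>p] obtain \<phi> where \<phi>: "\<phi> \<in> Cc_infinity \<Omega>" "energy (\<lambda>x. (u x, g x) - test \<phi> x) < (\<epsilon> / 2) powr p"
      by blast
    let ?v = "\<lambda>x. u x - \<phi> x" and ?g = "\<lambda>x. g x - gradient \<phi> x"
    have eq: "(u x, g x) - test \<phi> x = (?v x, ?g x)" for x by (simp add: test_def)
    have DL: "(\<lambda>x. (?v x, ?g x)) \<in> Lpw"
      using Lpw_diff[OF X_LpwD[OF V] test_Lpw[OF \<phi>(1)]] unfolding eq .
    have hw': "has_weak_gradient \<Omega> ?v ?g"
      by (rule has_weak_gradient_diff[OF domain_sets hw has_weak_gradient_test[OF domain_sets \<phi>(1)]])
    have "(LINT x|M. norm (weak_gradient \<Omega> ?v x) powr p * w x) = energy ?g"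
      using weak_gradient_eq_AE[OF open_domain hw'] weak_gradient_measurable[OF hw'] LpwD(1)[OF comp(2)[OF DL]]
      by (intro integral_cong_AE) (auto elim: eventually_mono)
    moreover have "(LINT x|M. \<bar>?v x\<bar> powr p * w x) = energy ?v" by simp
    ultimately have "W1p_norm \<Omega> p w ?v = energy ?v powr (1 / p) + energy ?g powr (1 / p)"
      by (simp add: W1p_norm_def)
    moreover have "e powr (1 / p) < \<epsilon> / 2" if "e < (\<epsilon> / 2) powr p" "0 \<le> e" for e
    proof -
      have "e powr (1 / p) < ((\<epsilon> / 2) powr p) powr (1 / p)" using that p_gt_1 by (intro powr_less_mono2) auto
      then show ?thesis using \<epsilon> p_gt_1 by (simp add: powr_powr)
    qed
    from this[OF le_less_trans[OF comp(3)[OF DL] \<phi>(2)[unfolded eq]] energy_nonneg]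
      this[OF le_less_trans[OF comp(4)[OF DL] \<phi>(2)[unfolded eq]] energy_nonneg]
    have "energy ?v powr (1 / p) < \<epsilon> / 2" "energy ?g powr (1 / p) < \<epsilon> / 2" .
    ultimately show ?thesis using \<phi>(1) by (intro bexI[of _ \<phi>]) auto
  qed
  ultimately show "u \<in> W1p_0 \<Omega> p w" by (simp add: W1p_0_def)
qed

end

subsection \<open>The chain rule\<close>

lemma norm_Pair_mono:
  "norm a \<le> norm c \<Longrightarrow> norm b \<le> norm d \<Longrightarrow> norm (a, b) \<le> norm (c, d)"
  unfolding norm_Pair by (intro real_sqrt_le_mono add_mono power_mono) auto

text \<open>Only t = 0 is delicate: the difference quotient is at most |t|^(\<beta> - 1), which
  tends to 0 because \<beta> > 1.\<close>

lemma max_powr_has_real_derivative: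
  fixes \<beta> :: real
  assumes \<beta>: "1 < \<beta>"
  shows "((\<lambda>t. max 0 t powr \<beta>) has_real_derivative \<beta> * max 0 t powr (\<beta> - 1)) (at t)"
proof -
  consider "t > 0" | "t < 0" | "t = 0" by linarith
  then show ?thesis
  proof cases
    case 1
    have "((\<lambda>t. t powr \<beta>) has_real_derivative \<beta> * t powr (\<beta> - 1)) (at t)"
      using 1 by (rule has_real_derivative_powr)
    then have "((\<lambda>t. max 0 t powr \<beta>) has_real_derivative \<beta> * t powr (\<beta> - 1)) (at t)"
      by (rule has_field_derivative_transform_within_open[OF _ open_greaterThan[of 0]]) (use 1 in auto)
    then show ?thesis using 1 by simp
  next
    case 2
    have "((\<lambda>t. 0) has_real_derivative 0) (at t)" by simp
    then have "((\<lambda>t. max 0 t powr \<beta>) has_real_derivative 0) (at t)"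
      by (rule has_field_derivative_transform_within_open[OF _ open_lessThan[of 0]]) (use 2 in auto)
    then show ?thesis using 2 by simp
  next
    case 3
    have "((\<lambda>t::real. \<bar>t\<bar> powr (\<beta> - 1)) \<longlongrightarrow> \<bar>0\<bar> powr (\<beta> - 1)) (at 0)"
      using \<beta> by (intro tendsto_powr2 tendsto_intros) auto
    then have "((\<lambda>t. max 0 t powr \<beta> / t) \<longlongrightarrow> 0) (at 0)"
    proof (rule Lim_null_comparison[rotated, OF tendsto_eq_rhs])
      show "\<forall>\<^sub>F t::real in at 0. norm (max 0 t powr \<beta> / t) \<le> \<bar>t\<bar> powr (\<beta> - 1)"
      proof (intro always_eventually allI)
        fix t :: real
        show "norm (max 0 t powr \<beta> / t) \<le> \<bar>t\<bar> powr (\<beta> - 1)"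
        proof (cases "0 < t")
          case False
          then have "max 0 t = 0" by simp
          then show ?thesis by simp
        qed (simp add: powr_diff)
      qed
    qed simp
    then show ?thesis using 3 by (simp add: has_field_derivative_iff)
  qed
qed

text \<open>The approximants will be derivatives of functions composed with test functions, whose
  values need not stay in [0, B]; they must be bounded on the whole line, which rules out
  polynomials. Smooth bounded functions still form an algebra that separates points.\<close>

lemma smooth_bounded_dense:
  fixes h :: "real \<Rightarrow> real"
  assumes "continuous_on {0..B} h" "0 < e"
  shows "\<exists>g. smooth_on UNIV g \<and> bounded (range g) \<and> (\<forall>t\<in>{0..B}. \<bar>h t - g t\<bar> < e)"
proof -
  interpret function_ring_on "{g. smooth_on UNIV g \<and> bounded (range g)}" "{0..B}"
  proof
    show "(\<lambda>x. f x * g x) \<in> {g. smooth_on UNIV g \<and> bounded (range g)}"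
      if fg: "f \<in> {g. smooth_on UNIV g \<and> bounded (range g)}" "g \<in> {g. smooth_on UNIV g \<and> bounded (range g)}"
      for f g :: "real \<Rightarrow> real"
    proof -
      obtain a where "\<And>x. \<bar>f x\<bar> \<le> a" using fg(1) by (auto simp: bounded_iff)
      moreover obtain b where "\<And>x. \<bar>g x\<bar> \<le> b" using fg(2) by (auto simp: bounded_iff)
      ultimately have "\<bar>f x * g x\<bar> \<le> a * b" for x
        unfolding abs_mult by (intro mult_mono') auto
      then have "bounded (range (\<lambda>x. f x * g x))" by (auto simp: bounded_iff)
      then show ?thesis using that by (simp add: smooth_on_mult)
    qed
    show "\<exists>f\<in>{g. smooth_on UNIV g \<and> bounded (range g)}. f x \<noteq> f y"
      if "x \<in> {0..B}" "y \<in> {0..B}" "x \<noteq> y" for x y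
    proof (rule bexI[of _ "\<lambda>t. sin (t * (1 / B) + 0)"])
      have B: "0 < B" using that by auto
      \<comment> \<open>Scaling by 1/B places the interval inside the range where the sine is
        injective.\<close>
      have "-(pi/2) \<le> t * (1 / B) + 0 \<and> t * (1 / B) + 0 \<le> pi/2" if "t \<in> {0..B}" for t
      proof -
        have "0 \<le> t * (1 / B)" "t * (1 / B) \<le> 1" using that B by (auto simp: field_simps)
        then show ?thesis using pi_ge_two by linarith
      qed
      then show "sin (x * (1 / B) + 0) \<noteq> sin (y * (1 / B) + 0)"
        using that B by (auto dest!: sin_inj_pi[rotated 4])
      show "(\<lambda>t. sin (t * (1 / B) + 0)) \<in> {g. smooth_on UNIV g \<and> bounded (range g)}"
        using smooth_on_compose[OF smooth_on_sin smooth_on_linear[of "1 / B" 0]]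
        by (auto simp: bounded_iff intro!: exI[of _ 1])
    qed
  qed (auto simp: smooth_on_continuous smooth_on_add smooth_on_const intro!: bounded_plus_comp)
  show ?thesis using Stone_Weierstrass_basic[OF assms] by auto
qed

context weighted_domain
begin

lemma X_fst_snd_measurable:
  assumes "V \<in> borel_measurable M"
  shows "(\<lambda>x. fst (V x) :: real) \<in> borel_measurable M" "(\<lambda>x. snd (V x) :: 'a) \<in> borel_measurable M"
  using measurable_compose[OF assms, of fst borel] measurable_compose[OF assms, of snd borel]
  by (simp_all add: borel_measurable_continuous_onI continuous_on_fst continuous_on_snd)

lemma X_snd_Lpw: "V \<in> X \<Longrightarrow> (\<lambda>x. snd (V x)) \<in> Lpw"
  by (rule Lpw_mono(1)[OF X_fst_snd_measurable(2)[OF LpwD(1)[OF X_LpwD]] X_LpwD])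
     (auto intro: norm_snd_le[of "snd (V x)" "fst (V x)" for x, unfolded prod.collapse])

lemma test_X: "\<phi> \<in> Cc_infinity \<Omega> \<Longrightarrow> test \<phi> \<in> X"
  unfolding X_def using test_Lpw p_gt_1 by (auto intro!: bexI[of _ \<phi>])

text \<open>If test functions \<phi> k approximate V, then the F o \<phi> k are test functions,
  because F is smooth and F 0 = 0. They converge since the error splits into a part that is
  Lipschitz in the approximation and a part governed by dominated convergence.\<close>

lemma X_chain_smooth:
  fixes F F' :: "real \<Rightarrow> real"
  assumes V: "V \<in> X" and F: "smooth_on UNIV F'" "\<And>t. (F has_real_derivative F' t) (at t)"
    and F0: "F 0 = 0" and L: "\<And>t. \<bar>F' t\<bar> \<le> L"
  shows "(\<lambda>x. (F (fst (V x)), F' (fst (V x)) *\<^sub>R snd (V x))) \<in> X" (is "?U \<in> X")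
proof -
  have L0: "0 \<le> L" using L[of 0] by linarith
  have smF: "smooth_on UNIV F" by (rule smooth_on_antiderivative[OF F(2,1)])
  have Fm: "F \<in> borel_measurable borel" "F' \<in> borel_measurable borel"
    using smF F(1) by (auto intro!: borel_measurable_continuous_onI smooth_on_continuous)
  have Vm: "V \<in> borel_measurable M" by (rule LpwD(1)[OF X_LpwD[OF V]])
  note vm = X_fst_snd_measurable[OF Vm]
  have lip: "\<bar>F a - F b\<bar> \<le> L * \<bar>a - b\<bar>" for a b
    using field_differentiable_bound[of UNIV F F' L a b] F(2) L by simp
  have Um: "?U \<in> borel_measurable M"
    using measurable_compose[OF vm(1) Fm(1)] measurable_compose[OF vm(1) Fm(2)] vm(2)
    by (intro borel_measurable_Pair borel_measurable_scaleR)
  have U: "?U \<in> Lpw"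
  proof (rule Lpw_mono(1)[OF Um])
    show "(\<lambda>x. L *\<^sub>R V x) \<in> Lpw"
      using LpwD[OF X_LpwD[OF V]] by (simp add: Lpw_def powr_mult mult.assoc)
    show "AE x in M. norm (?U x) \<le> norm (L *\<^sub>R V x)"
    proof (rule AE_I2)
      fix x
      have "norm (?U x) \<le> norm (L * fst (V x), L *\<^sub>R snd (V x))"
        using lip[of "fst (V x)" 0] F0 L[of "fst (V x)"] L0
        by (intro norm_Pair_mono) (auto simp: abs_mult intro!: mult_right_mono)
      also have "(L * fst (V x), L *\<^sub>R snd (V x)) = L *\<^sub>R V x" by (simp add: prod_eq_iff)
      finally show "norm (?U x) \<le> norm (L *\<^sub>R V x)" .
    qed
  qed
  obtain \<phi> where \<phi>: "\<And>k. \<phi> k \<in> Cc_infinity \<Omega>" "(\<lambda>k. energy (\<lambda>x. test (\<phi> k) x - V x)) \<longlonglongrightarrow> 0"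
    "AE x in M. (\<lambda>k. test (\<phi> k) x) \<longlonglongrightarrow> V x"
    using X_seq[OF V] by blast
  define W where "W k = test (\<lambda>x. F (\<phi> k x))" for k
  have WX: "W k \<in> X" for k
    unfolding W_def by (rule test_X[OF Cc_infinity_compose[OF smF F0 \<phi>(1)]])
  have W_eq: "W k x = (F (\<phi> k x), F' (\<phi> k x) *\<^sub>R gradient (\<phi> k) x)" for k x
    using gradient_compose[OF F(2) Cc_infinity_smooth[OF \<phi>(1)]] by (simp add: W_def test_def)
  have \<phi>m: "\<phi> k \<in> borel_measurable M" for k
    by (intro continuous_measurable smooth_on_continuous Cc_infinity_smooth[OF \<phi>(1)])
  \<comment> \<open>The product F'(\<phi>) grad \<phi> is compared in two moves: \<open>?A\<close>
    replaces F(\<phi>) and the gradient, at cost L times the distance of the pairs;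
    \<open>?B\<close> replaces the argument of F', where L |snd V| is a majorant.\<close>
  let ?A = "\<lambda>k x. (F (\<phi> k x), F' (\<phi> k x) *\<^sub>R gradient (\<phi> k) x) - (F (fst (V x)), F' (\<phi> k x) *\<^sub>R snd (V x))"
  let ?B = "\<lambda>k x. (0 :: real, F' (\<phi> k x) *\<^sub>R snd (V x))" and ?B' = "\<lambda>x. (0 :: real, F' (fst (V x)) *\<^sub>R snd (V x))"
  have B: "\<And>k. ?B k \<in> Lpw" "?B' \<in> Lpw" "(\<lambda>k. energy (\<lambda>x. ?B k x - ?B' x)) \<longlonglongrightarrow> 0"
  proof -
    have 1: "?B k \<in> borel_measurable M" for k
      using measurable_compose[OF \<phi>m Fm(2)] vm(2) by (intro borel_measurable_Pair borel_measurable_scaleR) auto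
    have 2: "?B' \<in> borel_measurable M"
      using measurable_compose[OF vm(1) Fm(2)] vm(2) by (intro borel_measurable_Pair borel_measurable_scaleR) auto
    have 3: "(\<lambda>x. L *\<^sub>R snd (V x)) \<in> Lpw"
      using LpwD[OF X_snd_Lpw[OF V]] by (simp add: Lpw_def powr_mult mult.assoc)
    have 4: "AE x in M. (\<lambda>k. ?B k x) \<longlonglongrightarrow> ?B' x"
      using \<phi>(3)
    proof eventually_elim
      fix x assume "(\<lambda>k. test (\<phi> k) x) \<longlonglongrightarrow> V x"
      from tendsto_fst[OF this] have "(\<lambda>k. \<phi> k x) \<longlonglongrightarrow> fst (V x)" by (simp add: test_def)
      then have "(\<lambda>k. F' (\<phi> k x)) \<longlonglongrightarrow> F' (fst (V x))"
        by (rule continuous_on_tendsto_compose[OF smooth_on_continuous[OF F(1), of UNIV]]) auto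
      then show "(\<lambda>k. ?B k x) \<longlonglongrightarrow> ?B' x" by (intro tendsto_intros)
    qed
    have 5: "AE x in M. norm (?B k x) \<le> norm (L *\<^sub>R snd (V x))" for k
      using L L0 by (intro AE_I2) (auto intro!: mult_right_mono)
    from energy_dominated_convergence[OF 1 2 3 4 5]
    show "\<And>k. ?B k \<in> Lpw" "?B' \<in> Lpw" "(\<lambda>k. energy (\<lambda>x. ?B k x - ?B' x)) \<longlonglongrightarrow> 0" .
  qed
  have A: "?A k \<in> Lpw" "energy (?A k) \<le> L powr p * energy (\<lambda>x. test (\<phi> k) x - V x)" for k
  proof -
    have m: "?A k \<in> borel_measurable M"
    proof -
      have "?A k = (\<lambda>x. (W k x - ?U x) - (?B k x - ?B' x))"
        by (auto simp: W_eq)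
      moreover have "(\<lambda>x. (W k x - ?U x) - (?B k x - ?B' x)) \<in> borel_measurable M"
        using LpwD(1)[OF X_LpwD[OF WX[of k]]] Um LpwD(1)[OF B(1)[of k]] LpwD(1)[OF B(2)]
        by (intro borel_measurable_diff)
      ultimately show ?thesis by simp
    qed
    have D: "(\<lambda>x. test (\<phi> k) x - V x) \<in> Lpw" by (rule Lpw_diff[OF test_Lpw[OF \<phi>(1)] X_LpwD[OF V]])
    have LD: "(\<lambda>x. L *\<^sub>R (test (\<phi> k) x - V x)) \<in> Lpw"
      using LpwD[OF D] by (simp add: Lpw_def powr_mult mult.assoc)
    have le: "AE x in M. norm (?A k x) \<le> norm (L *\<^sub>R (test (\<phi> k) x - V x))"
    proof (rule AE_I2)
      fix x
      have "norm (?A k x) \<le> norm (L * (\<phi> k x - fst (V x)), L *\<^sub>R (gradient (\<phi> k) x - snd (V x)))"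
        unfolding diff_Pair
        using lip[of "\<phi> k x" "fst (V x)"] L[of "\<phi> k x"] L0
        by (intro norm_Pair_mono)
           (auto simp: abs_mult scaleR_diff_right[symmetric] intro!: mult_right_mono)
      also have "(L * (\<phi> k x - fst (V x)), L *\<^sub>R (gradient (\<phi> k) x - snd (V x))) = L *\<^sub>R (test (\<phi> k) x - V x)"
        by (simp add: prod_eq_iff test_def)
      finally show "norm (?A k x) \<le> norm (L *\<^sub>R (test (\<phi> k) x - V x))" .
    qed
    show "?A k \<in> Lpw" by (rule Lpw_mono(1)[OF m LD le])
    have "energy (?A k) \<le> energy (\<lambda>x. L *\<^sub>R (test (\<phi> k) x - V x))" by (rule Lpw_mono(2)[OF m LD le])
    also have "\<dots> = L powr p * energy (\<lambda>x. test (\<phi> k) x - V x)"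
      using L0 by (simp add: powr_mult mult.assoc)
    finally show "energy (?A k) \<le> L powr p * energy (\<lambda>x. test (\<phi> k) x - V x)" .
  qed
  have "(\<lambda>k. energy (\<lambda>x. W k x - ?U x)) \<longlonglongrightarrow> 0"
  proof (rule tendsto_sandwich[OF _ _ tendsto_const])
    let ?e = "\<lambda>k. 2 powr p * (L powr p * energy (\<lambda>x. test (\<phi> k) x - V x) + energy (\<lambda>x. ?B k x - ?B' x))"
    show "\<forall>\<^sub>F k in sequentially. energy (\<lambda>x. W k x - ?U x) \<le> ?e k"
    proof (intro always_eventually allI)
      fix k
      have eq: "W k x - ?U x = ?A k x + (?B k x - ?B' x)" for x by (simp add: W_eq)
      have "energy (\<lambda>x. ?A k x + (?B k x - ?B' x)) \<le> 2 powr p * (energy (?A k) + energy (\<lambda>x. ?B k x - ?B' x))"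
        by (rule Lpw_add(2)[OF A(1) Lpw_diff[OF B(1,2)]])
      also have "\<dots> \<le> ?e k" using A(2)[of k] by (intro mult_left_mono add_right_mono) auto
      finally show "energy (\<lambda>x. W k x - ?U x) \<le> ?e k" unfolding eq .
    qed
    have "?e \<longlonglongrightarrow> 2 powr p * (L powr p * 0 + 0)" by (intro tendsto_intros \<phi>(2) B(3))
    then show "?e \<longlonglongrightarrow> 0" by simp
  qed (auto simp: energy_nonneg)
  then show ?thesis by (rule X_closed[OF WX U])
qed

text \<open>On [0, B], where the values of V lie, the derivative h is a uniform limit of smooth
  bounded functions g n. Their antiderivatives obey the smooth chain rule, and the result passes to
  the limit under a majorant.\<close>

lemma X_chain:
  fixes H h :: "real \<Rightarrow> real"
  assumes V: "V \<in> X" and bd: "AE x in M. 0 \<le> fst (V x) \<and> fst (V x) \<le> B"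
    and h: "continuous_on UNIV h" and H: "\<And>t. (H has_real_derivative h t) (at t)" "H 0 = 0"
  shows "(\<lambda>x. (H (fst (V x)), h (fst (V x)) *\<^sub>R snd (V x))) \<in> X" (is "?U \<in> X")
proof -
  have Hm: "H \<in> borel_measurable borel" "h \<in> borel_measurable borel"
    using h H(1) by (auto intro!: borel_measurable_continuous_onI DERIV_continuous_on[of _ _ h])
  note vm = X_fst_snd_measurable[OF LpwD(1)[OF X_LpwD[OF V]]]
  have Um: "?U \<in> borel_measurable M"
    using measurable_compose[OF vm(1) Hm(1)] measurable_compose[OF vm(1) Hm(2)] vm(2)
    by (intro borel_measurable_Pair borel_measurable_scaleR)
  have "compact (h ` {0..B})" using continuous_on_subset[OF h] by (intro compact_continuous_image) auto
  then obtain C where C: "\<And>t. t \<in> {0..B} \<Longrightarrow> \<bar>h t\<bar> \<le> C"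
    using compact_imp_bounded by (fastforce simp: bounded_iff)
  have "\<exists>g. smooth_on UNIV g \<and> bounded (range g) \<and> (\<forall>t\<in>{0..B}. \<bar>h t - g t\<bar> < 1 / real (Suc n))" for n
    using continuous_on_subset[OF h] by (intro smooth_bounded_dense) auto
  then obtain g where g: "\<And>n. smooth_on UNIV (g n)" "\<And>n. bounded (range (g n))"
    "\<And>n t. t \<in> {0..B} \<Longrightarrow> \<bar>h t - g n t\<bar> < 1 / real (Suc n)" by metis
  have "\<exists>G. (\<forall>t. (G has_real_derivative g n t) (at t)) \<and> G 0 = 0" for n
  proof -
    obtain G where "\<And>t. (G has_vector_derivative g n t) (at t)"
      using einterval_antiderivative[of "-\<infinity>" \<infinity> "g n"] smooth_on_continuous[OF g(1)[of n], of UNIV]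
      by (auto simp: continuous_on_eq_continuous_at)
    then have "((\<lambda>t. G t - G 0) has_real_derivative g n t) (at t)" for t
      by (auto simp: has_real_derivative_iff_has_vector_derivative intro!: derivative_eq_intros)
    then show ?thesis by (intro exI[of _ "\<lambda>t. G t - G 0"]) auto
  qed
  then obtain G where G: "\<And>n t. (G n has_real_derivative g n t) (at t)" "\<And>n. G n 0 = 0" by metis
  have GX: "(\<lambda>x. (G n (fst (V x)), g n (fst (V x)) *\<^sub>R snd (V x))) \<in> X" for n
  proof -
    obtain L where "\<And>t. \<bar>g n t\<bar> \<le> L" using g(2)[of n] by (auto simp: bounded_iff)
    then show ?thesis by (rule X_chain_smooth[OF V g(1) G])
  qed
  \<comment> \<open>The mean value theorem turns uniform closeness of the derivatives into uniform
    closeness of the functions, which agree at 0.\<close>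
  have diff: "\<bar>G n t - H t\<bar> \<le> B * (1 / real (Suc n))" if t: "t \<in> {0..B}" for n t
  proof (cases "t = 0")
    case False
    then have "0 < t" using t by simp
    then obtain z where z: "0 < z" "z < t" "(\<lambda>t. G n t - H t) t - (\<lambda>t. G n t - H t) 0 = (t - 0) * (g n z - h z)"
      using MVT2[of 0 t "\<lambda>t. G n t - H t" "\<lambda>t. g n t - h t"] DERIV_diff[OF G(1) H(1)] by blast
    then have "\<bar>G n t - H t\<bar> = t * \<bar>h z - g n z\<bar>"
      using G(2) H(2) \<open>0 < t\<close> by (simp add: abs_mult abs_minus_commute)
    also have "\<dots> \<le> B * (1 / real (Suc n))"
      using t z g(3)[of z n] by (intro mult_mono) auto
    finally show ?thesis .
  qed (use t G(2) H(2) in auto)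
  have l1: "(\<lambda>n. 1 / real (Suc n)) \<longlonglongrightarrow> 0" by (rule LIMSEQ_Suc[OF lim_1_over_n])
  show ?thesis
  proof (rule X_dominated_closed[OF GX Um])
    \<comment> \<open>On [0, B] the error of g n is at most 1, so |g n| is bounded by C + 1, and |G
      n| by B times such a bound.\<close>
    let ?D = "\<lambda>x. (B * (C + 2), (C + 1) *\<^sub>R snd (V x))"
    have "(\<lambda>x. (B * (C + 2), 0 :: 'a)) \<in> Lpw" by (rule Lpw_const)
    moreover have "(\<lambda>x. (0 :: real, (C + 1) *\<^sub>R snd (V x))) \<in> Lpw"
      using LpwD[OF X_snd_Lpw[OF V]] by (auto simp: Lpw_def powr_mult mult.assoc)
    ultimately show "?D \<in> Lpw" using Lpw_add(1) by fastforce
    show "AE x in M. (\<lambda>n. (G n (fst (V x)), g n (fst (V x)) *\<^sub>R snd (V x))) \<longlonglongrightarrow> ?U x"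
      using bd
    proof eventually_elim
      fix x assume x: "0 \<le> fst (V x) \<and> fst (V x) \<le> B"
      have "(\<lambda>n. g n (fst (V x)) - h (fst (V x))) \<longlonglongrightarrow> 0"
        by (rule Lim_null_comparison[OF _ l1])
           (use g(3)[of "fst (V x)"] x in \<open>auto intro!: always_eventually less_imp_le simp: abs_minus_commute\<close>)
      moreover have "(\<lambda>n. G n (fst (V x)) - H (fst (V x))) \<longlonglongrightarrow> B * 0"
        by (rule Lim_null_comparison[THEN tendsto_eq_rhs, OF _ tendsto_mult[OF tendsto_const[of B] l1, THEN tendsto_eq_rhs]])
           (use diff[of "fst (V x)"] x in \<open>auto intro!: always_eventually\<close>)
      ultimately show "(\<lambda>n. (G n (fst (V x)), g n (fst (V x)) *\<^sub>R snd (V x))) \<longlonglongrightarrow> ?U x"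
        by (intro tendsto_Pair tendsto_scaleR tendsto_const) (auto intro: LIM_zero_cancel)
    qed
    show "AE x in M. norm (G n (fst (V x)), g n (fst (V x)) *\<^sub>R snd (V x)) \<le> norm (?D x)" for n
      using bd
    proof eventually_elim
      fix x assume x: "0 \<le> fst (V x) \<and> fst (V x) \<le> B"
      let ?v = "fst (V x)"
      have gb: "\<bar>g n t\<bar> \<le> C + 1" if "t \<in> {0..B}" for t
      proof -
        have "1 / real (Suc n) \<le> 1" by simp
        then show ?thesis using g(3)[OF that, of n] C[OF that] by linarith
      qed
      have C0: "0 \<le> C" using C[of ?v] x by force
      have Gb: "\<bar>G n ?v\<bar> \<le> B * (C + 2)"
      proof (cases "?v = 0")
        case False
        then have v: "0 < ?v" using x by simp
        then obtain z where z: "0 < z" "z < ?v" "G n ?v - G n 0 = (?v - 0) * g n z"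
          using MVT2[of 0 ?v "G n" "g n"] G(1) by auto
        then have "\<bar>G n ?v\<bar> = ?v * \<bar>g n z\<bar>" using G(2) v by (simp add: abs_mult)
        also have "\<dots> \<le> B * (C + 2)" using x z gb[of z] C0 by (intro mult_mono) auto
        finally show ?thesis .
      qed (use G(2) x C0 in auto)
      show "norm (G n ?v, g n ?v *\<^sub>R snd (V x)) \<le> norm (?D x)"
        using Gb gb[of ?v] x C0 by (intro norm_Pair_mono) (auto intro!: mult_right_mono order_trans[OF Gb])
    qed
  qed
qed

lemma X_pos_part_power:
  assumes V: "V \<in> X" and bd: "AE x in M. 0 \<le> fst (V x) \<and> fst (V x) \<le> B" and \<beta>: "1 < \<beta>" and k: "0 \<le> k"
  shows "(\<lambda>x. (max 0 (fst (V x) - k) powr \<beta>, (\<beta> * max 0 (fst (V x) - k) powr (\<beta> - 1)) *\<^sub>R snd (V x))) \<in> X"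
proof (rule X_chain[OF V bd])
  show "continuous_on UNIV (\<lambda>t. \<beta> * max 0 (t - k) powr (\<beta> - 1))"
    using \<beta> by (intro continuous_intros continuous_on_powr') auto
  show "((\<lambda>t. max 0 (t - k) powr \<beta>) has_real_derivative \<beta> * max 0 (t - k) powr (\<beta> - 1)) (at t)" for t
  proof -
    have "((\<lambda>t. t - k) has_real_derivative 1) (at t)" by (auto intro!: derivative_eq_intros)
    from DERIV_chain2[OF max_powr_has_real_derivative[OF \<beta>] this] show ?thesis by simp
  qed
qed (use k in auto)

text \<open>The positive part is not differentiable at k, so it is reached from powers with
  exponents decreasing to 1. Their gradients vanish where V does not exceed k, since there the base
  of the power is 0, and elsewhere the factor tends to 1.\<close>

lemma X_pos_part:
  assumes V: "V \<in> X" and bd: "AE x in M. 0 \<le> fst (V x) \<and> fst (V x) \<le> B" and k: "0 \<le> k"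
  shows "(\<lambda>x. (max 0 (fst (V x) - k), if k < fst (V x) then snd (V x) else 0)) \<in> X"
proof -
  define b where "b n = 1 + 1 / real (Suc n)" for n
  have b: "1 < b n" "b n \<le> 2" for n by (auto simp: b_def)
  have lb: "b \<longlonglongrightarrow> 1"
    unfolding b_def[abs_def] using tendsto_add[OF tendsto_const[of "1 :: real"] LIMSEQ_Suc[OF lim_1_over_n]] by simp
  note vm[measurable] = X_fst_snd_measurable[OF LpwD(1)[OF X_LpwD[OF V]]]
  show ?thesis
  proof (rule X_dominated_closed[OF X_pos_part_power[OF V bd b(1) k]])
    show "(\<lambda>x. (max 0 (fst (V x) - k), if k < fst (V x) then snd (V x) else 0)) \<in> borel_measurable M"
      by measurable
    let ?D = "\<lambda>x. ((1 + B) powr 2, (2 * (1 + B) powr 1) *\<^sub>R snd (V x))"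
    have "(\<lambda>x. ((1 + B) powr 2, 0 :: 'a)) \<in> Lpw" by (rule Lpw_const)
    moreover have "(\<lambda>x. (0 :: real, (2 * (1 + B) powr 1) *\<^sub>R snd (V x))) \<in> Lpw"
      using LpwD[OF X_snd_Lpw[OF V]] by (auto simp: Lpw_def powr_mult mult.assoc)
    ultimately show "?D \<in> Lpw" using Lpw_add(1) by fastforce
    show "AE x in M. (\<lambda>n. (max 0 (fst (V x) - k) powr b n, (b n * max 0 (fst (V x) - k) powr (b n - 1)) *\<^sub>R snd (V x)))
        \<longlonglongrightarrow> (max 0 (fst (V x) - k), if k < fst (V x) then snd (V x) else 0)"
    proof (rule AE_I2)
      fix x
      let ?m = "max 0 (fst (V x) - k)"
      show "(\<lambda>n. (?m powr b n, (b n * ?m powr (b n - 1)) *\<^sub>R snd (V x)))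
        \<longlonglongrightarrow> (?m, if k < fst (V x) then snd (V x) else 0)"
      proof (cases "k < fst (V x)")
        case True
        then have "(\<lambda>n. (?m powr b n, (b n * ?m powr (b n - 1)) *\<^sub>R snd (V x)))
          \<longlonglongrightarrow> (?m powr 1, (1 * ?m powr (1 - 1)) *\<^sub>R snd (V x))"
          by (intro tendsto_intros lb) auto
        then show ?thesis using True by simp
      qed (use k in simp)
    qed
    show "AE x in M. norm (max 0 (fst (V x) - k) powr b n, (b n * max 0 (fst (V x) - k) powr (b n - 1)) *\<^sub>R snd (V x)) \<le> norm (?D x)" for n
      using bd
    proof eventually_elim
      fix x assume x: "0 \<le> fst (V x) \<and> fst (V x) \<le> B"
      let ?m = "max 0 (fst (V x) - k)"
      have m: "0 \<le> ?m" "?m \<le> 1 + B" "1 \<le> 1 + B" using x k by auto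
      have 1: "?m powr b n \<le> (1 + B) powr 2"
        using powr_mono2[OF _ m(1,2), of "b n"] powr_mono[OF b(2) m(3), of n] b(1)[of n] by linarith
      have "?m powr (b n - 1) \<le> (1 + B) powr 1"
        using powr_mono2[OF _ m(1,2), of "b n - 1"] powr_mono[OF _ m(3), of "b n - 1" 1] b[of n] by linarith
      then have 2: "b n * ?m powr (b n - 1) \<le> 2 * (1 + B) powr 1"
        using b[of n] by (intro mult_mono) auto
      show "norm (?m powr b n, (b n * ?m powr (b n - 1)) *\<^sub>R snd (V x)) \<le> norm (?D x)"
        using 1 2 b(1)[of n] m by (intro norm_Pair_mono) (auto simp: abs_mult intro!: mult_right_mono)
    qed
  qed
qed

section \<open>Gagliardo-Nirenberg on the closure of the test functions\<close>

lemma Fatou_bound: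
  fixes f :: "nat \<Rightarrow> 'a \<Rightarrow> real"
  assumes f: "\<And>k. integrable M (f k)" "\<And>k. AE x in M. 0 \<le> f k x" and l: "l \<in> borel_measurable M"
    and lim: "AE x in M. (\<lambda>k. f k x) \<longlonglongrightarrow> l x"
    and le: "\<And>k. (LINT x|M. f k x) \<le> c k" and c: "c \<longlonglongrightarrow> C"
  shows "integrable M l" "(LINT x|M. l x) \<le> C"
proof -
  have "AE x in M. \<forall>k. 0 \<le> f k x" using f(2) by (simp add: AE_all_countable)
  with lim have l0: "AE x in M. 0 \<le> l x"
  proof eventually_elim
    fix x assume "(\<lambda>k. f k x) \<longlonglongrightarrow> l x" "\<forall>k. 0 \<le> f k x"
    then show "0 \<le> l x" by (intro LIMSEQ_le_const[of "\<lambda>k. f k x"]) auto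
  qed
  have i0: "0 \<le> (LINT x|M. f k x)" for k by (rule integral_nonneg_AE[OF f(2)])
  have c0: "0 \<le> c k" for k using i0 le order_trans by blast
  then have C0: "0 \<le> C" by (intro LIMSEQ_le_const[OF c]) auto
  \<comment> \<open>The nonnegative integral is used because its finiteness proves that l is
    integrable, before any Bochner integral of l has a meaning.\<close>
  have "(\<integral>\<^sup>+x. ennreal (l x) \<partial>M) = (\<integral>\<^sup>+x. liminf (\<lambda>k. ennreal (f k x)) \<partial>M)"
    using lim by (intro nn_integral_cong_AE) (auto intro!: lim_imp_Liminf[symmetric] tendsto_ennrealI elim: eventually_mono)
  also have "\<dots> \<le> liminf (\<lambda>k. \<integral>\<^sup>+x. ennreal (f k x) \<partial>M)"
    using f(1) by (intro nn_integral_liminf) auto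
  also have "\<dots> \<le> liminf (\<lambda>k. ennreal (c k))"
    using le c0 by (intro Liminf_mono always_eventually allI) (simp add: nn_integral_eq_integral[OF f] ennreal_leI)
  also have "\<dots> = ennreal C" by (intro lim_imp_Liminf tendsto_ennrealI c) simp
  finally have *: "(\<integral>\<^sup>+x. ennreal (l x) \<partial>M) \<le> ennreal C" .
  show i: "integrable M l"
    using l l0 * by (intro integrableI_nonneg) (auto simp: less_top[symmetric] top_unique)
  show "(LINT x|M. l x) \<le> C"
    using * C0 by (simp add: nn_integral_eq_integral[OF i l0])
qed

text \<open>Along test functions approximating V, the gradients converge in L^1 and the functions
  almost everywhere; Fatou's lemma handles the left-hand side.\<close>

lemma Gagliardo_Nirenberg_X:
  assumes V: "V \<in> X" and dim: "DIM('a) \<ge> 2"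
  defines "q \<equiv> real DIM('a) / (real DIM('a) - 1)"
  shows "integrable M (\<lambda>x. \<bar>fst (V x)\<bar> powr q)"
    "(LINT x|M. \<bar>fst (V x)\<bar> powr q) \<le> (LINT x|M. norm (snd (V x))) powr q"
proof -
  have q: "0 < q" using dim by (auto simp: q_def)
  obtain \<phi> where \<phi>: "\<And>k. \<phi> k \<in> Cc_infinity \<Omega>" "(\<lambda>k. energy (\<lambda>x. test (\<phi> k) x - V x)) \<longlonglongrightarrow> 0"
    "AE x in M. (\<lambda>k. test (\<phi> k) x) \<longlonglongrightarrow> V x"
    using X_seq[OF V] by blast
  have Vm: "V \<in> borel_measurable M" by (rule LpwD(1)[OF X_LpwD[OF V]])
  note vm[measurable] = X_fst_snd_measurable[OF Vm]
  have Vi: "integrable M V" by (rule Lpw_integrable(1)[OF X_LpwD[OF V]])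
  have gi: "integrable M (\<lambda>x. norm (snd (V x)))"
    using integrable_bounded_linear[OF bounded_linear_snd Vi] by simp
  have on_M: "(LINT x|M. H x) = (LINT x|lborel. H x)" "integrable M H"
    if "continuous_on UNIV H" "\<And>x. x \<notin> K \<Longrightarrow> H x = 0" "compact K" "K \<subseteq> \<Omega>" for H :: "'a \<Rightarrow> real" and K
  proof -
    have i: "integrable lborel H"
      using that continuous_on_subset by (intro compact_support_integrable[of K]) blast+
    have z: "H x = 0" if "x \<notin> \<Omega>" for x using that \<open>K \<subseteq> \<Omega>\<close> \<open>\<And>x. x \<notin> K \<Longrightarrow> H x = 0\<close> by blast
    show "(LINT x|M. H x) = (LINT x|lborel. H x)" "integrable M H"
      using i z by (simp_all add: lebesgue_on_integral_supported[OF domain_sets] integral_completion integrable_completion)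
  qed
  have t: "(LINT x|M. \<bar>\<phi> k x\<bar> powr q) \<le> (LINT x|M. norm (gradient (\<phi> k) x)) powr q"
    "integrable M (\<lambda>x. \<bar>\<phi> k x\<bar> powr q)" "integrable M (\<lambda>x. norm (gradient (\<phi> k) x))" for k
  proof -
    obtain K where K: "compact K" "K \<subseteq> \<Omega>" "\<And>x. x \<notin> K \<Longrightarrow> \<phi> k x = 0" "\<And>x. x \<notin> K \<Longrightarrow> gradient (\<phi> k) x = 0"
      using Cc_infinity_support[OF \<phi>(1)[of k]] by metis
    note sm = Cc_infinity_smooth[OF \<phi>(1)[of k]]
    have 1: "continuous_on UNIV (\<lambda>x. \<bar>\<phi> k x\<bar> powr q)"
      using q by (intro continuous_intros continuous_on_powr' smooth_on_continuous[OF sm]) auto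
    have 2: "continuous_on UNIV (\<lambda>x. norm (gradient (\<phi> k) x))"
      by (intro continuous_intros smooth_on_continuous_gradient[OF sm])
    note on1 = on_M[OF 1 _ K(1,2)] and on2 = on_M[OF 2 _ K(1,2)]
    show "integrable M (\<lambda>x. \<bar>\<phi> k x\<bar> powr q)" "integrable M (\<lambda>x. norm (gradient (\<phi> k) x))"
      using on1(2) on2(2) K by auto
    show "(LINT x|M. \<bar>\<phi> k x\<bar> powr q) \<le> (LINT x|M. norm (gradient (\<phi> k) x)) powr q"
      using on1(1) on2(1) K Gagliardo_Nirenberg[OF \<phi>(1)[of k] dim] by (simp add: q_def)
  qed
  have c: "(\<lambda>k. LINT x|M. norm (gradient (\<phi> k) x)) \<longlonglongrightarrow> (LINT x|M. norm (snd (V x)))"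
  proof (rule LIM_zero_cancel, rule Lim_null_comparison)
    show "\<forall>\<^sub>F k in sequentially. norm ((LINT x|M. norm (gradient (\<phi> k) x)) - (LINT x|M. norm (snd (V x))))
      \<le> energy (\<lambda>x. test (\<phi> k) x - V x) powr (1 / p) * dual_const"
    proof (intro always_eventually allI)
      fix k
      have Di: "integrable M (\<lambda>x. test (\<phi> k) x - V x)"
        "(LINT x|M. norm (test (\<phi> k) x - V x)) \<le> energy (\<lambda>x. test (\<phi> k) x - V x) powr (1 / p) * dual_const"
        using Lpw_integrable[OF Lpw_diff[OF test_Lpw[OF \<phi>(1)] X_LpwD[OF V]]] by auto
      have "(LINT x|M. norm (gradient (\<phi> k) x)) - (LINT x|M. norm (snd (V x))) =
          (LINT x|M. norm (gradient (\<phi> k) x) - norm (snd (V x)))"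
        using t(3) gi by simp
      also have "\<bar>\<dots>\<bar> \<le> (LINT x|M. norm (test (\<phi> k) x - V x))"
      proof (rule integral_abs_bound[THEN order_trans], rule integral_mono)
        show "integrable M (\<lambda>x. \<bar>norm (gradient (\<phi> k) x) - norm (snd (V x))\<bar>)" using t(3) gi by simp
        show "integrable M (\<lambda>x. norm (test (\<phi> k) x - V x))" using Di(1) by simp
        fix x
        have "\<bar>norm (gradient (\<phi> k) x) - norm (snd (V x))\<bar> \<le> norm (gradient (\<phi> k) x - snd (V x))"
          by (rule norm_triangle_ineq3)
        also have "\<dots> \<le> norm (\<phi> k x - fst (V x), gradient (\<phi> k) x - snd (V x))" by (rule norm_snd_le)
        also have "(\<phi> k x - fst (V x), gradient (\<phi> k) x - snd (V x)) = test (\<phi> k) x - V x"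
          by (simp add: test_def prod_eq_iff)
        finally show "\<bar>norm (gradient (\<phi> k) x) - norm (snd (V x))\<bar> \<le> norm (test (\<phi> k) x - V x)" .
      qed
      also note Di(2)
      finally show "norm ((LINT x|M. norm (gradient (\<phi> k) x)) - (LINT x|M. norm (snd (V x))))
        \<le> energy (\<lambda>x. test (\<phi> k) x - V x) powr (1 / p) * dual_const" by simp
    qed
    have "(\<lambda>k. energy (\<lambda>x. test (\<phi> k) x - V x) powr (1 / p) * dual_const) \<longlonglongrightarrow> 0 powr (1 / p) * dual_const"
      using p_gt_1 by (intro tendsto_intros tendsto_powr2 \<phi>(2)) (auto simp: energy_nonneg)
    then show "(\<lambda>k. energy (\<lambda>x. test (\<phi> k) x - V x) powr (1 / p) * dual_const) \<longlonglongrightarrow> 0" by simp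
  qed
  have lim: "AE x in M. (\<lambda>k. \<bar>\<phi> k x\<bar> powr q) \<longlonglongrightarrow> \<bar>fst (V x)\<bar> powr q"
    using \<phi>(3)
  proof eventually_elim
    fix x assume "(\<lambda>k. test (\<phi> k) x) \<longlonglongrightarrow> V x"
    from tendsto_fst[OF this] have "(\<lambda>k. \<phi> k x) \<longlonglongrightarrow> fst (V x)" by (simp add: test_def)
    then show "(\<lambda>k. \<bar>\<phi> k x\<bar> powr q) \<longlonglongrightarrow> \<bar>fst (V x)\<bar> powr q"
      using q by (intro tendsto_powr2 tendsto_intros) auto
  qed
  have cq: "(\<lambda>k. (LINT x|M. norm (gradient (\<phi> k) x)) powr q) \<longlonglongrightarrow> (LINT x|M. norm (snd (V x))) powr q"
    using q by (intro tendsto_powr2 tendsto_intros c) auto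
  have m: "(\<lambda>x. \<bar>fst (V x)\<bar> powr q) \<in> borel_measurable M" by measurable
  show "integrable M (\<lambda>x. \<bar>fst (V x)\<bar> powr q)"
    by (rule Fatou_bound(1)[OF t(2) _ m lim t(1) cq]) simp
  show "(LINT x|M. \<bar>fst (V x)\<bar> powr q) \<le> (LINT x|M. norm (snd (V x))) powr q"
    by (rule Fatou_bound(2)[OF t(2) _ m lim t(1) cq]) simp
qed

end

subsection \<open>Weighted Sobolev inequalities\<close>

text \<open>At the levels k j = k0 + d (1 - 2^(-j)) the gaps halve while \<psi> decays like \<Psi>
  2^(- j \<mu>). The distance d is the one for which this decay reproduces itself under
  \<open>step\<close>; all levels stay below k0 + d, so monotonicity gives \<psi> (k0 + d) =
  0.\<close>

lemma Stampacchia: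
  fixes \<psi> :: "real \<Rightarrow> real"
  assumes mono: "\<And>k h. k0 \<le> k \<Longrightarrow> k \<le> h \<Longrightarrow> \<psi> h \<le> \<psi> k" and nn: "\<And>k. 0 \<le> \<psi> k"
    and step: "\<And>k h. k0 \<le> k \<Longrightarrow> k < h \<Longrightarrow> (h - k) powr \<alpha> * \<psi> h \<le> C * \<psi> k powr \<beta>"
    and pos: "0 < \<alpha>" "1 < \<beta>" "0 < C" "0 < \<Psi>" and start: "\<psi> k0 \<le> \<Psi>"
  shows "\<psi> (k0 + (C * \<Psi> powr (\<beta> - 1) * 2 powr (\<alpha> * \<beta> / (\<beta> - 1))) powr (1 / \<alpha>)) = 0"
proof -
  define d where "d = (C * \<Psi> powr (\<beta> - 1) * 2 powr (\<alpha> * \<beta> / (\<beta> - 1))) powr (1 / \<alpha>)"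
  have d: "0 < d" "d powr \<alpha> = C * \<Psi> powr (\<beta> - 1) * 2 powr (\<alpha> * \<beta> / (\<beta> - 1))"
    using pos by (auto simp: d_def powr_powr)
  define k where "k j = k0 + d * (1 - 2 powr (- real j))" for j :: nat
  \<comment> \<open>The rate at which the powers of 2 on both sides match: it satisfies \<alpha> +
    \<mu> = \<mu> \<beta>.\<close>
  define \<mu> where "\<mu> = \<alpha> / (\<beta> - 1)"
  have \<mu>: "0 < \<mu>" using pos by (simp add: \<mu>_def)
  have kd: "k (Suc j) - k j = d * 2 powr (- real (Suc j))" for j
  proof -
    have "2 powr (- real j) = 2 * 2 powr (- real (Suc j) :: real)"
      by (simp add: powr_diff powr_minus field_simps powr_realpow)
    then show ?thesis by (simp add: k_def algebra_simps)
  qed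
  have kk: "k j \<le> k0 + d" "k0 \<le> k j" for j
  proof -
    have "0 \<le> 2 powr (- real j :: real)" "2 powr (- real j) \<le> (1::real)"
      using powr_mono[of "- real j" 0 "2::real"] by auto
    then show "k j \<le> k0 + d" "k0 \<le> k j" using d(1) by (auto simp: k_def mult_le_cancel_left2)
  qed
  have bound: "\<psi> (k j) \<le> \<Psi> * 2 powr (- real j * \<mu>)" for j
  proof (induction j)
    case 0
    then show ?case using start by (simp add: k_def)
  next
    case (Suc j)
    let ?e = "d * 2 powr (- real (Suc j))"
    have e: "0 < ?e" using d(1) by simp
    have "?e powr \<alpha> * \<psi> (k (Suc j)) \<le> C * \<psi> (k j) powr \<beta>"
      using step[OF kk(2), of j "k (Suc j)"] e by (simp only: kd[symmetric])
    also have "\<dots> \<le> C * (\<Psi> * 2 powr (- real j * \<mu>)) powr \<beta>"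
      using Suc.IH nn pos by (intro mult_left_mono powr_mono2) auto
    also have "\<dots> = ?e powr \<alpha> * (\<Psi> * 2 powr (- real (Suc j) * \<mu>))"
    proof -
      have b: "\<mu> * (\<beta> - 1) = \<alpha>" using pos by (simp add: \<mu>_def)
      have ab: "\<alpha> * \<beta> / (\<beta> - 1) = \<mu> * \<beta>" by (simp add: \<mu>_def)
      have "?e powr \<alpha> = C * \<Psi> powr (\<beta> - 1) * (2 powr (\<mu> * \<beta>) * 2 powr (- real (Suc j) * \<alpha>))"
        using d pos by (simp add: powr_mult powr_powr ab del: of_nat_Suc)
      then have "?e powr \<alpha> * (\<Psi> * 2 powr (- real (Suc j) * \<mu>)) =
          C * (\<Psi> powr (\<beta> - 1) * \<Psi> powr 1) * (2 powr (\<mu> * \<beta>) * 2 powr (- real (Suc j) * \<alpha>) * 2 powr (- real (Suc j) * \<mu>))"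
        using pos by (simp add: mult_ac del: of_nat_Suc)
      also have "\<dots> = C * \<Psi> powr \<beta> * 2 powr (\<mu> * \<beta> + - real (Suc j) * \<alpha> + - real (Suc j) * \<mu>)"
        by (simp only: powr_add[symmetric]) simp
      also have "\<mu> * \<beta> + - real (Suc j) * \<alpha> + - real (Suc j) * \<mu> = - real j * \<mu> * \<beta>"
        unfolding b[symmetric] by (simp add: algebra_simps)
      finally show ?thesis using pos by (simp add: powr_mult powr_powr)
    qed
    finally show ?case using e by (simp only: mult_le_cancel_left_pos powr_gt_zero)
  qed
  have le: "\<psi> (k0 + d) \<le> \<Psi> * 2 powr (- real j * \<mu>)" for j
    using mono[OF kk(2,1)] bound[of j] order_trans by blast
  have "(\<lambda>j. \<Psi> * (2 powr (- \<mu>)) ^ j) \<longlonglongrightarrow> \<Psi> * 0"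
    using \<mu> powr_less_mono[of "- \<mu>" 0 "2::real"] by (intro tendsto_intros LIMSEQ_power_zero) auto
  moreover have "(2 powr (- \<mu>)) ^ j = 2 powr (- real j * \<mu>)" for j
    by (simp add: powr_realpow[symmetric] powr_powr mult.commute)
  ultimately have "\<psi> (k0 + d) \<le> 0"
    using LIMSEQ_le_const[of "\<lambda>j. \<Psi> * 2 powr (- real j * \<mu>)" 0 "\<psi> (k0 + d)"] le by auto
  then show ?thesis using nn[of "k0 + d"] by (simp add: d_def)
qed

lemma Hoelder_3:
  fixes f g h :: "'a \<Rightarrow> real"
  assumes "0 \<le> a" "0 \<le> b" "0 \<le> c" "a + b + c = 1" "integrable M f" "integrable M g" "integrable M h"
    "AE x in M. 0 \<le> f x" "AE x in M. 0 \<le> g x" "AE x in M. 0 \<le> h x"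
  shows "integrable M (\<lambda>x. f x powr a * g x powr b * h x powr c)"
    and "(LINT x|M. f x powr a * g x powr b * h x powr c)
      \<le> (LINT x|M. f x) powr a * (LINT x|M. g x) powr b * (LINT x|M. h x) powr c"
proof -
  let ?a = "\<lambda>i::nat. if i = 0 then a else if i = 1 then b else c"
  let ?g = "\<lambda>i::nat. if i = 0 then f else if i = 1 then g else h"
  have "integrable M (\<lambda>x. \<Prod>i\<in>{0,1,2}. ?g i x powr ?a i)"
    "(LINT x|M. (\<Prod>i\<in>{0,1,2}. ?g i x powr ?a i)) \<le> (\<Prod>i\<in>{0,1,2}. (LINT x|M. ?g i x) powr ?a i)"
    by (rule Hoelder_prod; use assms in auto)+
  then show "integrable M (\<lambda>x. f x powr a * g x powr b * h x powr c)"
    "(LINT x|M. f x powr a * g x powr b * h x powr c)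
      \<le> (LINT x|M. f x) powr a * (LINT x|M. g x) powr b * (LINT x|M. h x) powr c"
    by (simp_all add: mult.assoc)
qed

section \<open>Embeddings of the energy space\<close>

context weighted_domain
begin

text \<open>Hoelder's inequality for |g|^r = (|g|^p w)^(s/(s + 1)) (w^(-s))^(1/(s + 1)); the
  exponent r = p s/(s + 1) is the one at which the weight cancels.\<close>

lemma gradient_Lr:
  fixes g :: "'a \<Rightarrow> 'b::euclidean_space"
  assumes s: "0 < s" "integrable M (\<lambda>x. w x powr (- s))" and g: "g \<in> Lpw"
  defines "r \<equiv> p_sub p s"
  shows "integrable M (\<lambda>x. norm (g x) powr r)"
    "(LINT x|M. norm (g x) powr r) powr (1 / r) \<le>
      energy g powr (1 / p) * (LINT x|M. w x powr (- s)) powr (1 / (p * s))"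
proof -
  have a: "0 \<le> s / (s + 1)" "0 \<le> 1 / (s + 1)" "s / (s + 1) + 1 / (s + 1) = 1"
    using s by (auto simp: field_simps)
  have r: "0 < r" "r = p * (s / (s + 1))" using s p_gt_1 by (auto simp: r_def p_sub_def)
  have nn: "AE x in M. 0 \<le> norm (g x) powr p * w x" using weight_pos by (auto elim: eventually_mono)
  have nn': "AE x in M. 0 \<le> w x powr (- s)" by simp
  note H = Hoelder_2[OF a LpwD(2)[OF g] s(2) nn nn']
  have eq: "AE x in M. (norm (g x) powr p * w x) powr (s / (s + 1)) * (w x powr (- s)) powr (1 / (s + 1)) = norm (g x) powr r"
    using weight_pos
    by eventually_elim (simp add: powr_mult powr_powr r(2) mult.assoc powr_add[symmetric])
  have gm: "(\<lambda>x. norm (g x) powr r) \<in> borel_measurable M" using LpwD(1)[OF g] by measurable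
  show "integrable M (\<lambda>x. norm (g x) powr r)"
    using H(1) eq gm by (subst integrable_cong_AE[symmetric]) auto
  have "(LINT x|M. norm (g x) powr r) = (LINT x|M. (norm (g x) powr p * w x) powr (s / (s + 1)) * (w x powr (- s)) powr (1 / (s + 1)))"
    using H(1) eq gm by (intro integral_cong_AE) auto
  also note H(2)
  finally have "(LINT x|M. norm (g x) powr r) powr (1 / r) \<le>
     (energy g powr (s / (s + 1)) * (LINT x|M. w x powr (- s)) powr (1 / (s + 1))) powr (1 / r)"
    using r(1) by (intro powr_mono2) auto
  also have "\<dots> = energy g powr (1 / p) * (LINT x|M. w x powr (- s)) powr (1 / (p * s))"
    using s p_gt_1 by (simp add: powr_mult powr_powr r(2) energy_nonneg)
  finally show "(LINT x|M. norm (g x) powr r) powr (1 / r) \<le>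
      energy g powr (1 / p) * (LINT x|M. w x powr (- s)) powr (1 / (p * s))" .
qed

lemma superlevel_set:
  fixes v :: "'a \<Rightarrow> real"
  assumes v: "v \<in> borel_measurable M"
  shows "{x \<in> \<Omega>. h < v x} \<in> sets M" "integrable M (indicator {x \<in> \<Omega>. h < v x} :: 'a \<Rightarrow> real)"
    "(LINT x|M. indicator {x \<in> \<Omega>. h < v x} x) = measure M {x \<in> \<Omega>. h < v x}"
proof -
  have "{x \<in> space M. h < v x} \<in> sets M" using v by measurable
  then show S: "{x \<in> \<Omega>. h < v x} \<in> sets M" by simp
  then show "integrable M (indicator {x \<in> \<Omega>. h < v x} :: 'a \<Rightarrow> real)"
    by (intro integrable_real_indicator) (auto simp: emeasure_eq_measure)
  have "{x \<in> \<Omega>. h < v x} \<inter> \<Omega> = {x \<in> \<Omega>. h < v x}" by auto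
  then show "(LINT x|M. indicator {x \<in> \<Omega>. h < v x} x) = measure M {x \<in> \<Omega>. h < v x}"
    by simp
qed

lemma bounded_powr_integrable:
  fixes v :: "'a \<Rightarrow> real"
  assumes "v \<in> borel_measurable M" "AE x in M. 0 \<le> v x \<and> v x \<le> B" "0 \<le> a"
  shows "integrable M (\<lambda>x. v x powr a)"
proof (rule integrable_const_bound)
  show "AE x in M. norm (v x powr a) \<le> B powr a"
    using assms(2) by eventually_elim (use assms(3) in \<open>auto intro: powr_mono2\<close>)
qed (use assms(1) in measurable)

text \<open>Gagliardo-Nirenberg is applied to V^\<sigma>, with \<sigma> such that \<sigma> N/(N - 1)
  is the Sobolev exponent R. Hoelder splits V^(\<sigma> - 1) |grad V|, where \<sigma> - 1 = R (1 -
  1/r), so the same integral of V^R appears on both sides and is cancelled; boundedness of V makes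
  it finite. For r = 1 one has \<sigma> = 1, outside the reach of the power rule, but then the claim
  is Gagliardo-Nirenberg itself.\<close>

lemma Sobolev_X:
  assumes V: "V \<in> X" and bd: "AE x in M. 0 \<le> fst (V x) \<and> fst (V x) \<le> B"
    and dim: "DIM('a) \<ge> 2" and r: "1 \<le> r" "r < real DIM('a)"
    and g: "integrable M (\<lambda>x. norm (snd (V x)) powr r)"
  defines "N \<equiv> real DIM('a)"
  shows "(LINT x|M. fst (V x) powr sobolev_exp N r) powr (1 / sobolev_exp N r)
    \<le> r * (N - 1) / (N - r) * (LINT x|M. norm (snd (V x)) powr r) powr (1 / r)"
proof -
  define \<sigma> where "\<sigma> = r * (N - 1) / (N - r)"
  define q where "q = N / (N - 1)"
  define R where "R = sobolev_exp N r"
  have N2: "2 \<le> N" "r < N" using dim r by (auto simp: N_def)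
  have q: "0 < q" using N2 by (simp add: q_def)
  have R: "0 < R" "R = N * r / (N - r)" using N2 r by (auto simp: R_def sobolev_exp_def)
  have \<sigma>q: "\<sigma> * q = R" using N2 r by (simp add: \<sigma>_def q_def R(2))
  let ?G = "LINT x|M. norm (snd (V x)) powr r"
  let ?I = "LINT x|M. fst (V x) powr R"
  note vm[measurable] = X_fst_snd_measurable[OF LpwD(1)[OF X_LpwD[OF V]]]
  have I0: "0 \<le> ?I" by simp
  have "?I powr (1 / R) \<le> \<sigma> * ?G powr (1 / r)"
  proof (cases "r = 1")
    case True
    have s1: "\<sigma> = 1" "R = q" using True N2 by (auto simp: \<sigma>_def R(2) q_def)
    have "?I = (LINT x|M. \<bar>fst (V x)\<bar> powr q)"
      using bd s1 by (intro integral_cong_AE) (auto elim: eventually_mono)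
    also have "\<dots> \<le> (LINT x|M. norm (snd (V x))) powr q"
      using Gagliardo_Nirenberg_X(2)[OF V dim] by (simp add: q_def N_def)
    finally have "?I powr (1 / R) \<le> ((LINT x|M. norm (snd (V x))) powr q) powr (1 / R)"
      using R(1) I0 by (intro powr_mono2) auto
    then show ?thesis using True s1 q by (simp add: powr_powr)
  next
    case False
    then have r1: "1 < r" using r by simp
    have \<sigma>1: "1 < \<sigma>"
    proof -
      have "0 < N * (r - 1)" using r1 N2 by simp
      then have "N - r < r * (N - 1)" by (simp add: algebra_simps)
      then show ?thesis using N2 by (simp add: \<sigma>_def)
    qed
    let ?m = "\<lambda>x. max 0 (fst (V x) - 0)"
    let ?U = "\<lambda>x. (?m x powr \<sigma>, (\<sigma> * ?m x powr (\<sigma> - 1)) *\<^sub>R snd (V x))"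
    have U: "?U \<in> X" by (rule X_pos_part_power[OF V bd \<sigma>1]) simp
    have m_eq: "AE x in M. ?m x = fst (V x)" using bd by (auto elim: eventually_mono)
    have Ri: "integrable M (\<lambda>x. fst (V x) powr R)"
      using R by (intro bounded_powr_integrable[OF vm(1) bd]) simp
    have e: "R * (1 - 1 / r) = \<sigma> - 1"
    proof -
      have "(N - r) * (R * (1 - 1 / r)) = N * (r - 1)" using r1 N2 by (simp add: R(2) field_simps)
      moreover have "(N - r) * (\<sigma> - 1) = N * (r - 1)" using N2 by (simp add: \<sigma>_def field_simps)
      ultimately show ?thesis using N2 by (metis less_irrefl mult_cancel_left right_minus_eq)
    qed
    have a: "0 \<le> 1 - 1 / r" "0 \<le> 1 / r" "1 - 1 / r + 1 / r = 1" using r1 by auto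
    have nn: "AE x in M. 0 \<le> fst (V x) powr R" "AE x in M. 0 \<le> norm (snd (V x)) powr r" by auto
    note H = Hoelder_2[OF a Ri g nn]
    have "?I = (LINT x|M. \<bar>fst (?U x)\<bar> powr q)"
      using m_eq by (intro integral_cong_AE) (auto simp: powr_powr \<sigma>q elim: eventually_mono)
    also have "\<dots> \<le> (LINT x|M. norm (snd (?U x))) powr q"
      using Gagliardo_Nirenberg_X(2)[OF U dim] by (simp add: q_def N_def)
    also have "(LINT x|M. norm (snd (?U x))) = (LINT x|M. \<sigma> * ((fst (V x) powr R) powr (1 - 1 / r) * (norm (snd (V x)) powr r) powr (1 / r)))"
      using m_eq r1 \<sigma>1
      by (intro integral_cong_AE) (auto simp: powr_powr e abs_mult elim: eventually_mono)
    finally have *: "?I \<le> (LINT x|M. \<sigma> * ((fst (V x) powr R) powr (1 - 1 / r) * (norm (snd (V x)) powr r) powr (1 / r))) powr q" .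
    have **: "(LINT x|M. \<sigma> * ((fst (V x) powr R) powr (1 - 1 / r) * (norm (snd (V x)) powr r) powr (1 / r)))
      \<le> \<sigma> * (?I powr (1 - 1 / r) * ?G powr (1 / r))"
      using H \<sigma>1 by (simp add: mult_left_mono)
    have "?I powr (1 / q) \<le> ((\<sigma> * (?I powr (1 - 1 / r) * ?G powr (1 / r))) powr q) powr (1 / q)"
    proof (intro powr_mono2)
      have "0 \<le> (LINT x|M. \<sigma> * ((fst (V x) powr R) powr (1 - 1 / r) * (norm (snd (V x)) powr r) powr (1 / r)))"
        using \<sigma>1 by (intro Bochner_Integration.integral_nonneg) simp
      with * show "?I \<le> (\<sigma> * (?I powr (1 - 1 / r) * ?G powr (1 / r))) powr q"
        using q ** by (elim order_trans) (intro powr_mono2; simp)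
    qed (use q I0 in auto)
    also have "\<dots> = \<sigma> * (?I powr (1 - 1 / r) * ?G powr (1 / r))"
      using q \<sigma>1 by (simp add: powr_powr)
    finally have main: "?I powr (1 / q) \<le> \<sigma> * (?I powr (1 - 1 / r) * ?G powr (1 / r))" .
    show ?thesis
    proof (cases "?I = 0")
      case False
      then have Ip: "0 < ?I" using I0 by linarith
      \<comment> \<open>What is left of the exponent after cancelling I^(1 - 1/r) is exactly
        1/R.\<close>
      have "1 / q = 1 / R + (1 - 1 / r)"
        using N2 r1 by (simp add: q_def R(2) field_simps)
      then have "?I powr (1 - 1 / r) * ?I powr (1 / R) \<le> ?I powr (1 - 1 / r) * (\<sigma> * ?G powr (1 / r))"
        using main by (simp add: powr_add mult_ac)
      then show ?thesis using Ip by (simp only: mult_le_cancel_left_pos powr_gt_zero)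
    qed (use \<sigma>1 in simp)
  qed
  then show ?thesis by (simp add: \<sigma>_def R_def)
qed

text \<open>Quantifying over bounded nonnegative functions, the form in which powers and truncations
  of approximating solutions occur, keeps the left-hand side a genuine integral for positive q and
  not the default value 0.\<close>

definition embeds :: "real \<Rightarrow> real \<Rightarrow> bool" where
  "embeds q C \<longleftrightarrow> (\<forall>V\<in>X. \<forall>B. (AE x in M. 0 \<le> fst (V x) \<and> fst (V x) \<le> B) \<longrightarrow>
     (LINT x|M. fst (V x) powr q) powr (1 / q) \<le> C * energy (\<lambda>x. snd (V x)) powr (1 / p))"

lemma Sobolev_embedding:
  assumes dim: "DIM('a) \<ge> 2" and s: "0 < s" "integrable M (\<lambda>x. w x powr (- s))"
    and r: "1 \<le> p_sub p s" "p_sub p s < real DIM('a)"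
  shows "\<exists>C>0. embeds (sobolev_exp (real DIM('a)) (p_sub p s)) C"
proof -
  let ?N = "real DIM('a)" and ?r = "p_sub p s"
  let ?W = "(LINT x|M. w x powr (- s)) powr (1 / (p * s))"
  let ?C = "?r * (?N - 1) / (?N - ?r) * ?W"
  have c0: "0 \<le> ?r * (?N - 1) / (?N - ?r)" using r dim by (intro divide_nonneg_nonneg mult_nonneg_nonneg) auto
  \<comment> \<open>Adding 1 makes the constant positive even if the weight integral is 0.\<close>
  have "embeds (sobolev_exp ?N ?r) (?C + 1)"
    unfolding embeds_def
  proof (intro ballI allI impI)
    fix V B assume V: "V \<in> X" and bd: "AE x in M. 0 \<le> fst (V x) \<and> fst (V x) \<le> B"
    let ?E = "energy (\<lambda>x. snd (V x))"
    note g = gradient_Lr[OF s X_snd_Lpw[OF V]]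
    have "(LINT x|M. fst (V x) powr sobolev_exp ?N ?r) powr (1 / sobolev_exp ?N ?r)
        \<le> ?r * (?N - 1) / (?N - ?r) * (LINT x|M. norm (snd (V x)) powr ?r) powr (1 / ?r)"
      by (rule Sobolev_X[OF V bd dim r g(1)])
    also have "\<dots> \<le> ?r * (?N - 1) / (?N - ?r) * (?E powr (1 / p) * ?W)"
      by (rule mult_left_mono[OF g(2) c0])
    also have "\<dots> \<le> (?C + 1) * ?E powr (1 / p)" by (simp add: algebra_simps)
    finally show "(LINT x|M. fst (V x) powr sobolev_exp ?N ?r) powr (1 / sobolev_exp ?N ?r) \<le> (?C + 1) * ?E powr (1 / p)" .
  qed
  moreover have "0 < ?C + 1" using mult_nonneg_nonneg[OF c0, of ?W] by simp
  ultimately show ?thesis by blast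
qed

text \<open>The critical case \<open>p_s = N\<close> reduces to the subcritical one by lowering \<open>s\<close>.\<close>

lemma critical_embedding:
  assumes dim: "DIM('a) \<ge> 2" and s: "0 < s" "integrable M (\<lambda>x. w x powr (- s))"
    and r: "p_sub p s = real DIM('a)" and q: "p < q"
  shows "\<exists>C>0. embeds q C"
proof -
  let ?N = "real DIM('a)"
  \<comment> \<open>Solves N r'/(N - r') = q for r', and then p s'/(s' + 1) = r' for s'.\<close>
  define r' where "r' = ?N * q / (?N + q)"
  define s' where "s' = r' / (p - r')"
  have N2: "2 \<le> ?N" using dim by simp
  have ps: "?N < p"
  proof -
    have "p_sub p s < p" using s(1) p_gt_1 by (simp add: p_sub_def field_simps)
    then show ?thesis using r by simp
  qed
  have q2: "2 < q" "0 < q" using q ps N2 by linarith+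
  have r': "1 \<le> r'" "r' < ?N"
  proof -
    have "1 \<le> (?N - 1) * (q - 1)" using mult_mono[of 1 "?N - 1" 1 "q - 1"] N2 q2 by simp
    then have "?N + q \<le> ?N * q" by (simp add: algebra_simps)
    then show "1 \<le> r'" using N2 q2 by (simp add: r'_def)
    show "r' < ?N" using N2 q2 by (simp add: r'_def field_simps)
  qed
  have s'0: "0 < s'" using r' ps by (simp add: s'_def)
  have s'r: "p_sub p s' = r'"
  proof -
    have "s' + 1 = p / (p - r')" using r' ps by (simp add: s'_def field_simps)
    then show ?thesis using r' ps by (simp add: p_sub_def) (simp add: s'_def)
  qed
  have "s' \<le> s"
  proof (rule ccontr)
    assume "\<not> s' \<le> s"
    then have "p_sub p s \<le> p_sub p s'"
      using s p_gt_1 by (simp add: p_sub_def field_simps)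
    then show False using r s'r r' by simp
  qed
  have "integrable M (\<lambda>x. w x powr (- s'))"
  proof (rule Bochner_Integration.integrable_bound)
    show "integrable M (\<lambda>x. 1 + w x powr (- s))" using s(2) by simp
    show "AE x in M. norm (w x powr (- s')) \<le> norm (1 + w x powr (- s))"
      using weight_pos
    proof eventually_elim
      fix x assume wx: "0 < w x"
      \<comment> \<open>Where w is at least 1 the left-hand side is at most 1; where w is below 1
        the larger exponent s gives the larger value.\<close>
      have "w x powr (- s') \<le> 1 + w x powr (- s)"
      proof (cases "1 \<le> w x")
        case True
        then have "w x powr (- s') \<le> w x powr 0" using s'0 by (intro powr_mono) auto
        then show ?thesis using wx by (simp add: add_increasing2)
      next
        case False
        then have "w x powr (- s') \<le> w x powr (- s)" using wx \<open>s' \<le> s\<close> by (intro powr_mono') auto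
        then show ?thesis by simp
      qed
      then show "norm (w x powr (- s')) \<le> norm (1 + w x powr (- s))" by simp
    qed
  qed measurable
  from Sobolev_embedding[OF dim s'0 this] s'r r'
  have "\<exists>C>0. embeds (sobolev_exp ?N r') C" by simp
  moreover have "sobolev_exp ?N r' = q"
  proof -
    have "?N - r' = ?N * ?N / (?N + q)" using N2 q2 by (simp add: r'_def field_simps)
    then show ?thesis using N2 q2 by (simp add: sobolev_exp_def r'_def)
  qed
  ultimately show ?thesis by simp
qed

text \<open>Chebyshev's inequality: the truncation m exceeds h - k wherever v exceeds h.\<close>

lemma level_set_inequality:
  assumes m: "m \<in> borel_measurable M" and v: "v \<in> borel_measurable M" and q: "0 < q" and kh: "k < h"
    and meq: "\<And>x. m x = max 0 (v x - k)" and i: "integrable M (\<lambda>x. m x powr q)"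
  shows "(h - k) powr q * measure M {x \<in> \<Omega>. h < v x} \<le> (LINT x|M. m x powr q)"
proof -
  note S = superlevel_set[OF v, of h]
  have "(h - k) powr q * measure M {x \<in> \<Omega>. h < v x} = (LINT x|M. (h - k) powr q * indicator {x \<in> \<Omega>. h < v x} x)"
    using S(3) by simp
  also have "\<dots> \<le> (LINT x|M. m x powr q)"
  proof (rule integral_mono[OF _ i])
    show "integrable M (\<lambda>x. (h - k) powr q * indicator {x \<in> \<Omega>. h < v x} x)" using S(2) by simp
    show "(h - k) powr q * indicator {x \<in> \<Omega>. h < v x} x \<le> m x powr q" for x
      using kh q by (auto simp: indicator_def meq intro!: powr_mono2)
  qed
  finally show ?thesis .
qed

lemma AE_le_of_measure_0:
  fixes v :: "'a \<Rightarrow> real"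
  assumes "v \<in> borel_measurable M" "measure M {x \<in> \<Omega>. h < v x} = 0"
  shows "AE x in M. v x \<le> h"
proof -
  have "{x \<in> \<Omega>. h < v x} \<in> null_sets M"
    using assms superlevel_set(1)[OF assms(1)] by (intro null_setsI) (auto simp: emeasure_eq_measure)
  then show ?thesis by (rule AE_I') auto
qed

text \<open>The gradient of (V - k)^+ lives on the set where V > k, so Gagliardo-Nirenberg and
  Hoelder bound the measure at level h by a power \<beta> = q (1 - 1/r) of the measure at level k,
  and \<beta> > 1 says precisely r > N. The bound is linear in the size T of the gradient, which
  later closes the energy estimate for f in L^1. T is a positive upper bound because Stampacchia
  needs a positive constant and the energy may vanish.\<close>

lemma supercritical_embedding:
  assumes dim: "DIM('a) \<ge> 2" and s: "0 < s" "integrable M (\<lambda>x. w x powr (- s))"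
    and r: "real DIM('a) < p_sub p s"
  shows "\<exists>K>0. \<forall>V\<in>X. \<forall>B T. (AE x in M. 0 \<le> fst (V x) \<and> fst (V x) \<le> B) \<and> 0 < T \<and>
    energy (\<lambda>x. snd (V x)) powr (1 / p) \<le> T \<longrightarrow> (AE x in M. fst (V x) \<le> K * T)"
proof -
  let ?N = "real DIM('a)" and ?r = "p_sub p s"
  define q where "q = ?N / (?N - 1)"
  define \<beta> where "\<beta> = q * (1 - 1 / ?r)"
  \<comment> \<open>The added 1 here and in \<Psi> only secures positivity.\<close>
  define W where "W = (LINT x|M. w x powr (- s)) powr (1 / (p * s)) + 1"
  define \<Psi> where "\<Psi> = measure M (space M) + 1"
  define K where "K = W * (\<Psi> powr (\<beta> - 1) * 2 powr (q * \<beta> / (\<beta> - 1))) powr (1 / q)"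
  have N2: "2 \<le> ?N" "2 < ?r" using dim r by auto
  have q: "0 < q" using N2 by (simp add: q_def)
  have W0: "0 < W" using powr_ge_zero[of "LINT x|M. w x powr (- s)" "1 / (p * s)"] by (simp add: W_def add_pos_nonneg del: powr_ge_zero)
  have \<beta>: "1 < \<beta>" 
  proof -
    have "?N / ?r < 1" using r N2 by simp
    then have "?N - 1 < ?N * (1 - 1 / ?r)" by (simp add: algebra_simps)
    then show ?thesis using N2 by (simp add: \<beta>_def q_def)
  qed
  have \<Psi>: "0 < \<Psi>" by (simp add: \<Psi>_def add_nonneg_pos)
  have K: "0 < K" using W0 \<Psi> by (simp add: K_def)
  have main: "AE x in M. fst (V x) \<le> K * T"
    if V: "V \<in> X" and bd: "AE x in M. 0 \<le> fst (V x) \<and> fst (V x) \<le> B" and T: "0 < T"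
      "energy (\<lambda>x. snd (V x)) powr (1 / p) \<le> T" for V B T
  proof -
    note vm[measurable] = X_fst_snd_measurable[OF LpwD(1)[OF X_LpwD[OF V]]]
    note g = gradient_Lr[OF s X_snd_Lpw[OF V]]
    let ?G = "LINT x|M. norm (snd (V x)) powr ?r"
    define \<psi> where "\<psi> k = measure M {x \<in> \<Omega>. k < fst (V x)}" for k
    have G: "?G powr (1 / ?r) \<le> T * W"
    proof -
      have "?G powr (1 / ?r) \<le> T * (LINT x|M. w x powr (- s)) powr (1 / (p * s))"
        using g(2) mult_right_mono[OF T(2), of "(LINT x|M. w x powr (- s)) powr (1 / (p * s))"] by simp
      also have "\<dots> \<le> T * W" using T by (intro mult_left_mono) (auto simp: W_def)
      finally show ?thesis .
    qed
    have TW: "0 < T * W" using T W0 by simp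
    have "\<psi> (0 + ((T * W) powr q * \<Psi> powr (\<beta> - 1) * 2 powr (q * \<beta> / (\<beta> - 1))) powr (1 / q)) = 0"
    proof (rule Stampacchia[OF _ _ _ q \<beta> _ \<Psi>])
      show "\<psi> h \<le> \<psi> k" if "k \<le> h" for k h
        unfolding \<psi>_def using that superlevel_set(1)[OF vm(1)] by (intro finite_measure_mono) auto
      show "0 \<le> \<psi> k" for k by (simp add: \<psi>_def)
      show "0 < (T * W) powr q" using TW by (simp only: powr_gt_zero)
      show "\<psi> 0 \<le> \<Psi>" unfolding \<psi>_def \<Psi>_def using bounded_measure[of "{x \<in> \<Omega>. 0 < fst (V x)}"] by linarith
      fix k h :: real assume k: "0 \<le> k" "k < h"
      let ?U = "\<lambda>x. (max 0 (fst (V x) - k), if k < fst (V x) then snd (V x) else 0)"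
      have U: "?U \<in> X" by (rule X_pos_part[OF V bd k(1)])
      let ?S = "{x \<in> \<Omega>. k < fst (V x)}"
      note S = superlevel_set[OF vm(1), of k]
      have a: "0 \<le> 1 / ?r" "0 \<le> 1 - 1 / ?r" "1 / ?r + (1 - 1 / ?r) = 1" using N2 by auto
      have nn: "AE x in M. 0 \<le> norm (snd (V x)) powr ?r" "AE x in M. 0 \<le> (indicator ?S x :: real)" by auto
      note H = Hoelder_2[OF a g(1) S(2) nn]
      \<comment> \<open>Inserting the indicator of the level set changes nothing and lets Hoelder
        trade integrability of the gradient for a power of the measure of the set.\<close>
      have "(LINT x|M. norm (snd (?U x))) = (LINT x|M. (norm (snd (V x)) powr ?r) powr (1 / ?r) * indicator ?S x powr (1 - 1 / ?r))"
        using N2 by (intro Bochner_Integration.integral_cong) (auto simp: indicator_def powr_powr)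
      also have "\<dots> \<le> ?G powr (1 / ?r) * \<psi> k powr (1 - 1 / ?r)" using H(2) unfolding S(3) \<psi>_def .
      also have "\<dots> \<le> T * W * \<psi> k powr (1 - 1 / ?r)" using G by (rule mult_right_mono) simp
      finally have gr: "(LINT x|M. norm (snd (?U x))) \<le> T * W * \<psi> k powr (1 - 1 / ?r)" .
      have "(h - k) powr q * \<psi> h \<le> (LINT x|M. max 0 (fst (V x) - k) powr q)"
        unfolding \<psi>_def
      proof (rule level_set_inequality[OF _ vm(1) q k(2)])
        show "integrable M (\<lambda>x. max 0 (fst (V x) - k) powr q)"
          using Gagliardo_Nirenberg_X(1)[OF U dim] by (simp add: q_def)
      qed auto
      also have "\<dots> \<le> (LINT x|M. norm (snd (?U x))) powr q"
        using Gagliardo_Nirenberg_X(2)[OF U dim] by (simp add: q_def)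
      also have "\<dots> \<le> (T * W * \<psi> k powr (1 - 1 / ?r)) powr q"
        using gr q by (intro powr_mono2) auto
      also have "\<dots> = (T * W) powr q * \<psi> k powr \<beta>"
        using TW by (simp add: powr_mult powr_powr \<beta>_def mult.commute)
      finally show "(h - k) powr q * \<psi> h \<le> (T * W) powr q * \<psi> k powr \<beta>" .
    qed
    moreover have "((T * W) powr q * \<Psi> powr (\<beta> - 1) * 2 powr (q * \<beta> / (\<beta> - 1))) powr (1 / q) = K * T"
      using TW q T W0 by (simp add: K_def powr_mult powr_powr)
    ultimately show ?thesis
      by (intro AE_le_of_measure_0 vm(1)) (simp add: \<psi>_def)
  qed
  show ?thesis using K main by blast
qed

end

subsection \<open>A priori estimates\<close>

abbreviation source :: "real \<Rightarrow> ('a \<Rightarrow> real) \<Rightarrow> nat \<Rightarrow> ('a \<Rightarrow> real) \<Rightarrow> 'a \<Rightarrow> real" where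
  "source \<delta> f n v x \<equiv> min (f x) (real n) / (v x + 1 / real n) powr \<delta>"

lemma source_le:
  assumes "0 \<le> f x" "0 < v x" "0 < \<delta>" "1 \<le> n"
  shows "source \<delta> f n v x \<le> f x / v x powr \<delta>"
  using assms by (intro frac_le powr_mono2) auto

text \<open>Divide by the lower power of I and take a root. The a priori estimates use this to turn
  a bound of a quantity by a smaller power of itself into a fixed bound.\<close>

lemma powr_absorb:
  fixes I D a b :: real
  assumes "I powr a \<le> D * I powr b" "b < a" "0 \<le> I" "0 \<le> D"
  shows "I \<le> D powr (1 / (a - b))"
proof (cases "I = 0")
  case False
  then have I: "0 < I" using assms by simp
  have "I powr b * I powr (a - b) \<le> I powr b * D"
    using assms(1) I by (simp add: powr_add[symmetric] mult.commute)
  then have "I powr (a - b) \<le> D" using I by (simp only: mult_le_cancel_left_pos powr_gt_zero)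
  then have "(I powr (a - b)) powr (1 / (a - b)) \<le> D powr (1 / (a - b))"
    using assms by (intro powr_mono2) auto
  then show ?thesis using assms I by (simp add: powr_powr)
qed (use assms in simp)

context weighted_domain
begin

lemma X_power:
  assumes V: "V \<in> X" and bd: "AE x in M. 0 < fst (V x) \<and> fst (V x) \<le> B" and \<beta>: "1 \<le> \<beta>"
  shows "(\<lambda>x. (fst (V x) powr \<beta>, (\<beta> * fst (V x) powr (\<beta> - 1)) *\<^sub>R snd (V x))) \<in> X" (is "?U \<in> X")
proof -
  note vm[measurable] = X_fst_snd_measurable[OF LpwD(1)[OF X_LpwD[OF V]]]
  have m: "?U \<in> borel_measurable M" by measurable
  show ?thesis
  proof (cases "\<beta> = 1")
    \<comment> \<open>The power rule needs \<beta> > 1: for \<beta> = 1 the factor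
      \<open>0 powr 0\<close> = 0 would make the derivative discontinuous. Positivity of V almost
      everywhere makes the pair V itself.\<close>
    case True
    then show ?thesis
      using bd by (intro X_cong_AE[OF V m]) (auto simp: prod_eq_iff elim: eventually_mono)
  next
    case False
    then have \<beta>1: "1 < \<beta>" using \<beta> by simp
    have "AE x in M. 0 \<le> fst (V x) \<and> fst (V x) \<le> B" using bd by (auto elim: eventually_mono)
    note W = X_pos_part_power[OF V this \<beta>1 order_refl]
    have "AE x in M. ?U x = (max 0 (fst (V x) - 0) powr \<beta>, (\<beta> * max 0 (fst (V x) - 0) powr (\<beta> - 1)) *\<^sub>R snd (V x))"
      using bd by eventually_elim simp
    then show ?thesis by (rule X_cong_AE[OF W m])
  qed
qed

text \<open>The test function H has gradient h grad v. Because h is nonnegative, the degeneracy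
  condition may be multiplied by it; its bound L makes the resulting left-hand side
  integrable.\<close>

lemma test_inequality:
  assumes A: "structure_conditions \<Omega> p w A" and v: "approx_solution \<Omega> p w A \<delta> f n v"
    and U: "(\<lambda>x. (H x, h x *\<^sub>R weak_gradient \<Omega> v x)) \<in> X"
    and h: "h \<in> borel_measurable M" "AE x in M. 0 \<le> h x \<and> h x \<le> L"
  shows "integrable M (\<lambda>x. source \<delta> f n v x * H x)"
    "integrable M (\<lambda>x. h x * (norm (weak_gradient \<Omega> v x) powr p * w x))"
    "(LINT x|M. h x * (norm (weak_gradient \<Omega> v x) powr p * w x))
      \<le> (LINT x|M. source \<delta> f n v x * H x)"
proof -
  have vW: "v \<in> W1p_0 \<Omega> p w" using v by (simp add: approx_solution_def)
  have H: "H \<in> W1p_0 \<Omega> p w" "AE x in M. weak_gradient \<Omega> H x = h x *\<^sub>R weak_gradient \<Omega> v x"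
    by (rule X_imp_W1p_0[OF U])+
  have *: "integrable M (\<lambda>x. A x (weak_gradient \<Omega> v x) \<bullet> weak_gradient \<Omega> H x)"
    "integrable M (\<lambda>x. source \<delta> f n v x * H x)"
    "(LINT x|M. A x (weak_gradient \<Omega> v x) \<bullet> weak_gradient \<Omega> H x) =
     (LINT x|M. source \<delta> f n v x * H x)"
    using v H(1) by (auto simp: approx_solution_def)
  show "integrable M (\<lambda>x. source \<delta> f n v x * H x)" by (rule *)
  have "(\<lambda>x. weak_gradient \<Omega> v x) \<in> Lpw" using X_snd_Lpw[OF W1p_0_imp_X[OF vW]] by simp
  note gL = LpwD[OF this]
  show i: "integrable M (\<lambda>x. h x * (norm (weak_gradient \<Omega> v x) powr p * w x))"
  proof (rule Bochner_Integration.integrable_bound)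
    show "integrable M (\<lambda>x. L * (norm (weak_gradient \<Omega> v x) powr p * w x))" using gL(2) by simp
    show "(\<lambda>x. h x * (norm (weak_gradient \<Omega> v x) powr p * w x)) \<in> borel_measurable M"
      using h(1) gL(1) by measurable
    show "AE x in M. norm (h x * (norm (weak_gradient \<Omega> v x) powr p * w x)) \<le> norm (L * (norm (weak_gradient \<Omega> v x) powr p * w x))"
      using h(2) by eventually_elim (auto simp: abs_mult intro!: mult_right_mono)
  qed
  have "AE x in M. \<forall>\<zeta>. A x \<zeta> \<bullet> \<zeta> \<ge> norm \<zeta> powr p * w x"
    using A by (simp add: structure_conditions_def)
  then have "AE x in M. h x * (norm (weak_gradient \<Omega> v x) powr p * w x) \<le> A x (weak_gradient \<Omega> v x) \<bullet> weak_gradient \<Omega> H x"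
    using H(2) h(2) by eventually_elim (auto intro!: mult_left_mono)
  then have "(LINT x|M. h x * (norm (weak_gradient \<Omega> v x) powr p * w x)) \<le> (LINT x|M. A x (weak_gradient \<Omega> v x) \<bullet> weak_gradient \<Omega> H x)"
    by (rule integral_mono_AE[OF i *(1)])
  then show "(LINT x|M. h x * (norm (weak_gradient \<Omega> v x) powr p * w x))
      \<le> (LINT x|M. source \<delta> f n v x * H x)" by (simp only: *(3))
qed

lemma approx_solution_X:
  assumes "approx_solution \<Omega> p w A \<delta> f n v"
  shows "(\<lambda>x. (v x, weak_gradient \<Omega> v x)) \<in> X" "v \<in> borel_measurable M"
    "\<exists>B. AE x in M. 0 < v x \<and> v x \<le> B"
proof -
  show "(\<lambda>x. (v x, weak_gradient \<Omega> v x)) \<in> X"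
    using assms by (intro W1p_0_imp_X) (simp add: approx_solution_def)
  show "v \<in> borel_measurable M" using assms by (auto simp: approx_solution_def Linfinity_def)
  obtain B where "AE x in M. \<bar>v x\<bar> \<le> B" using assms by (auto simp: approx_solution_def Linfinity_def)
  moreover have "AE x in M. 0 < v x" using assms by (simp add: approx_solution_def)
  ultimately have "AE x in M. 0 < v x \<and> v x \<le> B" by eventually_elim auto
  then show "\<exists>B. AE x in M. 0 < v x \<and> v x \<le> B" by blast
qed

text \<open>With E the integral of v^(\<beta> - 1) |grad v|^p w and R that of the source times
  v^\<beta>, the chain is I^(p/q) \<le> C^p \<gamma>^p E, E \<le> R and R \<le> F I^(1/m'). No
  constant depends on n. The exponent q is left open to serve the Sobolev exponent and the free
  exponent of the critical case alike.\<close>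

lemma Lt_estimate:
  assumes A: "structure_conditions \<Omega> p w A" and \<delta>: "0 < \<delta>" "\<delta> < 1"
    and emb: "embeds q C" "0 < C" and q: "p < q"
    and m: "conj_exp (q / (1 - \<delta>)) \<le> m" "m < q / (q - p)"
    and f: "f \<in> Lp \<Omega> m" "AE x in M. 0 \<le> f x"
  shows "0 < q * gain \<delta> p m q"
    "\<exists>K. \<forall>n\<ge>1. \<forall>v. approx_solution \<Omega> p w A \<delta> f n v \<longrightarrow> (LINT x|M. v x powr (q * gain \<delta> p m q)) \<le> K"
proof -
  define m' where "m' = conj_exp m"
  define \<gamma> where "\<gamma> = gain \<delta> p m q"
  define \<beta> where "\<beta> = p * (\<gamma> - 1) + 1"
  define F where "F = (LINT x|M. \<bar>f x\<bar> powr m) powr (1 / m)"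
  define D where "D = C powr p * \<gamma> powr p * F"
  have q1: "1 < q" "0 < q" using q p_gt_1 by auto
  have ce: "conj_exp (q / (1 - \<delta>)) = q / (q - (1 - \<delta>))"
  proof -
    have "q / (1 - \<delta>) - 1 = (q - (1 - \<delta>)) / (1 - \<delta>)" using \<delta> by (simp add: diff_divide_distrib)
    then show ?thesis using \<delta> by (simp add: conj_exp_def)
  qed
  have m1: "1 < m"
  proof -
    have "1 < q / (q - (1 - \<delta>))" using \<delta> q1 by (simp add: field_simps)
    then show ?thesis using m(1) ce by linarith
  qed
  have m': "m' = m / (m - 1)" "1 / m + 1 / m' = 1" "0 < m'"
    using m1 by (auto simp: m'_def conj_exp_def field_simps)
  \<comment> \<open>The upper bound on m, rewritten: it makes the denominator of \<open>gain\<close>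
    positive and the final absorption possible.\<close>
  have pm: "q < p * m'"
  proof -
    have "m * (q - p) < q" using m(2) q by (simp add: field_simps)
    then have "q * (m - 1) < p * m" by (simp add: algebra_simps)
    then show ?thesis using m1 by (simp add: m'(1) field_simps)
  qed
  \<comment> \<open>The lower bound on m, rewritten: it gives \<gamma> \<ge> 1.\<close>
  have qm: "(1 - \<delta>) * m' \<le> q"
  proof -
    have "q / (q - (1 - \<delta>)) \<le> m" using m(1) ce by simp
    then have "q \<le> m * (q - (1 - \<delta>))" using \<delta> q1 by (simp add: field_simps)
    then have "(1 - \<delta>) * m \<le> q * (m - 1)" by (simp add: algebra_simps)
    then show ?thesis using m1 by (simp add: m'(1) field_simps)
  qed
  have \<gamma>: "\<gamma> * (p * m' - q) = (\<delta> + p - 1) * m'" using pm by (simp add: \<gamma>_def gain_def m'_def)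
  have \<gamma>1: "1 \<le> \<gamma>"
  proof -
    have "p * m' - q \<le> (\<delta> + p - 1) * m'" using qm by (simp add: algebra_simps)
    then show ?thesis using pm by (simp add: \<gamma>_def gain_def m'_def[symmetric])
  qed
  have \<beta>1: "1 \<le> \<beta>" using \<gamma>1 p_gt_1 by (simp add: \<beta>_def)
  \<comment> \<open>The equation that determines \<gamma>: Hoelder turns f v^(\<beta> - \<delta>)
    into the same integral I that the embedding produces.\<close>
  have exps: "q * \<gamma> * (1 / m') = \<beta> - \<delta>"
  proof -
    have "q * \<gamma> = m' * (\<beta> - \<delta>)" using \<gamma> by (simp add: \<beta>_def algebra_simps)
    then show ?thesis using m'(3) by simp
  qed
  show "0 < q * gain \<delta> p m q" using q1 \<gamma>1 by (simp add: \<gamma>_def)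
  have fm: "f \<in> borel_measurable M" "integrable M (\<lambda>x. \<bar>f x\<bar> powr m)" using f by (auto simp: Lp_def)
  have F0: "0 \<le> F" by (simp add: F_def)
  have D0: "0 \<le> D" by (simp add: D_def F0)
  have "(LINT x|M. v x powr (q * \<gamma>)) \<le> D powr (1 / (p / q - 1 / m'))"
    if n: "1 \<le> n" and v: "approx_solution \<Omega> p w A \<delta> f n v" for n v
  proof -
    note vX = approx_solution_X[OF v]
    obtain B where B: "AE x in M. 0 < v x \<and> v x \<le> B" using vX(3) by blast
    have B': "AE x in M. 0 \<le> v x \<and> v x \<le> B" using B by (auto elim: eventually_mono)
    note vm[measurable] = vX(2)
    let ?g = "weak_gradient \<Omega> v"
    let ?E = "LINT x|M. v x powr (\<beta> - 1) * (norm (?g x) powr p * w x)"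
    let ?I = "LINT x|M. v x powr (q * \<gamma>)"
    let ?R = "LINT x|M. source \<delta> f n v x * v x powr \<beta>"
    have U\<beta>: "(\<lambda>x. (v x powr \<beta>, (\<beta> * v x powr (\<beta> - 1)) *\<^sub>R ?g x)) \<in> X"
      using X_power[OF vX(1), of B \<beta>] B \<beta>1 by simp
    have U\<gamma>: "(\<lambda>x. (v x powr \<gamma>, (\<gamma> * v x powr (\<gamma> - 1)) *\<^sub>R ?g x)) \<in> X"
      using X_power[OF vX(1), of B \<gamma>] B \<gamma>1 by simp
    have hb: "AE x in M. 0 \<le> \<beta> * v x powr (\<beta> - 1) \<and> \<beta> * v x powr (\<beta> - 1) \<le> \<beta> * B powr (\<beta> - 1)"
      using B by eventually_elim (use \<beta>1 in \<open>auto intro!: powr_mono2\<close>)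
    have hm: "(\<lambda>x. \<beta> * v x powr (\<beta> - 1)) \<in> borel_measurable M" by measurable
    note T = test_inequality[OF A v U\<beta> hm hb]
    \<comment> \<open>Differentiating v^\<beta> yields a factor \<beta> \<ge> 1 on the left, which
      is dropped.\<close>
    have ER: "?E \<le> ?R"
    proof -
      have "(LINT x|M. \<beta> * v x powr (\<beta> - 1) * (norm (?g x) powr p * w x)) = \<beta> * ?E"
        by (simp add: mult.assoc)
      moreover have "0 \<le> ?E" using weight_pos by (intro integral_nonneg_AE) (auto elim: eventually_mono)
      then have "1 * ?E \<le> \<beta> * ?E" using \<beta>1 by (rule mult_right_mono[rotated])
      ultimately show ?thesis using T(3) by linarith
    qed
    have Ii: "integrable M (\<lambda>x. v x powr (q * \<gamma>))"
      using q1 \<gamma>1 by (intro bounded_powr_integrable[OF vm B']) simp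
    have a: "0 \<le> 1 / m" "0 \<le> 1 / m'" "1 / m + 1 / m' = 1" using m1 m' by auto
    have nn: "AE x in M. 0 \<le> \<bar>f x\<bar> powr m" "AE x in M. 0 \<le> v x powr (q * \<gamma>)" by auto
    note Ho = Hoelder_2[OF a fm(2) Ii nn]
    have "?R \<le> (LINT x|M. (\<bar>f x\<bar> powr m) powr (1 / m) * (v x powr (q * \<gamma>)) powr (1 / m'))"
    proof (rule integral_mono_AE[OF T(1) Ho(1)])
      show "AE x in M. source \<delta> f n v x * v x powr \<beta>
          \<le> (\<bar>f x\<bar> powr m) powr (1 / m) * (v x powr (q * \<gamma>)) powr (1 / m')"
        using f(2) B
      proof eventually_elim
        fix x assume x: "0 \<le> f x" "0 < v x \<and> v x \<le> B"
        have "source \<delta> f n v x * v x powr \<beta> \<le> f x / v x powr \<delta> * v x powr \<beta>"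
          using source_le[of f x v \<delta> n] x \<delta> n by (intro mult_right_mono) auto
        also have "\<dots> = f x * v x powr (\<beta> - \<delta>)" using x by (simp add: powr_diff)
        also have "\<dots> = (\<bar>f x\<bar> powr m) powr (1 / m) * (v x powr (q * \<gamma>)) powr (1 / m')"
          using x m1 by (simp only: powr_powr exps) simp
        finally show "source \<delta> f n v x * v x powr \<beta>
          \<le> (\<bar>f x\<bar> powr m) powr (1 / m) * (v x powr (q * \<gamma>)) powr (1 / m')" .
      qed
    qed
    then have RF: "?R \<le> F * ?I powr (1 / m')" using Ho(2) by (simp add: F_def)
    have bd\<gamma>: "AE x in M. 0 \<le> fst (v x powr \<gamma>, (\<gamma> * v x powr (\<gamma> - 1)) *\<^sub>R ?g x) \<and>
        fst (v x powr \<gamma>, (\<gamma> * v x powr (\<gamma> - 1)) *\<^sub>R ?g x) \<le> B powr \<gamma>"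
      using B by eventually_elim (use \<gamma>1 in \<open>auto intro!: powr_mono2\<close>)
    \<comment> \<open>Here p (\<gamma> - 1) = \<beta> - 1 identifies the energy of v^\<gamma> with
      the quantity controlled by testing with v^\<beta>.\<close>
    have en: "energy (\<lambda>x. (\<gamma> * v x powr (\<gamma> - 1)) *\<^sub>R ?g x) = \<gamma> powr p * ?E"
    proof -
      have "norm ((\<gamma> * v x powr (\<gamma> - 1)) *\<^sub>R ?g x) powr p * w x = \<gamma> powr p * (v x powr (\<beta> - 1) * (norm (?g x) powr p * w x))" for x
        using \<gamma>1 by (simp add: powr_mult powr_powr \<beta>_def mult_ac)
      then show ?thesis by (simp only: Bochner_Integration.integral_mult_right_zero)
    qed
    have "(LINT x|M. (v x powr \<gamma>) powr q) powr (1 / q) \<le> C * (\<gamma> powr p * ?E) powr (1 / p)"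
      using emb(1)[unfolded embeds_def, rule_format, OF U\<gamma> bd\<gamma>] by (simp only: fst_conv snd_conv en)
    then have "?I powr (1 / q) \<le> C * (\<gamma> powr p * ?E) powr (1 / p)"
      by (simp add: powr_powr mult.commute)
    then have "(?I powr (1 / q)) powr p \<le> (C * (\<gamma> powr p * ?E) powr (1 / p)) powr p"
      using p_gt_1 by (intro powr_mono2) auto
    also have "\<dots> = C powr p * (\<gamma> powr p * ?E)"
    proof -
      have "0 \<le> ?E" using weight_pos by (intro integral_nonneg_AE) (auto elim: eventually_mono)
      then show ?thesis using emb(2) p_gt_1 \<gamma>1 by (simp add: powr_mult powr_powr)
    qed
    also have "\<dots> \<le> C powr p * (\<gamma> powr p * (F * ?I powr (1 / m')))"
      using ER RF by (intro mult_left_mono) auto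
    finally have "?I powr (p / q) \<le> D * ?I powr (1 / m')"
      by (simp add: powr_powr D_def mult_ac)
    \<comment> \<open>The power of I on the right is the smaller one.\<close>
    moreover have "1 / m' < p / q" using pm m'(3) q1 by (simp add: field_simps)
    ultimately show ?thesis by (rule powr_absorb) (auto simp: D0)
  qed
  then show "\<exists>K. \<forall>n\<ge>1. \<forall>v. approx_solution \<Omega> p w A \<delta> f n v \<longrightarrow> (LINT x|M. v x powr (q * gain \<delta> p m q)) \<le> K"
    unfolding \<gamma>_def by blast
qed

text \<open>Levels start at 1, where the singular factor v^(-\<delta>) is at most 1. Hoelder with
  three factors puts f into L^m and the truncation into L^q and leaves the exponent c for the
  measure of the level set. Absorbing the truncation gives Stampacchia's recursion with exponent
  \<beta> = c q/(p - 1).\<close>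

lemma Linfinity_estimate:
  assumes A: "structure_conditions \<Omega> p w A" and \<delta>: "0 < \<delta>"
    and emb: "embeds q C" "0 < C" and q: "p < q"
    and m: "q / (q - p) < m"
    and f: "f \<in> Lp \<Omega> m" "AE x in M. 0 \<le> f x"
  shows "\<exists>K. \<forall>n\<ge>1. \<forall>v. approx_solution \<Omega> p w A \<delta> f n v \<longrightarrow> (AE x in M. v x \<le> K)"
proof -
  define F where "F = (LINT x|M. \<bar>f x\<bar> powr m) powr (1 / m)"
  define c where "c = 1 - 1 / m - 1 / q"
  define D where "D = C powr p * F + 1"
  define \<beta> where "\<beta> = c * q / (p - 1)"
  define \<Psi> where "\<Psi> = measure M (space M) + 1"
  define K where "K = 1 + (D powr (q / (p - 1)) * \<Psi> powr (\<beta> - 1) * 2 powr (q * \<beta> / (\<beta> - 1))) powr (1 / q)"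
  have q1: "1 < q" "0 < q" using q p_gt_1 by auto
  have m1: "1 < m"
  proof -
    have "1 < q / (q - p)" using q p_gt_1 by (simp add: field_simps)
    then show ?thesis using m by linarith
  qed
  have mq: "p < q * (1 - 1 / m)"
  proof -
    have "q < m * (q - p)" using m q by (simp add: field_simps)
    then show ?thesis using m1 by (simp add: field_simps)
  qed
  \<comment> \<open>Equivalent to q (1 - 1/m) > p, which is the assumed lower bound on m.\<close>
  have \<beta>: "1 < \<beta>"
  proof -
    have "p - 1 < c * q" using mq q1 by (simp add: c_def algebra_simps)
    then show ?thesis using p_gt_1 by (simp add: \<beta>_def)
  qed
  have c: "0 < c"
  proof -
    have "0 < c * q" using \<beta> p_gt_1 by (simp add: \<beta>_def field_simps)
    then show ?thesis using q1 by (simp add: zero_less_mult_iff)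
  qed
  have fm: "f \<in> borel_measurable M" "integrable M (\<lambda>x. \<bar>f x\<bar> powr m)" using f by (auto simp: Lp_def)
  have F0: "0 \<le> F" by (simp add: F_def)
  have D0: "0 < D" using F0 by (simp add: D_def add_nonneg_pos)
  have \<Psi>: "0 < \<Psi>" by (simp add: \<Psi>_def add_nonneg_pos)
  have "AE x in M. v x \<le> K" if n: "1 \<le> n" and v: "approx_solution \<Omega> p w A \<delta> f n v" for n v
  proof -
    note vX = approx_solution_X[OF v]
    obtain B where B: "AE x in M. 0 < v x \<and> v x \<le> B" using vX(3) by blast
    have B': "AE x in M. 0 \<le> fst (v x, weak_gradient \<Omega> v x) \<and> fst (v x, weak_gradient \<Omega> v x) \<le> B"
      using B by (auto elim: eventually_mono)
    note vm[measurable] = vX(2)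
    let ?g = "weak_gradient \<Omega> v"
    define \<psi> where "\<psi> k = measure M {x \<in> \<Omega>. k < v x}" for k
    have "\<psi> (1 + (D powr (q / (p - 1)) * \<Psi> powr (\<beta> - 1) * 2 powr (q * \<beta> / (\<beta> - 1))) powr (1 / q)) = 0"
    proof (rule Stampacchia[OF _ _ _ q1(2) \<beta> _ \<Psi>])
      show "\<psi> h \<le> \<psi> k" if "k \<le> h" for k h
        unfolding \<psi>_def using that superlevel_set(1)[OF vm] by (intro finite_measure_mono) auto
      show "0 \<le> \<psi> k" for k by (simp add: \<psi>_def)
      show "0 < D powr (q / (p - 1))" using D0 by simp
      show "\<psi> 1 \<le> \<Psi>" unfolding \<psi>_def \<Psi>_def using bounded_measure[of "{x \<in> \<Omega>. 1 < v x}"] by linarith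
      fix k h :: real assume k: "1 \<le> k" "k < h"
      let ?S = "{x \<in> \<Omega>. k < v x}"
      let ?H = "\<lambda>x. max 0 (v x - k)" and ?h = "\<lambda>x. if k < v x then 1 else 0 :: real"
      let ?I = "LINT x|M. ?H x powr q"
      let ?E = "LINT x|M. ?h x * (norm (?g x) powr p * w x)"
      let ?R = "LINT x|M. source \<delta> f n v x * ?H x"
      have U: "(\<lambda>x. (?H x, ?h x *\<^sub>R ?g x)) \<in> X"
      proof -
        have "(\<lambda>x. (?H x, if k < v x then ?g x else 0)) \<in> X"
          using X_pos_part[OF vX(1) B', of k] k by (simp cong: if_cong)
        moreover have "(if k < v x then ?g x else 0) = ?h x *\<^sub>R ?g x" for x by simp
        ultimately show ?thesis by simp
      qed
      have hm: "?h \<in> borel_measurable M" by measurable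
      have hb: "AE x in M. 0 \<le> ?h x \<and> ?h x \<le> 1" by auto
      note T = test_inequality[OF A v U hm hb]
      have bdH: "AE x in M. 0 \<le> ?H x \<and> ?H x \<le> max 0 B" using B by eventually_elim (use k in auto)
      have Hm: "?H \<in> borel_measurable M" by measurable
      have Ii: "integrable M (\<lambda>x. ?H x powr q)"
        using q1 by (intro bounded_powr_integrable[OF Hm bdH]) simp
      note S = superlevel_set[OF vm, of k]
      have a: "0 \<le> 1 / m" "0 \<le> 1 / q" "0 \<le> c" "1 / m + 1 / q + c = 1" using m1 q1 c by (auto simp: c_def)
      have nn: "AE x in M. 0 \<le> \<bar>f x\<bar> powr m" "AE x in M. 0 \<le> ?H x powr q" "AE x in M. 0 \<le> (indicator ?S x :: real)"
        by auto
      note Ho = Hoelder_3[OF a fm(2) Ii S(2) nn]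
      have "?R \<le> (LINT x|M. (\<bar>f x\<bar> powr m) powr (1 / m) * (?H x powr q) powr (1 / q) * indicator ?S x powr c)"
      proof (rule integral_mono_AE[OF T(1) Ho(1)])
        show "AE x in M. source \<delta> f n v x * ?H x
            \<le> (\<bar>f x\<bar> powr m) powr (1 / m) * (?H x powr q) powr (1 / q) * indicator ?S x powr c"
          using f(2) B AE_space
        proof eventually_elim
          fix x assume x: "0 \<le> f x" "0 < v x \<and> v x \<le> B" "x \<in> space M"
          show "source \<delta> f n v x * ?H x
            \<le> (\<bar>f x\<bar> powr m) powr (1 / m) * (?H x powr q) powr (1 / q) * indicator ?S x powr c"
          proof (cases "k < v x")
            case True
            \<comment> \<open>The only place where k \<ge> 1 enters: the singular denominator is at
              least 1.\<close>
            have "1 \<le> (v x + 1 / real n) powr \<delta>" using True k \<delta> n by (intro ge_one_powr_ge_zero) (auto intro: order_trans[of 1 "v x"])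
            then have "source \<delta> f n v x \<le> f x / 1"
              using x n by (intro frac_le) auto
            then have "source \<delta> f n v x * ?H x \<le> f x * ?H x"
              by (intro mult_right_mono) auto
            also have "\<dots> = (\<bar>f x\<bar> powr m) powr (1 / m) * (?H x powr q) powr (1 / q) * indicator ?S x powr c"
              using x True m1 q1 by (simp add: powr_powr)
            finally show ?thesis .
          qed (use k in simp)
        qed
      qed
      also have "\<dots> \<le> F * ?I powr (1 / q) * \<psi> k powr c"
        using Ho(2) unfolding S(3) by (simp add: F_def \<psi>_def)
      finally have RF: "?R \<le> F * ?I powr (1 / q) * \<psi> k powr c" .
      have en: "energy (\<lambda>x. ?h x *\<^sub>R ?g x) = ?E"
        using p_gt_1 by (intro Bochner_Integration.integral_cong) auto
      have E0: "0 \<le> ?E" using weight_pos by (intro integral_nonneg_AE) (auto elim: eventually_mono)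
      have "AE x in M. 0 \<le> fst (?H x, ?h x *\<^sub>R ?g x) \<and> fst (?H x, ?h x *\<^sub>R ?g x) \<le> max 0 B"
        using bdH by simp
      from emb(1)[unfolded embeds_def, rule_format, OF U this]
      have Y: "?I powr (1 / q) \<le> C * ?E powr (1 / p)" by (simp only: fst_conv snd_conv en)
      have "(?I powr (1 / q)) powr p \<le> (C * ?E powr (1 / p)) powr p"
        using Y p_gt_1 by (intro powr_mono2) auto
      also have "\<dots> = C powr p * ?E" using emb(2) p_gt_1 E0 by (simp add: powr_mult powr_powr)
      also have "\<dots> \<le> C powr p * (F * ?I powr (1 / q) * \<psi> k powr c)"
        using T(3) RF by (intro mult_left_mono) auto
      \<comment> \<open>The exponent 1 is written out so that \<open>powr_absorb\<close> can compare
        the powers p and 1 of the L^q norm of the truncation.\<close>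
      also have "\<dots> = (C powr p * F * \<psi> k powr c) * (?I powr (1 / q)) powr 1"
        by (simp add: mult_ac)
      also have "\<dots> \<le> (D * \<psi> k powr c) * (?I powr (1 / q)) powr 1"
        by (intro mult_right_mono) (auto simp: D_def)
      finally have "(?I powr (1 / q)) \<le> (D * \<psi> k powr c) powr (1 / (p - 1))"
        using p_gt_1 D0 by (intro powr_absorb) auto
      then have IY: "(?I powr (1 / q)) powr q \<le> ((D * \<psi> k powr c) powr (1 / (p - 1))) powr q"
        using q1 by (intro powr_mono2) auto
      have I0: "0 \<le> ?I" by simp
      have "(h - k) powr q * \<psi> h \<le> ?I"
        unfolding \<psi>_def by (rule level_set_inequality[OF Hm vm q1(2) k(2) _ Ii]) simp
      also have "?I = (?I powr (1 / q)) powr q" using q1 I0 by (simp add: powr_powr)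
      also note IY
      also have "((D * \<psi> k powr c) powr (1 / (p - 1))) powr q = D powr (q / (p - 1)) * \<psi> k powr \<beta>"
        using D0 by (simp add: powr_mult powr_powr \<beta>_def)
      finally show "(h - k) powr q * \<psi> h \<le> D powr (q / (p - 1)) * \<psi> k powr \<beta>" .
    qed
    then show ?thesis
      unfolding K_def by (intro AE_le_of_measure_0 vm) (simp add: \<psi>_def)
  qed
  then show ?thesis by blast
qed

text \<open>Let T be the p-th root of the energy. The embedding gives v \<le> K T, and testing with
  v itself gives T^p \<le> F (K T)^(1 - \<delta>), where F is the L^1 norm of f. Since 1 - \<delta>
  < p this bounds T, and then v, independently of n.\<close>

lemma Linfinity_estimate_supercritical:
  assumes A: "structure_conditions \<Omega> p w A" and \<delta>: "0 < \<delta>" "\<delta> < 1"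
    and dim: "DIM('a) \<ge> 2" and s: "0 < s" "integrable M (\<lambda>x. w x powr (- s))" "real DIM('a) < p_sub p s"
    and f: "f \<in> Lp \<Omega> 1" "AE x in M. 0 \<le> f x"
  shows "\<exists>K. \<forall>n\<ge>1. \<forall>v. approx_solution \<Omega> p w A \<delta> f n v \<longrightarrow> (AE x in M. v x \<le> K)"
proof -
  obtain K where K: "0 < K" "\<And>V B T. V \<in> X \<Longrightarrow> AE x in M. 0 \<le> fst (V x) \<and> fst (V x) \<le> B \<Longrightarrow> 0 < T \<Longrightarrow>
    energy (\<lambda>x. snd (V x)) powr (1 / p) \<le> T \<Longrightarrow> AE x in M. fst (V x) \<le> K * T"
    using supercritical_embedding[OF dim s] by blast
  define F where "F = (LINT x|M. \<bar>f x\<bar>)"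
  define T0 where "T0 = (F * K powr (1 - \<delta>)) powr (1 / (p - (1 - \<delta>)))"
  have fi: "f \<in> borel_measurable M" "integrable M (\<lambda>x. \<bar>f x\<bar>)" using f by (auto simp: Lp_def)
  have "AE x in M. v x \<le> K * max T0 1" if n: "1 \<le> n" and v: "approx_solution \<Omega> p w A \<delta> f n v" for n v
  proof -
    note vX = approx_solution_X[OF v]
    obtain B where B: "AE x in M. 0 < v x \<and> v x \<le> B" using vX(3) by blast
    have B': "AE x in M. 0 \<le> fst (v x, weak_gradient \<Omega> v x) \<and> fst (v x, weak_gradient \<Omega> v x) \<le> B"
      using B by (auto elim: eventually_mono)
    let ?g = "weak_gradient \<Omega> v"
    let ?E = "energy ?g"
    let ?T = "?E powr (1 / p)"
    have le: "AE x in M. v x \<le> K * T" if "0 < T" "?T \<le> T" for T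
      using K(2)[OF vX(1) B' that(1)] that(2) by simp
    show ?thesis
    proof (cases "?E = 0")
      \<comment> \<open>The embedding asks for a positive T; with zero energy T = 1 will do, hence
        the maximum with 1.\<close>
      case True
      then have "AE x in M. v x \<le> K * 1" by (intro le) auto
      then show ?thesis by eventually_elim (use K(1) in \<open>auto intro: order_trans mult_left_mono\<close>)
    next
      case False
      have E0: "0 \<le> ?E" by (rule energy_nonneg)
      then have T: "0 < ?T" using False by simp
      have U: "(\<lambda>x. (v x, 1 *\<^sub>R ?g x)) \<in> X" using vX(1) by simp
      have hb: "AE x in M. 0 \<le> (1::real) \<and> (1::real) \<le> 1" by simp
      note TI = test_inequality[OF A v U borel_measurable_const hb]
      have "?E \<le> (LINT x|M. source \<delta> f n v x * v x)"
        using TI(3) by simp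
      also have "\<dots> \<le> (LINT x|M. \<bar>f x\<bar> * (K * ?T) powr (1 - \<delta>))"
      proof (rule integral_mono_AE[OF TI(1)])
        show "integrable M (\<lambda>x. \<bar>f x\<bar> * (K * ?T) powr (1 - \<delta>))" using fi(2) by simp
        show "AE x in M. source \<delta> f n v x * v x \<le> \<bar>f x\<bar> * (K * ?T) powr (1 - \<delta>)"
          using f(2) B le[OF T order_refl]
        proof eventually_elim
          fix x assume x: "0 \<le> f x" "0 < v x \<and> v x \<le> B" "v x \<le> K * ?T"
          have "source \<delta> f n v x * v x \<le> f x / v x powr \<delta> * v x"
            using source_le[of f x v \<delta> n] x \<delta> n by (intro mult_right_mono) auto
          also have "\<dots> = f x * v x powr (1 - \<delta>)" using x by (simp add: powr_diff)
          also have "\<dots> \<le> \<bar>f x\<bar> * (K * ?T) powr (1 - \<delta>)"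
            using x \<delta> by (intro mult_mono powr_mono2) auto
          finally show "source \<delta> f n v x * v x \<le> \<bar>f x\<bar> * (K * ?T) powr (1 - \<delta>)" .
        qed
      qed
      also have "\<dots> = F * K powr (1 - \<delta>) * ?T powr (1 - \<delta>)"
        using K(1) T by (simp add: F_def powr_mult)
      finally have "?T powr p \<le> F * K powr (1 - \<delta>) * ?T powr (1 - \<delta>)"
        using E0 p_gt_1 by (simp add: powr_powr)
      then have "?T \<le> T0"
        unfolding T0_def by (rule powr_absorb) (use p_gt_1 \<delta> in \<open>auto simp: F_def\<close>)
      then have "AE x in M. v x \<le> K * max T0 1" by (intro le) auto
      then show ?thesis .
    qed
  qed
  then show ?thesis by blast
qed

section \<open>Passage to the limit\<close>

lemma limit_Lp:
  assumes t: "0 < t" and un: "\<And>n. 1 \<le> n \<Longrightarrow> approx_solution \<Omega> p w A \<delta> f n (un n)"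
    and lim: "AE x in M. (\<lambda>n. un n x) \<longlonglongrightarrow> u x" and u: "u \<in> borel_measurable M"
    and K: "\<And>n. 1 \<le> n \<Longrightarrow> (LINT x|M. un n x powr t) \<le> K"
  shows "u \<in> Lp \<Omega> t"
proof -
  \<comment> \<open>The sequence is shifted because the approximating problem is only posed for n
    \<ge> 1; nothing is known of \<open>un 0\<close>.\<close>
  have pos: "AE x in M. 0 < un (Suc n) x" for n
    using un[of "Suc n"] by (simp add: approx_solution_def)
  have i: "integrable M (\<lambda>x. un (Suc n) x powr t)" for n
  proof -
    note vX = approx_solution_X[OF un[of "Suc n"]]
    obtain B where "AE x in M. 0 < un (Suc n) x \<and> un (Suc n) x \<le> B" using vX(3) by auto
    then have "AE x in M. 0 \<le> un (Suc n) x \<and> un (Suc n) x \<le> B" by (auto elim: eventually_mono)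
    then show ?thesis using t vX(2) by (intro bounded_powr_integrable) auto
  qed
  have "AE x in M. \<forall>n. 0 < un (Suc n) x" using pos by (simp add: AE_all_countable)
  with lim have l: "AE x in M. (\<lambda>n. un (Suc n) x powr t) \<longlonglongrightarrow> \<bar>u x\<bar> powr t"
  proof eventually_elim
    fix x assume x: "(\<lambda>n. un n x) \<longlonglongrightarrow> u x" "\<forall>n. 0 < un (Suc n) x"
    have l: "(\<lambda>n. un (Suc n) x) \<longlonglongrightarrow> u x" using x(1) by (rule LIMSEQ_Suc)
    have "0 \<le> u x" using x(2) by (intro LIMSEQ_le_const[OF l]) (auto intro: less_imp_le)
    then show "(\<lambda>n. un (Suc n) x powr t) \<longlonglongrightarrow> \<bar>u x\<bar> powr t"
      using t x(2) by (auto intro!: tendsto_powr2 l always_eventually less_imp_le)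
  qed
  have "integrable M (\<lambda>x. \<bar>u x\<bar> powr t)"
    by (rule Fatou_bound(1)[OF i _ _ l K tendsto_const]) (use u in auto)
  then show ?thesis using u by (simp add: Lp_def)
qed

lemma limit_Linfinity:
  assumes un: "\<And>n. 1 \<le> n \<Longrightarrow> approx_solution \<Omega> p w A \<delta> f n (un n)"
    and lim: "AE x in M. (\<lambda>n. un n x) \<longlonglongrightarrow> u x" and u: "u \<in> borel_measurable M"
    and K: "\<And>n. 1 \<le> n \<Longrightarrow> AE x in M. un n x \<le> K"
  shows "u \<in> Linfinity \<Omega>"
proof -
  have "AE x in M. \<forall>n. 0 < un (Suc n) x \<and> un (Suc n) x \<le> K"
    using un K by (auto simp: AE_all_countable approx_solution_def)
  with lim have "AE x in M. \<bar>u x\<bar> \<le> K"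
  proof eventually_elim
    fix x assume x: "(\<lambda>n. un n x) \<longlonglongrightarrow> u x" "\<forall>n. 0 < un (Suc n) x \<and> un (Suc n) x \<le> K"
    have l: "(\<lambda>n. un (Suc n) x) \<longlonglongrightarrow> u x" using x(1) by (rule LIMSEQ_Suc)
    have "0 \<le> u x" using x(2) by (intro LIMSEQ_le_const[OF l]) (auto intro: less_imp_le)
    moreover have "u x \<le> K" using x(2) by (intro LIMSEQ_le_const2[OF l]) auto
    ultimately show "\<bar>u x\<bar> \<le> K" by simp
  qed
  then show ?thesis using u by (auto simp: Linfinity_def)
qed

end

theorem theorem3p3:
  fixes \<Omega> :: "'a::euclidean_space set"
    and w f u :: "'a \<Rightarrow> real"
    and A :: "'a \<Rightarrow> 'a \<Rightarrow> 'a"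
    and un :: "nat \<Rightarrow> 'a \<Rightarrow> real"
    and p s \<delta> N ps pstar :: real
  defines "N \<equiv> real DIM('a)"
    and "ps \<equiv> p_sub p s"
    and "pstar \<equiv> sobolev_exp N ps"
  assumes "DIM('a) \<ge> 2" and "bounded_smooth_domain \<Omega>"
    and "1 < p" and "s \<ge> 1 / (p - 1)" and "s > N / p"
    and "As_weight \<Omega> p s w"
    and "structure_conditions \<Omega> p w A"
    and "0 < \<delta>" and "\<delta> < 1"
    and "f \<in> borel_measurable (lebesgue_on \<Omega>)"
    and "AE x in lebesgue_on \<Omega>. 0 \<le> f x"
    and "\<not> (AE x in lebesgue_on \<Omega>. f x = 0)"
    and "\<forall>n\<ge>1. approx_solution \<Omega> p w A \<delta> f n (un n)"
    and "AE x in lebesgue_on \<Omega>. (\<lambda>n. un n x) \<longlonglongrightarrow> u x"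
    and "u \<in> W1p_0 \<Omega> p w"
    and "weak_solution \<Omega> p w A \<delta> f u"
  shows
    "(1 \<le> ps \<and> ps < N \<longrightarrow>
        (\<forall>m. conj_exp (pstar / (1 - \<delta>)) \<le> m \<and> m < pstar / (pstar - p) \<and> f \<in> Lp \<Omega> m
             \<longrightarrow> u \<in> Lp \<Omega> (pstar * gain \<delta> p m pstar)) \<and>
        (\<forall>m. m > pstar / (pstar - p) \<and> f \<in> Lp \<Omega> m \<longrightarrow> u \<in> Linfinity \<Omega>)) \<and>
     (ps = N \<longrightarrow>
        (\<forall>q m. q > p \<and> conj_exp (q / (1 - \<delta>)) < m \<and> m < q / (q - p) \<and> f \<in> Lp \<Omega> m
               \<longrightarrow> u \<in> Lp \<Omega> (q * gain \<delta> p m q))) \<and>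
     (ps > N \<and> f \<in> Lp \<Omega> 1 \<longrightarrow> u \<in> Linfinity \<Omega>)"
proof -
  have \<Omega>: "open \<Omega>" "bounded \<Omega>" using assms(5) by (auto simp: bounded_smooth_domain_def)
  have p: "1 < p" and \<delta>: "0 < \<delta>" "\<delta> < 1" and s: "0 < s"
    using assms(6,7,11,12) by (auto intro: less_le_trans[of 0 "1 / (p - 1)"])
  have dim: "DIM('a) \<ge> 2" by fact
  have Ap: "Ap_weight p w" and ws: "integrable (lebesgue_on \<Omega>) (\<lambda>x. w x powr (- s))"
    using assms(9) by (auto simp: As_weight_def)
  \<comment> \<open>The conditions on the weight are local: w is integrable over the compact closure
    of \<Omega>, its dual power over a ball containing \<Omega>, and both restrict to
    \<Omega>.\<close>
  interpret weighted_domain \<Omega> p w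
  proof
    have "compact (closure \<Omega>)" using \<Omega>(2) by simp
    then have "integrable (lebesgue_on (closure \<Omega>)) w"
      using Ap by (auto simp: Ap_weight_def locally_integrable_on_def)
    then show "integrable (lebesgue_on \<Omega>) w"
      by (rule integrable_lebesgue_on_subset) (use \<Omega>(1) closure_subset in auto)
    have "AE x in lebesgue. 0 < w x" using Ap by (simp add: Ap_weight_def)
    then show "AE x in lebesgue_on \<Omega>. 0 < w x"
      using \<Omega>(1) by (subst AE_restrict_space_iff) (auto elim: eventually_mono)
    obtain r where r: "\<Omega> \<subseteq> ball 0 r" "0 < r"
      using \<Omega>(2) bounded_subset_ballD by blast
    then have "integrable (lebesgue_on (ball 0 r)) (\<lambda>x. w x powr (- 1 / (p - 1)))"
      using Ap by (auto simp: Ap_weight_def)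
    then show "integrable (lebesgue_on \<Omega>) (\<lambda>x. w x powr (- 1 / (p - 1)))"
      by (rule integrable_lebesgue_on_subset) (use r \<Omega>(1) in auto)
  qed (use \<Omega> p in auto)
  have f0: "AE x in M. 0 \<le> f x" by fact
  have A: "structure_conditions \<Omega> p w A" by fact
  have un: "\<And>n. 1 \<le> n \<Longrightarrow> approx_solution \<Omega> p w A \<delta> f n (un n)" using assms(16) by blast
  have lim: "AE x in M. (\<lambda>n. un n x) \<longlonglongrightarrow> u x" by fact
  have um: "u \<in> borel_measurable M" using assms(18) by (simp add: W1p_0_def W1p_def)
  \<comment> \<open>Stated for any q with an embedding, so that cases (a)(i) and (b) differ only in
    where the embedding comes from.\<close>
  have Lt: "u \<in> Lp \<Omega> (q * gain \<delta> p m q)"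
    if H: "\<exists>C>0. embeds q C" "p < q" "conj_exp (q / (1 - \<delta>)) \<le> m" "m < q / (q - p)" "f \<in> Lp \<Omega> m" for q m
  proof -
    obtain C where "embeds q C" "0 < C" using H(1) by blast
    note est = Lt_estimate[OF A \<delta> this H(2-5) f0]
    then obtain K where K: "\<And>n v. 1 \<le> n \<Longrightarrow> approx_solution \<Omega> p w A \<delta> f n v \<Longrightarrow> (LINT x|M. v x powr (q * gain \<delta> p m q)) \<le> K"
      by blast
    show ?thesis by (rule limit_Lp[OF est(1) un lim um K[OF _ un]])
  qed
  have Linf: "u \<in> Linfinity \<Omega>"
    if H: "\<exists>K. \<forall>n\<ge>1. \<forall>v. approx_solution \<Omega> p w A \<delta> f n v \<longrightarrow> (AE x in M. v x \<le> K)"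
  proof -
    obtain K where K: "\<And>n v. 1 \<le> n \<Longrightarrow> approx_solution \<Omega> p w A \<delta> f n v \<Longrightarrow> AE x in M. v x \<le> K"
      using H by blast
    show ?thesis by (rule limit_Linfinity[OF un lim um K[OF _ un]])
  qed
  have sub: "\<exists>C>0. embeds pstar C" "p < pstar" if "1 \<le> ps" "ps < N"
  proof -
    show "\<exists>C>0. embeds pstar C"
      using Sobolev_embedding[OF dim s ws] that by (simp add: pstar_def ps_def N_def)
    have "N < p * s" using assms(8) p by (simp add: N_def field_simps)
    then have "0 < p * (p * s - N)" using p by simp
    \<comment> \<open>This is p < N ps/(N - ps) with denominators cleared, using ps (s + 1) = p s;
      the hypothesis s > N/p is thus what makes the Sobolev exponent exceed p.\<close>
    also have "\<dots> = (N * ps - p * (N - ps)) * (s + 1)"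
    proof -
      have "ps * (s + 1) = p * s" using s by (simp add: ps_def p_sub_def)
      then have "(N + p) * (ps * (s + 1)) = (N + p) * (p * s)" by simp
      then show ?thesis by (simp add: algebra_simps)
    qed
    finally have "p * (N - ps) < N * ps" using s by (simp add: zero_less_mult_iff)
    moreover have "0 < N - ps" using that by simp
    ultimately show "p < pstar" by (simp add: pstar_def sobolev_exp_def field_simps)
  qed
  show ?thesis
  proof (intro conjI impI allI; elim conjE)
    fix m assume "1 \<le> ps" "ps < N" "conj_exp (pstar / (1 - \<delta>)) \<le> m" "m < pstar / (pstar - p)" "f \<in> Lp \<Omega> m"
    then show "u \<in> Lp \<Omega> (pstar * gain \<delta> p m pstar)" using sub by (intro Lt)
  next
    fix m assume ps: "1 \<le> ps" "ps < N" and m: "pstar / (pstar - p) < m" "f \<in> Lp \<Omega> m"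
    obtain C where "embeds pstar C" "0 < C" using sub(1)[OF ps] by blast
    from Linfinity_estimate[OF A \<delta>(1) this sub(2)[OF ps] m f0] show "u \<in> Linfinity \<Omega>" by (rule Linf)
  next
    fix q m assume "ps = N" "p < q" "conj_exp (q / (1 - \<delta>)) < m" "m < q / (q - p)" "f \<in> Lp \<Omega> m"
    then show "u \<in> Lp \<Omega> (q * gain \<delta> p m q)"
      using critical_embedding[OF dim s ws] by (intro Lt) (auto simp: ps_def N_def)
  next
    assume "N < ps" "f \<in> Lp \<Omega> 1"
    then have "\<exists>K. \<forall>n\<ge>1. \<forall>v. approx_solution \<Omega> p w A \<delta> f n v \<longrightarrow> (AE x in M. v x \<le> K)"
      by (intro Linfinity_estimate_supercritical[OF A \<delta> dim s ws _ _ f0]) (auto simp: ps_def N_def)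
    then show "u \<in> Linfinity \<Omega>" by (rule Linf)
  qed
qed

end
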